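(* 1-FTM-RM is solvable in polynomial time.
   Context: An instance $I$ consists of finite disjoint sets $R$ (residents) and $H$ (hospitals), a positive integer quota $q_h$ for each $h\in H$, for each $r\in R$ a preference list of $r$ (a sequence of distinct members of $H$, not necessarily all), and for each $h\in H$ a preference list of $h$ (a sequence of distinct members of $R$). A list is complete if it contains every member of the opposite side; an instance is complete if all lists are complete. A match is a pair $(r,h)\in R\times H$. For a set $M$ of matches, $\mathrm{res}_h M=\{r:(r,h)\in M\}$, $\mathrm{res}\,M=\{r:(r,h)\in M\text{ for some }h\}$. $J$ is an extension of $I$ (same $R,H$, quotas) if every list of $J$ has the corresponding list of $I$ as a prefix; a complete extension is a completion. An event is $(r,h)^+$ (proposal) or $(r,h)^-$ (rejection). For an event sequence $\sigma$, $\mathrm{prop}(\sigma)$, $\mathrm{rej}(\sigma)$ are the sets of matches proposed/rejected in $\sigma$ and $\mathrm{tent}(\sigma)=\mathrm{prop}(\sigma)\setminus\mathrm{rej}(\sigma)$. A match $(r,h)\in M$ is ousted from $M$ in $I$ if the list of $h$ in $I$ contains at least $q_h$ residents of $\mathrm{res}_h M$ and either $r$ is not on it or $r$ is preceded on it by at least $q_h$ residents of $\mathrm{res}_h M$. $I$-feasible sequences: the empty sequence is $I$-feasible; if $\sigma$ is $I$-feasible then $\sigma+(r,h)^+$ is $I$-feasible if $r\notin\mathrm{res}\,\mathrm{tent}(\sigma)$, $(r,h)\notin\mathrm{prop}(\sigma)$, $h$ is on the list of $r$ in $I$ and $(r,h')\in\mathrm{rej}(\sigma)$ for every $h'$ preceding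 $h$ on it; and $\sigma+(r,h)^-$ is $I$-feasible if $(r,h)$ is ousted from $\mathrm{prop}(\sigma)$ in $I$ and $(r,h)\notin\mathrm{rej}(\sigma)$. All maximal $I$-feasible sequences contain the same events; $\mathrm{prop}(I),\mathrm{tent}(I)$ denote $\mathrm{prop}(\sigma),\mathrm{tent}(\sigma)$ for any maximal $I$-feasible $\sigma$. A match $(r,h)\in\mathrm{tent}(I)$ is finalizable in $I$ if $(r,h)\in\mathrm{tent}(J)$ for every completion $J$ of $I$. $I$ is resident-minimal if $\mathrm{prop}(I)$ equals the set of matches $(r,h)$ with $h$ on the list of $r$ in $I$. 1-FTM-RM is the problem: given a resident-minimal instance $I$ (lists written explicitly) in which every hospital has quota at most 1, and a match $(r,h)\in\mathrm{tent}(I)$, decide whether $(r,h)$ is finalizable in $I$. *)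

theory Defs
  imports Main "HOL-Library.Sublist"
begin

record ('r, 'h) inst =
  Res   :: "'r set"
  Hos   :: "'h set"
  quota :: "'h \<Rightarrow> nat"
  rlist :: "'r \<Rightarrow> 'h list"
  hlist :: "'h \<Rightarrow> 'r list"

definition valid_inst :: "('r, 'h) inst \<Rightarrow> bool" where
  "valid_inst I \<longleftrightarrow> finite (Res I) \<and> finite (Hos I)
     \<and> (\<forall>h\<in>Hos I. 0 < quota I h)
     \<and> (\<forall>r\<in>Res I. distinct (rlist I r) \<and> set (rlist I r) \<subseteq> Hos I)
     \<and> (\<forall>h\<in>Hos I. distinct (hlist I h) \<and> set (hlist I h) \<subseteq> Res I)"

definition extension :: "('r, 'h) inst \<Rightarrow> ('r, 'h) inst \<Rightarrow> bool" where
  "extension I J \<longleftrightarrow> valid_inst J \<and> Res J = Res I \<and> Hos J = Hos I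
     \<and> (\<forall>h\<in>Hos I. quota J h = quota I h)
     \<and> (\<forall>r\<in>Res I. prefix (rlist I r) (rlist J r))
     \<and> (\<forall>h\<in>Hos I. prefix (hlist I h) (hlist J h))"

definition complete_inst :: "('r, 'h) inst \<Rightarrow> bool" where
  "complete_inst J \<longleftrightarrow> (\<forall>r\<in>Res J. set (rlist J r) = Hos J)
     \<and> (\<forall>h\<in>Hos J. set (hlist J h) = Res J)"

definition completion :: "('r, 'h) inst \<Rightarrow> ('r, 'h) inst \<Rightarrow> bool" where
  "completion I J \<longleftrightarrow> extension I J \<and> complete_inst J"

datatype ('r, 'h) event = Prop 'r 'h | Rej 'r 'h

definition propS :: "('r, 'h) event list \<Rightarrow> ('r \<times> 'h) set" where
  "propS \<sigma> = {(r, h). Prop r h \<in> set \<sigma>}"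

definition rejS :: "('r, 'h) event list \<Rightarrow> ('r \<times> 'h) set" where
  "rejS \<sigma> = {(r, h). Rej r h \<in> set \<sigma>}"

definition tentS :: "('r, 'h) event list \<Rightarrow> ('r \<times> 'h) set" where
  "tentS \<sigma> = propS \<sigma> - rejS \<sigma>"

definition res_h :: "('r \<times> 'h) set \<Rightarrow> 'h \<Rightarrow> 'r set" where
  "res_h M h = {r. (r, h) \<in> M}"

definition res_all :: "('r \<times> 'h) set \<Rightarrow> 'r set" where
  "res_all M = {r. \<exists>h. (r, h) \<in> M}"

definition ousted :: "('r, 'h) inst \<Rightarrow> ('r \<times> 'h) set \<Rightarrow> 'r \<Rightarrow> 'h \<Rightarrow> bool" where
  "ousted I M r h \<longleftrightarrow> (r, h) \<in> M
     \<and> quota I h \<le> card (set (hlist I h) \<inter> res_h M h)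
     \<and> (r \<notin> set (hlist I h)
        \<or> quota I h \<le> card (set (takeWhile (\<lambda>x. x \<noteq> r) (hlist I h)) \<inter> res_h M h))"

inductive feasible :: "('r, 'h) inst \<Rightarrow> ('r, 'h) event list \<Rightarrow> bool" for I where
  feas_Nil: "feasible I []"
| feas_Prop: "feasible I \<sigma> \<Longrightarrow> r \<in> Res I \<Longrightarrow> r \<notin> res_all (tentS \<sigma>)
     \<Longrightarrow> (r, h) \<notin> propS \<sigma> \<Longrightarrow> h \<in> set (rlist I r)
     \<Longrightarrow> (\<forall>h'\<in>set (takeWhile (\<lambda>x. x \<noteq> h) (rlist I r)). (r, h') \<in> rejS \<sigma>)
     \<Longrightarrow> feasible I (\<sigma> @ [Prop r h])"
| feas_Rej: "feasible I \<sigma> \<Longrightarrow> ousted I (propS \<sigma>) r h \<Longrightarrow> (r, h) \<notin> rejS \<sigma>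
     \<Longrightarrow> feasible I (\<sigma> @ [Rej r h])"

definition maximal_feasible :: "('r, 'h) inst \<Rightarrow> ('r, 'h) event list \<Rightarrow> bool" where
  "maximal_feasible I \<sigma> \<longleftrightarrow> feasible I \<sigma> \<and> (\<forall>e. \<not> feasible I (\<sigma> @ [e]))"

text \<open>prop(I), tent(I): taken from some maximal feasible sequence (the paper shows
  all maximal feasible sequences contain the same events).\<close>
definition propI :: "('r, 'h) inst \<Rightarrow> ('r \<times> 'h) set" where
  "propI I = propS (SOME \<sigma>. maximal_feasible I \<sigma>)"

definition tentI :: "('r, 'h) inst \<Rightarrow> ('r \<times> 'h) set" where
  "tentI I = tentS (SOME \<sigma>. maximal_feasible I \<sigma>)"

definition finalizable :: "('r, 'h) inst \<Rightarrow> 'r \<Rightarrow> 'h \<Rightarrow> bool" where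
  "finalizable I r h \<longleftrightarrow> (r, h) \<in> tentI I
     \<and> (\<forall>J. completion I J \<longrightarrow> (r, h) \<in> tentI J)"

definition resident_minimal :: "('r, 'h) inst \<Rightarrow> bool" where
  "resident_minimal I \<longleftrightarrow> propI I = {(r, h). r \<in> Res I \<and> h \<in> set (rlist I r)}"

definition ftm_rm_input :: "('r, 'h) inst \<Rightarrow> 'r \<Rightarrow> 'h \<Rightarrow> bool" where
  "ftm_rm_input I r h \<longleftrightarrow> valid_inst I \<and> resident_minimal I
     \<and> (\<forall>h'\<in>Hos I. quota I h' \<le> 1) \<and> (r, h) \<in> tentI I"

definition enc_num :: "nat \<Rightarrow> nat list" where
  "enc_num k = replicate k 1 @ [2]"

definition rank :: "nat set \<Rightarrow> nat \<Rightarrow> nat" where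
  "rank A x = card {y\<in>A. y < x}"

definition enc_list :: "nat set \<Rightarrow> nat list \<Rightarrow> nat list" where
  "enc_list A xs = concat (map (\<lambda>x. enc_num (rank A x)) xs) @ [3]"

definition encode :: "(nat, nat) inst \<Rightarrow> nat \<Rightarrow> nat \<Rightarrow> nat list" where
  "encode I r h =
     enc_num (card (Res I)) @ enc_num (card (Hos I))
     @ concat (map (\<lambda>x. enc_list (Hos I) (rlist I x)) (sorted_list_of_set (Res I)))
     @ concat (map (\<lambda>y. enc_num (quota I y) @ enc_list (Res I) (hlist I y))
                   (sorted_list_of_set (Hos I)))
     @ enc_num (rank (Res I) r) @ enc_num (rank (Hos I) h)"

datatype move = MLeft | MRight | MStay

text \<open>States 0..<tm_states (start 0, accept 1, reject 2, both halting);
  tape symbols 0..<tm_symbols, 0 is the blank.\<close>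
record tm =
  tm_states  :: nat
  tm_symbols :: nat
  tm_delta   :: "nat \<Rightarrow> nat \<Rightarrow> nat \<times> nat \<times> move"

definition wf_tm :: "tm \<Rightarrow> bool" where
  "wf_tm M \<longleftrightarrow> 3 \<le> tm_states M \<and> 4 \<le> tm_symbols M
     \<and> (\<forall>q<tm_states M. \<forall>a<tm_symbols M.
          fst (tm_delta M q a) < tm_states M \<and> fst (snd (tm_delta M q a)) < tm_symbols M)"

text \<open>Configuration: state, reversed tape left of head, symbol under head, tape right of head.\<close>
type_synonym config = "nat \<times> nat list \<times> nat \<times> nat list"

definition hd0 :: "nat list \<Rightarrow> nat" where
  "hd0 xs = (case xs of [] \<Rightarrow> 0 | x # _ \<Rightarrow> x)"

definition tm_step :: "tm \<Rightarrow> config \<Rightarrow> config" where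
  "tm_step M c = (case c of (q, ls, a, rs) \<Rightarrow>
     if q = 1 \<or> q = 2 then c else
     (case tm_delta M q a of (q', b, d) \<Rightarrow>
       (case d of
          MLeft \<Rightarrow> (q', tl ls, hd0 ls, b # rs)
        | MRight \<Rightarrow> (q', b # ls, hd0 rs, tl rs)
        | MStay \<Rightarrow> (q', ls, b, rs))))"

definition tm_init :: "nat list \<Rightarrow> config" where
  "tm_init w = (0, [], hd0 w, tl w)"

definition tm_run :: "tm \<Rightarrow> nat \<Rightarrow> nat list \<Rightarrow> config" where
  "tm_run M t w = (tm_step M ^^ t) (tm_init w)"

end

theory Submission
  imports Defs "HOL-Library.Nat_Bijection"
begin

text \<open>
  With all quotas equal to 1, call a resident exhaustible if some completion makes every hospital
  on his list reject him. Since the instance is resident-minimal, only the last hospital of a list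
  can be undecided, so \<open>z\<close> is exhaustible iff his list is empty or some \<open>y\<close> that can still be
  ranked above \<open>z\<close> by the last hospital \<open>g\<close> of \<open>z\<close> either has \<open>g\<close> on his list or is
  exhaustible himself. Along a shortest chain of such displacements all hospitals are distinct, so a
  single completion realises the whole chain; hence \<open>(r, h)\<close> is finalizable iff \<open>r\<close> is not
  exhaustible.

  On the encoded word, exhaustibility is the least fixed point of a unary operator definable in
  first-order logic with counting. Every such fixed point is computed in polynomial time by a
  program whose store is a fixed number of sets of tape positions and whose elementary operations are
  finite-state sweeps over the tape; the cells of the Turing machine record to which sets their
  position belongs, and its states are the continuations of the program.
\<close>

section \<open>Feasible sequences\<close>

text \<open>Why a shortest chain hardly repeats a hospital: minimality makes every resident after
  the first one not \<open>free\<close>. Two such residents with the same last hospital both propose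
  there in \<open>I\<close>, so neither could beat the other, although of two distinct residents one
  always can. Only the hospital of the first resident may recur, and then the later resident is
  already ranked above him in \<open>I\<close>. This matters because a completion fixes a single
  continuation of each list.

  The length of a chain is unbounded, which is why exhaustibility enters as a least fixed point and
  not as one formula. Unary codes make this possible on the word: every number in the input is at
  most the word length, so a variable that ranges over tape positions serves as a number as well.
  Counting recovers ranks from runs of ones and block indices from terminators. A variable is a
  register holding one position, so a loop over all values is a repeated shift.\<close>

lemma propS_simps [simp]:
  "propS [] = {}" "propS (\<sigma> @ [Prop r h]) = insert (r, h) (propS \<sigma>)" "propS (\<sigma> @ [Rej r h]) = propS \<sigma>"
  by (auto simp: propS_def)

lemma rejS_simps [simp]:
  "rejS [] = {}" "rejS (\<sigma> @ [Prop r h]) = rejS \<sigma>" "rejS (\<sigma> @ [Rej r h]) = insert (r, h) (rejS \<sigma>)"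
  by (auto simp: rejS_def)

lemma propS_mono: "set \<sigma> \<subseteq> set \<tau> \<Longrightarrow> propS \<sigma> \<subseteq> propS \<tau>"
  and rejS_mono: "set \<sigma> \<subseteq> set \<tau> \<Longrightarrow> rejS \<sigma> \<subseteq> rejS \<tau>"
  by (auto simp: propS_def rejS_def)

lemma ousted_mono:
  assumes "ousted I M r h" "M \<subseteq> M'"
  shows "ousted I M' r h"
proof -
  have "card (S \<inter> res_h M h) \<le> card (S \<inter> res_h M' h)" if "finite S" for S
    using assms(2) that by (intro card_mono) (auto simp: res_h_def)
  then show ?thesis
    using assms unfolding ousted_def by (blast intro: le_trans)
qed

text \<open>With quota 1 both counts ask for one proposer. For a listed \<open>r\<close> the first
  count follows from the second; for an unlisted \<open>r\<close> the part of the list before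
  \<open>r\<close> is the whole list, so the two cases merge.\<close>

lemma ousted_quota_one:
  assumes "quota I h = 1"
  shows "ousted I M r h \<longleftrightarrow> (r, h) \<in> M \<and> (\<exists>y\<in>set (takeWhile (\<lambda>x. x \<noteq> r) (hlist I h)). (y, h) \<in> M)"
proof -
  have card: "1 \<le> card (S \<inter> res_h M h) \<longleftrightarrow> (\<exists>y\<in>S. (y, h) \<in> M)" if "finite S" for S
    using that by (auto simp: res_h_def Suc_le_eq card_gt_0_iff)
  have all: "takeWhile (\<lambda>x. x \<noteq> r) (hlist I h) = hlist I h" if "r \<notin> set (hlist I h)"
    using that by (auto simp: takeWhile_eq_all_conv)
  show ?thesis
  proof (cases "r \<in> set (hlist I h)")
    case True
    have "set (takeWhile (\<lambda>x. x \<noteq> r) (hlist I h)) \<subseteq> set (hlist I h)"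
      by (meson set_takeWhileD subsetI)
    then show ?thesis
      unfolding ousted_def assms card[OF List.finite_set] using True by blast
  next
    case False
    then show ?thesis
      unfolding ousted_def assms card[OF List.finite_set] by (simp add: all)
  qed
qed

lemma feasible_rej_prop: "feasible I \<sigma> \<Longrightarrow> rejS \<sigma> \<subseteq> propS \<sigma>"
  by (induction rule: feasible.induct) (auto simp: ousted_def)

lemma feasible_prop_listed:
  "feasible I \<sigma> \<Longrightarrow> (r, h) \<in> propS \<sigma> \<Longrightarrow> r \<in> Res I \<and> h \<in> set (rlist I r)"
  by (induction rule: feasible.induct) auto

lemma feasible_prop_order:
  "feasible I \<sigma> \<Longrightarrow> (r, h) \<in> propS \<sigma> \<Longrightarrow> h' \<in> set (takeWhile (\<lambda>x. x \<noteq> h) (rlist I r)) \<Longrightarrow> (r, h') \<in> rejS \<sigma>"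
  by (induction rule: feasible.induct) auto

lemma feasible_distinct: "feasible I \<sigma> \<Longrightarrow> distinct \<sigma>"
  by (induction rule: feasible.induct) (auto simp: propS_def rejS_def)

text \<open>Feasible sequences repeat no event and draw from the finite set \<open>E\<close>, so
  their lengths are bounded and a longest one cannot be extended.\<close>

lemma maximal_feasible_exists:
  assumes "valid_inst I"
  shows "\<exists>\<sigma>. maximal_feasible I \<sigma>"
proof -
  define E where "E = (\<lambda>(r, h). Prop r h) ` (Res I \<times> Hos I) \<union> (\<lambda>(r, h). Rej r h) ` (Res I \<times> Hos I)"
  have fin: "finite E"
    using assms by (simp add: E_def valid_inst_def)
  have sub: "set \<sigma> \<subseteq> E" if f: "feasible I \<sigma>" for \<sigma>
  proof
    fix e assume e: "e \<in> set \<sigma>"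
    have p: "(r, h) \<in> Res I \<times> Hos I" if "(r, h) \<in> propS \<sigma>" for r h
      using feasible_prop_listed[OF f that] assms by (auto simp: valid_inst_def)
    show "e \<in> E"
    proof (cases e)
      case (Prop r h)
      then have "(r, h) \<in> Res I \<times> Hos I"
        using e by (intro p) (simp add: propS_def)
      then show ?thesis
        unfolding Prop E_def by blast
    next
      case (Rej r h)
      then have "(r, h) \<in> rejS \<sigma>"
        using e by (simp add: rejS_def)
      then have "(r, h) \<in> Res I \<times> Hos I"
        using feasible_rej_prop[OF f] by (intro p) blast
      then show ?thesis
        unfolding Rej E_def by blast
    qed
  qed
  have len: "length \<sigma> \<le> card E" if "feasible I \<sigma>" for \<sigma>
    using card_mono[OF fin sub[OF that]] distinct_card[OF feasible_distinct[OF that]] by simp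
  have bnd: "\<forall>\<tau>. feasible I \<tau> \<longrightarrow> length \<tau> < Suc (card E)"
    using len by (simp add: le_imp_less_Suc)
  obtain \<sigma> where \<sigma>: "feasible I \<sigma>" "\<forall>\<tau>. feasible I \<tau> \<longrightarrow> length \<tau> \<le> length \<sigma>"
    using ex_has_greatest_nat[OF feas_Nil bnd] by blast
  have "\<not> feasible I (\<sigma> @ [e])" for e
    using \<sigma>(2) by (metis length_append_singleton Suc_n_not_le_n)
  then have "maximal_feasible I \<sigma>"
    using \<sigma>(1) by (simp add: maximal_feasible_def)
  then show ?thesis ..
qed

definition final_seq :: "('r, 'h) inst \<Rightarrow> ('r, 'h) event list" where
  "final_seq I = (SOME \<sigma>. maximal_feasible I \<sigma>)"

lemma maximal_final_seq: "valid_inst I \<Longrightarrow> maximal_feasible I (final_seq I)"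
  unfolding final_seq_def using maximal_feasible_exists by (rule someI_ex)

lemma maximal_feasible_rej:
  "maximal_feasible I \<tau> \<Longrightarrow> ousted I (propS \<tau>) r h \<Longrightarrow> (r, h) \<in> rejS \<tau>"
  using feas_Rej[of I \<tau> r h] by (auto simp: maximal_feasible_def)

lemma takeWhile_neq_linear:
  "a \<noteq> b \<Longrightarrow> a \<in> set xs \<Longrightarrow> b \<notin> set (takeWhile (\<lambda>x. x \<noteq> a) xs) \<Longrightarrow> a \<in> set (takeWhile (\<lambda>x. x \<noteq> b) xs)"
  by (induction xs) (auto split: if_splits)

text \<open>The precondition that \<open>r\<close> is unmatched takes care of itself: a hospital
  \<open>g\<close> holding \<open>r\<close> would be listed before \<open>h\<close>, hence rejected
  by \<open>prev\<close>, or after \<open>h\<close>, and then \<open>h\<close> would already have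
  been proposed to.\<close>

lemma maximal_feasible_prop:
  assumes m: "maximal_feasible I \<tau>" and r: "r \<in> Res I" and h: "h \<in> set (rlist I r)"
    and prev: "\<And>h'. h' \<in> set (takeWhile (\<lambda>x. x \<noteq> h) (rlist I r)) \<Longrightarrow> (r, h') \<in> rejS \<tau>"
  shows "(r, h) \<in> propS \<tau>"
proof (rule ccontr)
  assume n: "(r, h) \<notin> propS \<tau>"
  have f: "feasible I \<tau>"
    using m by (simp add: maximal_feasible_def)
  have "r \<notin> res_all (tentS \<tau>)"
  proof
    assume "r \<in> res_all (tentS \<tau>)"
    then obtain g where g: "(r, g) \<in> propS \<tau>" "(r, g) \<notin> rejS \<tau>"
      by (auto simp: res_all_def tentS_def)
    have "h \<noteq> g" using g n by auto
    have "g \<notin> set (takeWhile (\<lambda>x. x \<noteq> h) (rlist I r))"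
      using g prev by blast
    moreover have "h \<notin> set (takeWhile (\<lambda>x. x \<noteq> g) (rlist I r))"
      using feasible_prop_order[OF f g(1)] feasible_rej_prop[OF f] n by blast
    ultimately show False
      using takeWhile_neq_linear[OF \<open>h \<noteq> g\<close> h] by blast
  qed
  then have "feasible I (\<tau> @ [Prop r h])"
    using f r n h prev by (intro feas_Prop) auto
  then show False
    using m by (auto simp: maximal_feasible_def)
qed

text \<open>An enabled event stays enabled, apart from the requirement that the resident is
  unmatched, which \<open>maximal_feasible_prop\<close> removes. So all maximal sequences have the
  same events, and the choice by \<open>SOME\<close> is harmless.\<close>

lemma feasible_subset_maximal:
  assumes "feasible I \<sigma>" "maximal_feasible I \<tau>"
  shows "set \<sigma> \<subseteq> set \<tau>"
  using assms(1)
proof (induction rule: feasible.induct)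
  case feas_Nil
  then show ?case by simp
next
  case (feas_Prop \<sigma> r h)
  have "(r, h) \<in> propS \<tau>"
    using feas_Prop rejS_mono[OF feas_Prop.IH] by (intro maximal_feasible_prop[OF assms(2)]) auto
  then show ?case
    using feas_Prop by (auto simp: propS_def)
next
  case (feas_Rej \<sigma> r h)
  have "(r, h) \<in> rejS \<tau>"
    using maximal_feasible_rej[OF assms(2) ousted_mono[OF feas_Rej(2) propS_mono[OF feas_Rej.IH]]] .
  then show ?case
    using feas_Rej by (auto simp: rejS_def)
qed

text \<open>Whether some completion of \<open>I\<close> ranks \<open>y\<close> above \<open>z\<close> at the hospital \<open>g\<close>.\<close>
definition can_beat :: "('r, 'h) inst \<Rightarrow> 'h \<Rightarrow> 'r \<Rightarrow> 'r \<Rightarrow> bool" where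
  "can_beat I g y z \<longleftrightarrow> y \<noteq> z \<and> (z \<notin> set (hlist I g) \<or> y \<in> set (takeWhile (\<lambda>x. x \<noteq> z) (hlist I g)))"

text \<open>The residents that exhaust their list in some completion.\<close>
inductive_set exhausts :: "('r, 'h) inst \<Rightarrow> 'r set" for I where
  exhausts_Nil: "z \<in> Res I \<Longrightarrow> rlist I z = [] \<Longrightarrow> z \<in> exhausts I"
| exhausts_step: "z \<in> Res I \<Longrightarrow> rlist I z \<noteq> [] \<Longrightarrow> y \<in> Res I \<Longrightarrow> can_beat I (last (rlist I z)) y z
    \<Longrightarrow> last (rlist I z) \<in> set (rlist I y) \<or> y \<in> exhausts I \<Longrightarrow> z \<in> exhausts I"

lemma takeWhile_prefix_subset:
  "prefix xs ys \<Longrightarrow> set (takeWhile P xs) \<subseteq> set (takeWhile P ys)"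
  by (auto simp: prefix_def takeWhile_append dest: set_takeWhileD)

lemma takeWhile_prefix_eq:
  "prefix xs ys \<Longrightarrow> z \<in> set xs \<Longrightarrow> takeWhile (\<lambda>x. x \<noteq> z) ys = takeWhile (\<lambda>x. x \<noteq> z) xs"
  by (auto simp: prefix_def)

lemma before_last:
  "distinct xs \<Longrightarrow> x \<in> set xs \<Longrightarrow> x \<noteq> last xs \<Longrightarrow> x \<in> set (takeWhile (\<lambda>x. x \<noteq> last xs) xs)"
  by (induction xs rule: rev_induct) (auto simp: takeWhile_append)

text \<open>Proposals carry over because the hospitals before a listed \<open>h\<close> stay the
  same. Rejections carry over because with quota 1 they ask for a proposer earlier in the list, and
  a resident who was unlisted lands behind all listed ones.\<close>

lemma extension_feasible:
  assumes v: "valid_inst I" and ext: "extension I J" and one: "\<And>h. h \<in> Hos I \<Longrightarrow> quota I h = 1"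
    and f: "feasible I \<sigma>"
  shows "feasible J \<sigma>"
  using f
proof (induction rule: feasible.induct)
  case feas_Nil
  show ?case by (rule feasible.feas_Nil)
next
  case (feas_Prop \<sigma> r h)
  have p: "prefix (rlist I r) (rlist J r)"
    using ext feas_Prop by (auto simp: extension_def)
  show ?case
    using feas_Prop ext takeWhile_prefix_eq[OF p feas_Prop.hyps(5)] set_mono_prefix[OF p]
    by (intro feasible.feas_Prop) (auto simp: extension_def)
next
  case (feas_Rej \<sigma> r h)
  have h: "h \<in> Hos I"
    using feas_Rej feasible_prop_listed[of I \<sigma> r h] v by (auto simp: ousted_def valid_inst_def)
  have "ousted J (propS \<sigma>) r h"
    using feas_Rej.hyps(2) takeWhile_prefix_subset[of "hlist I h" "hlist J h"] ext one[OF h] h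
    by (auto simp: ousted_quota_one extension_def)
  then show ?case
    using feas_Rej by (intro feasible.feas_Rej) auto
qed

section \<open>Finalizability as the negation of exhaustibility\<close>

context
  fixes I :: "('r, 'h) inst" and r :: 'r and h :: 'h
  assumes input: "ftm_rm_input I r h"
begin

lemma input_valid: "valid_inst I"
  using input by (simp add: ftm_rm_input_def)

lemma input_quota: "g \<in> Hos I \<Longrightarrow> quota I g = 1"
  using input by (force simp: ftm_rm_input_def valid_inst_def)

lemma input_final_prop: "propS (final_seq I) = {(r, h). r \<in> Res I \<and> h \<in> set (rlist I r)}"
  using input by (auto simp: ftm_rm_input_def resident_minimal_def propI_def final_seq_def)

text \<open>By resident-minimality the last hospital of the list has been proposed to, and
  feasibility allows this only after all earlier ones have rejected.\<close>

lemma input_final_rej: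
  assumes "z \<in> Res I" "g \<in> set (rlist I z)" "g \<noteq> last (rlist I z)"
  shows "(z, g) \<in> rejS (final_seq I)"
proof -
  have "rlist I z \<noteq> []" using assms by auto
  then have "(z, last (rlist I z)) \<in> propS (final_seq I)"
    using assms by (auto simp: input_final_prop)
  then show ?thesis
    using feasible_prop_order before_last[OF _ assms(2,3)] maximal_final_seq[OF input_valid] assms(1) input_valid
    by (metis maximal_feasible_def valid_inst_def)
qed

lemma input_tent: "r \<in> Res I" "h \<in> set (rlist I r)" "h = last (rlist I r)"
proof -
  have t: "(r, h) \<in> propS (final_seq I)" "(r, h) \<notin> rejS (final_seq I)"
    using input by (auto simp: ftm_rm_input_def tentI_def tentS_def final_seq_def)
  then show "r \<in> Res I" "h \<in> set (rlist I r)"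
    by (auto simp: input_final_prop)
  then show "h = last (rlist I r)"
    using t input_final_rej by blast
qed

lemma listed_in: "z \<in> Res I \<Longrightarrow> g \<in> set (rlist I z) \<Longrightarrow> g \<in> Hos I"
  using input_valid by (auto simp: valid_inst_def)

lemma completion_final_mono:
  assumes "completion I J"
  shows "set (final_seq I) \<subseteq> set (final_seq J)"
proof -
  have J: "extension I J" "valid_inst J"
    using assms by (auto simp: completion_def extension_def)
  have "feasible I (final_seq I)"
    using maximal_final_seq[OF input_valid] by (simp add: maximal_feasible_def)
  then show ?thesis
    by (intro feasible_subset_maximal[OF extension_feasible[OF input_valid J(1)]]
        maximal_final_seq J input_quota)
qed

text \<open>The two claims feed each other: a rejection by the last hospital of a list of
  \<open>I\<close> is caused by a proposer who either lists it in \<open>I\<close> or has gone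
  beyond his own list, and going beyond a nonempty list takes a rejection by its last
  hospital.\<close>

lemma completion_exhausts:
  assumes J: "completion I J" and f: "feasible J \<sigma>"
  shows "(\<forall>z g. (z, g) \<in> rejS \<sigma> \<longrightarrow> rlist I z \<noteq> [] \<longrightarrow> g = last (rlist I z) \<longrightarrow> z \<in> exhausts I)
    \<and> (\<forall>z g. (z, g) \<in> propS \<sigma> \<longrightarrow> g \<notin> set (rlist I z) \<longrightarrow> z \<in> exhausts I)"
  using f
proof (induction rule: feasible.induct)
  case feas_Nil
  then show ?case by simp
next
  case (feas_Prop \<sigma> z g)
  have z: "z \<in> Res I" and p: "prefix (rlist I z) (rlist J z)"
    using feas_Prop.hyps(2) J by (auto simp: completion_def extension_def)
  have "z \<in> exhausts I" if g: "g \<notin> set (rlist I z)"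
  proof (cases "rlist I z = []")
    case True
    with z show ?thesis by (rule exhausts_Nil)
  next
    case False
    have "takeWhile (\<lambda>x. x \<noteq> g) (rlist I z) = rlist I z"
      using g by (auto simp: takeWhile_eq_all_conv)
    then have "last (rlist I z) \<in> set (takeWhile (\<lambda>x. x \<noteq> g) (rlist I z))"
      using last_in_set[OF False] by (simp only:)
    then have "(z, last (rlist I z)) \<in> rejS \<sigma>"
      using takeWhile_prefix_subset[OF p] feas_Prop.hyps(6) by blast
    then show ?thesis
      using feas_Prop.IH False by blast
  qed
  then show ?case
    using feas_Prop.IH by auto
next
  case (feas_Rej \<sigma> z g)
  have "z \<in> exhausts I" if n: "rlist I z \<noteq> []" and g: "g = last (rlist I z)"
  proof -
    have "z \<in> Res J"
      using feas_Rej.hyps feasible_prop_listed[of J \<sigma>] by (auto simp: ousted_def)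
    then have z: "z \<in> Res I"
      using J by (auto simp: completion_def extension_def)
    then have gH: "g \<in> Hos I"
      using n g listed_in by auto
    then have p: "prefix (hlist I g) (hlist J g)" and q: "quota J g = 1"
      using J input_quota by (auto simp: completion_def extension_def)
    obtain y where y: "y \<in> set (takeWhile (\<lambda>x. x \<noteq> z) (hlist J g))" "(y, g) \<in> propS \<sigma>"
      using feas_Rej.hyps(2) ousted_quota_one[OF q] by blast
    have "y \<in> Res J"
      using y feasible_prop_listed[OF feas_Rej.hyps(1)] by blast
    then have "y \<in> Res I"
      using J by (auto simp: completion_def extension_def)
    moreover have "can_beat I g y z"
      using y(1) takeWhile_prefix_eq[OF p] by (auto simp: can_beat_def dest: set_takeWhileD)
    moreover have "g \<in> set (rlist I y) \<or> y \<in> exhausts I"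
      using feas_Rej.IH y(2) by blast
    ultimately show ?thesis
      unfolding g by (rule exhausts_step[OF z n])
  qed
  then show ?case
    using feas_Rej.IH by auto
qed

lemma not_exhausts_finalizable:
  assumes "r \<notin> exhausts I"
  shows "finalizable I r h"
  unfolding finalizable_def
proof (intro conjI allI impI)
  show "(r, h) \<in> tentI I"
    using input by (simp add: ftm_rm_input_def)
  fix J assume J: "completion I J"
  then have m: "maximal_feasible J (final_seq J)"
    by (intro maximal_final_seq) (auto simp: completion_def extension_def)
  have "(r, h) \<notin> rejS (final_seq J)"
    using completion_exhausts[OF J] m assms input_tent by (fastforce simp: maximal_feasible_def)
  moreover have "(r, h) \<in> propS (final_seq J)"
    using propS_mono[OF completion_final_mono[OF J]] input_tent by (auto simp: input_final_prop)
  ultimately show "(r, h) \<in> tentI J"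
    by (simp add: tentI_def tentS_def final_seq_def)
qed

text \<open>The residents that exhaust their list because of a proposal already made in \<open>I\<close>.\<close>
definition free :: "'r \<Rightarrow> bool" where
  "free z \<longleftrightarrow> z \<in> Res I \<and> (rlist I z = [] \<or>
     (\<exists>y\<in>Res I. can_beat I (last (rlist I z)) y z \<and> last (rlist I z) \<in> set (rlist I y)))"

definition displaces :: "'r \<Rightarrow> 'r \<Rightarrow> bool" where
  "displaces y z \<longleftrightarrow> y \<in> Res I \<and> z \<in> Res I \<and> rlist I z \<noteq> [] \<and> can_beat I (last (rlist I z)) y z"

definition walk :: "(nat \<Rightarrow> 'r) \<Rightarrow> nat \<Rightarrow> 'r \<Rightarrow> bool" where
  "walk f k z \<longleftrightarrow> free (f 0) \<and> f k = z \<and> (\<forall>i<k. displaces (f i) (f (Suc i)))"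

lemma exhausts_walk:
  assumes "z \<in> exhausts I"
  shows "\<exists>k f. walk f k z"
  using assms
proof (induction rule: exhausts.induct)
  case (exhausts_Nil z)
  then have "walk (\<lambda>_. z) 0 z"
    by (auto simp: walk_def free_def)
  then show ?case by blast
next
  case (exhausts_step z y)
  show ?case
  proof (cases "last (rlist I z) \<in> set (rlist I y)")
    case True
    then have "walk (\<lambda>_. z) 0 z"
      using exhausts_step by (auto simp: walk_def free_def)
    then show ?thesis by blast
  next
    case False
    then obtain k f where "walk f k y"
      using exhausts_step by blast
    then have "walk (f(Suc k := z)) (Suc k) z"
      using exhausts_step by (auto simp: walk_def displaces_def less_Suc_eq)
    then show ?thesis by blast
  qed
qed

text \<open>In a walk of least length, a \<open>free\<close> resident after the start would allow
  dropping everything before him, and a repeated resident would allow cutting out the loop.\<close>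

lemma shortest_walk:
  assumes "z \<in> exhausts I"
  obtains k f where "walk f k z" "\<And>i. 0 < i \<Longrightarrow> i \<le> k \<Longrightarrow> \<not> free (f i)" "inj_on f {..k}"
proof -
  define k where "k = (LEAST k. \<exists>f. walk f k z)"
  obtain f where f: "walk f k z"
    using exhausts_walk[OF assms] LeastI_ex[of "\<lambda>k. \<exists>f. walk f k z"] unfolding k_def by blast
  have least: "\<not> walk g j z" if "j < k" for g j
    using not_less_Least that unfolding k_def by blast
  have "\<not> free (f i)" if "0 < i" "i \<le> k" for i
  proof
    assume "free (f i)"
    then have "walk (\<lambda>j. f (j + i)) (k - i) z"
      using f that by (auto simp: walk_def)
    then show False
      using least[of "k - i"] that by auto
  qed
  moreover have "f i \<noteq> f j" if ij: "i < j" "j \<le> k" for i j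
  proof
    assume eq: "f i = f j"
    define g where "g = (\<lambda>m. if m \<le> i then f m else f (m + (j - i)))"
    have "displaces (g m) (g (Suc m))" if m: "m < k - (j - i)" for m
    proof (cases "m < i")
      case True
      then show ?thesis using f ij by (auto simp: g_def walk_def)
    next
      case False
      have "g m = f (m + (j - i))"
        using False eq ij by (cases "m = i") (auto simp: g_def)
      moreover have "g (Suc m) = f (Suc (m + (j - i)))"
        using False by (simp add: g_def)
      ultimately show ?thesis
        using f m by (auto simp: walk_def)
    qed
    moreover have "g (k - (j - i)) = z"
      using f ij eq by (cases "j = k") (auto simp: g_def walk_def)
    ultimately have "walk g (k - (j - i)) z"
      using f by (auto simp: walk_def g_def)
    then show False
      using least[of "k - (j - i)"] ij by auto
  qed
  then have "inj_on f {..k}"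
    by (intro linorder_inj_onI) auto
  ultimately show ?thesis
    using that f by blast
qed

section \<open>Completions that realise a chain\<close>

definition complete_list :: "'a list \<Rightarrow> 'a set \<Rightarrow> 'a set \<Rightarrow> 'a list" where
  "complete_list xs S T =
     xs @ (SOME ys. distinct ys \<and> set ys = S - set xs)
        @ (SOME ys. distinct ys \<and> set ys = T - S - set xs)"

text \<open>Any enumeration of the appended sets will do, since the sets \<open>S\<close> on which
  the construction relies later are singletons or empty.\<close>

lemma complete_list_parts:
  assumes "finite T" "S \<subseteq> T"
  obtains ys zs where "complete_list xs S T = xs @ ys @ zs" "distinct ys" "set ys = S - set xs"
    "distinct zs" "set zs = T - S - set xs"
proof -
  have ex: "\<exists>ys. distinct ys \<and> set ys = U" if "U \<subseteq> T" for U
    using finite_distinct_list[of U] finite_subset[OF that assms(1)] by auto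
  show ?thesis
    by (rule that[OF complete_list_def[of xs S T]])
      (use someI_ex[OF ex, of "S - set xs"] someI_ex[OF ex, of "T - S - set xs"] assms in auto)
qed

text \<open>The completion in which \<open>z\<close> continues with the hospitals in \<open>nxt z\<close> and \<open>g\<close> with the
  residents in \<open>prv g\<close>.\<close>
definition steered :: "('r \<Rightarrow> 'h set) \<Rightarrow> ('h \<Rightarrow> 'r set) \<Rightarrow> ('r, 'h) inst" where
  "steered nxt prv = I\<lparr>rlist := \<lambda>z. complete_list (rlist I z) (nxt z) (Hos I),
     hlist := \<lambda>g. complete_list (hlist I g) (prv g) (Res I)\<rparr>"

lemma completion_steered:
  assumes "\<And>z. nxt z \<subseteq> Hos I" "\<And>g. prv g \<subseteq> Res I"
  shows "completion I (steered nxt prv)"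
proof -
  have fin: "finite (Hos I)" "finite (Res I)"
    using input_valid by (auto simp: valid_inst_def)
  have c: "distinct (complete_list xs S T) \<and> set (complete_list xs S T) = T \<and> prefix xs (complete_list xs S T)"
    if "finite T" "S \<subseteq> T" "distinct xs" "set xs \<subseteq> T" for xs :: "'a list" and S T
    by (rule complete_list_parts[OF that(1,2), of xs]) (use that in auto)
  show ?thesis
    using c[OF fin(1) assms(1)] c[OF fin(2) assms(2)] input_valid
    by (auto simp: completion_def extension_def complete_inst_def valid_inst_def steered_def)
qed

text \<open>If \<open>y\<close> is not yet ahead of \<open>z\<close>, then \<open>z\<close> is
  unlisted, and \<open>y\<close> is listed or comes first among the appended residents. The bound
  \<open>prv g \<subseteq> {y}\<close> keeps \<open>z\<close> out of this first group.\<close>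

lemma steered_beats:
  assumes "can_beat I g y z" "prv g \<subseteq> Res I" "prv g \<subseteq> {y}" "y \<notin> set (takeWhile (\<lambda>x. x \<noteq> z) (hlist I g)) \<Longrightarrow> prv g = {y}"
  shows "y \<in> set (takeWhile (\<lambda>x. x \<noteq> z) (hlist (steered nxt prv) g))"
proof -
  have fin: "finite (Res I)"
    using input_valid by (auto simp: valid_inst_def)
  obtain ys zs where c: "complete_list (hlist I g) (prv g) (Res I) = hlist I g @ ys @ zs"
    "set ys = prv g - set (hlist I g)"
    using complete_list_parts[OF fin assms(2)] by metis
  show ?thesis
  proof (cases "y \<in> set (takeWhile (\<lambda>x. x \<noteq> z) (hlist I g))")
    case True
    then show ?thesis
      using takeWhile_prefix_subset[of "hlist I g" "hlist I g @ ys @ zs"] c(1) by (auto simp: steered_def)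
  next
    case False
    then have z: "z \<notin> set (hlist I g @ ys)" and y: "y \<in> set (hlist I g @ ys)"
      using assms(1) assms(4)[OF False] c(2) by (auto simp: can_beat_def)
    have "takeWhile (\<lambda>x. x \<noteq> z) ((hlist I g @ ys) @ zs) = (hlist I g @ ys) @ takeWhile (\<lambda>x. x \<noteq> z) zs"
      using z by (intro takeWhile_append2) auto
    then show ?thesis
      using y c(1) by (auto simp: steered_def)
  qed
qed

lemma steered_next:
  assumes "nxt y \<subseteq> Hos I" "nxt y = {g}" "g \<notin> set (rlist I y)"
  shows "g \<in> set (rlist (steered nxt prv) y)"
    and "set (takeWhile (\<lambda>x. x \<noteq> g) (rlist (steered nxt prv) y)) \<subseteq> set (rlist I y)"
proof -
  have fin: "finite (Hos I)"
    using input_valid by (auto simp: valid_inst_def)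
  obtain ys zs where c: "complete_list (rlist I y) (nxt y) (Hos I) = rlist I y @ ys @ zs"
    "distinct ys" "set ys = {g}"
    by (rule complete_list_parts[OF fin assms(1), of "rlist I y"]) (use assms in auto)
  have "ys = [g]"
    using c by (cases ys) (auto simp: subset_singleton_iff)
  then show "g \<in> set (rlist (steered nxt prv) y)"
    and "set (takeWhile (\<lambda>x. x \<noteq> g) (rlist (steered nxt prv) y)) \<subseteq> set (rlist I y)"
    using c assms by (auto simp: steered_def takeWhile_append)
qed

text \<open>By induction along a shortest walk, \<open>f i\<close> exhausts his list in the steered
  completion: rejected everywhere, he proposes to \<open>G (Suc i)\<close>, where he ranks above
  \<open>f (Suc i)\<close>.\<close>

lemma exhausts_not_finalizable:
  assumes "r \<in> exhausts I"
  shows "\<not> finalizable I r h"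
proof -
  obtain k f where walk: "walk f k r" and nfree: "\<And>i. 0 < i \<Longrightarrow> i \<le> k \<Longrightarrow> \<not> free (f i)"
    and inj: "inj_on f {..k}"
    using shortest_walk[OF assms] by blast
  define G where "G = (\<lambda>i. last (rlist I (f i)))"
  have G_last: "last (rlist I (f i)) = G i" for i
    by (simp add: G_def)
  have disp: "displaces (f i) (f (Suc i))" if "i < k" for i
    using walk that by (auto simp: walk_def)
  have fR: "f i \<in> Res I" if "i \<le> k" for i
    using that walk disp[of "i - 1"] by (cases i) (auto simp: walk_def free_def displaces_def)
  have ne: "rlist I (f i) \<noteq> []" if "0 < i" "i \<le> k" for i
    using that disp[of "i - 1"] by (auto simp: displaces_def)
  have GH: "G i \<in> Hos I" "G i \<in> set (rlist I (f i))" if "rlist I (f i) \<noteq> []" "i \<le> k" for i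
    using listed_in[OF fR[OF that(2)]] that by (auto simp: G_def)
  have nbeat: "\<not> can_beat I (G i) y (f i)" if "0 < i" "i \<le> k" "y \<in> Res I" "G i \<in> set (rlist I y)" for i y
    using nfree[OF that(1,2)] fR that by (auto simp: free_def G_def)
  \<comment> \<open>Both residents list the common hospital in \<open>I\<close> and neither is
    \<open>free\<close>, so neither can beat the other there; but of two distinct residents one
    always can. Index 0 is excluded because \<open>f 0\<close> is \<open>free\<close>.\<close>
  have Ginj: "i = j" if "0 < i" "i \<le> k" "0 < j" "j \<le> k" "G i = G j" for i j
  proof (rule ccontr)
    assume "i \<noteq> j"
    then have "f i \<noteq> f j"
      using inj that by (auto simp: inj_on_def)
    moreover have "\<not> can_beat I (G i) (f j) (f i)" "\<not> can_beat I (G i) (f i) (f j)"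
      using that nbeat[of i "f j"] nbeat[of j "f i"] fR GH(2)[of i] GH(2)[of j] ne by auto
    ultimately show False
      using takeWhile_neq_linear[of "f i" "f j" "hlist I (G i)"] by (auto simp: can_beat_def)
  qed
  \<comment> \<open>A proposer who makes \<open>f 0\<close> free; arbitrary when the list of
    \<open>f 0\<close> is empty.\<close>
  obtain b where b: "rlist I (f 0) \<noteq> [] \<Longrightarrow> b \<in> Res I \<and> can_beat I (G 0) b (f 0) \<and> G 0 \<in> set (rlist I b)"
    using walk by (auto simp: walk_def free_def G_def)
  define nxt where "nxt = (\<lambda>z. {G (Suc i) |i. i < k \<and> f i = z})"
  \<comment> \<open>\<open>G 0\<close> may equal some \<open>G (Suc i)\<close>. The place right
    after the list of that hospital then goes to \<open>f i\<close>; only otherwise does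
    \<open>b\<close> get it.\<close>
  define prv where "prv = (\<lambda>g. if \<exists>i<k. G (Suc i) = g then {f i |i. i < k \<and> G (Suc i) = g}
     else if rlist I (f 0) \<noteq> [] \<and> g = G 0 then {b} else {})"
  have nxtH: "nxt z \<subseteq> Hos I" for z
    using GH ne by (auto simp: nxt_def)
  have prvR: "prv g \<subseteq> Res I" for g
    using fR b by (auto simp: prv_def)
  define J where "J = steered nxt prv"
  have J: "completion I J"
    unfolding J_def using nxtH prvR by (rule completion_steered)
  then have m: "maximal_feasible J (final_seq J)"
    by (intro maximal_final_seq) (auto simp: completion_def extension_def)
  have ResJ: "Res J = Res I"
    using J by (auto simp: completion_def extension_def)
  have qJ: "quota J g = 1" if "g \<in> Hos I" for g
    using J that input_quota by (auto simp: completion_def extension_def)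
  have propJ: "(z, g) \<in> propS (final_seq J)" if "z \<in> Res I" "g \<in> set (rlist I z)" for z g
    using propS_mono[OF completion_final_mono[OF J]] that by (auto simp: input_final_prop)
  have rej: "(z, g) \<in> rejS (final_seq J)"
    if z: "z \<in> Res I" "rlist I z \<noteq> []" and y: "(y, last (rlist I z)) \<in> propS (final_seq J)"
      "y \<in> set (takeWhile (\<lambda>x. x \<noteq> z) (hlist J (last (rlist I z))))" and g: "g \<in> set (rlist I z)" for z y g
  proof (cases "g = last (rlist I z)")
    case True
    have "ousted J (propS (final_seq J)) z g"
      using ousted_quota_one[OF qJ[OF listed_in[OF z(1) g]]] propJ[OF z(1) g] y True by blast
    then show ?thesis
      using maximal_feasible_rej[OF m] by blast
  next
    case False
    then show ?thesis
      using input_final_rej[OF z(1) g] rejS_mono[OF completion_final_mono[OF J]] by blast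
  qed
  have "\<forall>g\<in>set (rlist I (f i)). (f i, g) \<in> rejS (final_seq J)" if "i \<le> k" for i
    using that
  proof (induction i)
    case 0
    show ?case
    proof (cases "rlist I (f 0) = []")
      case False
      have "\<exists>y. y \<in> Res I \<and> G 0 \<in> set (rlist I y) \<and> y \<in> set (takeWhile (\<lambda>x. x \<noteq> f 0) (hlist J (G 0)))"
      proof (cases "\<exists>i<k. G (Suc i) = G 0")
        \<comment> \<open>Here \<open>f (Suc i)\<close> takes the part of \<open>b\<close>: he
          proposes to \<open>G 0\<close> in \<open>I\<close>, and as he is not \<open>free\<close>,
          \<open>f 0\<close> cannot beat him, so he stands before \<open>f 0\<close> already in
          \<open>I\<close>.\<close>
        case True
        then obtain i where i: "i < k" "G (Suc i) = G 0" by blast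
        have "f (Suc i) \<noteq> f 0"
          using inj i by (auto simp: inj_on_def)
        moreover have "\<not> can_beat I (G 0) (f 0) (f (Suc i))"
          using nbeat[of "Suc i" "f 0"] i fR[of 0] GH(2)[OF False] by auto
        ultimately have "f (Suc i) \<in> set (takeWhile (\<lambda>x. x \<noteq> f 0) (hlist I (G 0)))"
          using takeWhile_neq_linear[of "f (Suc i)" "f 0"] by (auto simp: can_beat_def)
        moreover have "prefix (hlist I (G 0)) (hlist J (G 0))"
          using J GH(1)[OF False] by (auto simp: completion_def extension_def)
        ultimately have "f (Suc i) \<in> set (takeWhile (\<lambda>x. x \<noteq> f 0) (hlist J (G 0)))"
          using takeWhile_prefix_subset by blast
        then show ?thesis
          using fR[of "Suc i"] GH(2)[of "Suc i"] ne[of "Suc i"] i by auto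
      next
        case F: False
        then have "prv (G 0) = {b}"
          using False by (auto simp: prv_def)
        then have "b \<in> set (takeWhile (\<lambda>x. x \<noteq> f 0) (hlist J (G 0)))"
          unfolding J_def using b False prvR by (intro steered_beats) auto
        then show ?thesis
          using b False by blast
      qed
      then obtain y where "y \<in> Res I" "G 0 \<in> set (rlist I y)"
        "y \<in> set (takeWhile (\<lambda>x. x \<noteq> f 0) (hlist J (G 0)))"
        by blast
      then show ?thesis
        using rej[OF fR[of 0] False, unfolded G_last] propJ by blast
    qed simp
  next
    case (Suc i)
    have i: "i < k" using Suc.prems by simp
    have ne': "rlist I (f (Suc i)) \<noteq> []"
      using ne i by auto
    have beat: "can_beat I (G (Suc i)) (f i) (f (Suc i))"
      using disp[OF i] by (auto simp: displaces_def G_def)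
    \<comment> \<open>Otherwise \<open>f (Suc i)\<close> would be \<open>free\<close>. So this
      hospital is genuinely appended to the list of \<open>f i\<close>, and as the only element of
      \<open>nxt (f i)\<close> it comes first.\<close>
    have "G (Suc i) \<notin> set (rlist I (f i))"
      using nbeat[of "Suc i" "f i"] beat i fR[of i] by auto
    moreover have nx: "nxt (f i) = {G (Suc i)}"
    proof -
      have "j = i" if "j < k" "f j = f i" for j
        using inj i that by (intro inj_onD[OF inj]) auto
      then show ?thesis
        using i by (auto simp: nxt_def)
    qed
    ultimately have "(f i, G (Suc i)) \<in> propS (final_seq J)"
      using steered_next[where y = "f i" and nxt = nxt and prv = prv, OF nxtH nx, folded J_def]
        Suc.IH i fR[of i]
      by (intro maximal_feasible_prop[OF m]) (auto simp: ResJ)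
    moreover have "prv (G (Suc i)) = {f i}"
    proof -
      have "j = i" if "j < k" "G (Suc j) = G (Suc i)" for j
        using Ginj[of "Suc j" "Suc i"] i that by simp
      then have "{f j |j. j < k \<and> G (Suc j) = G (Suc i)} = {f i}"
        using i by blast
      then show ?thesis
        using i unfolding prv_def by auto
    qed
    then have "f i \<in> set (takeWhile (\<lambda>x. x \<noteq> f (Suc i)) (hlist J (G (Suc i))))"
      unfolding J_def using beat prvR by (intro steered_beats) auto
    ultimately show ?case
      using rej[OF fR[OF Suc.prems] ne', unfolded G_last] by blast
  qed
  then have "(r, h) \<in> rejS (final_seq J)"
    using walk input_tent by (auto simp: walk_def)
  then have "(r, h) \<notin> tentI J"
    by (simp add: tentI_def tentS_def final_seq_def)
  then show ?thesis
    using J by (auto simp: finalizable_def)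
qed

theorem finalizable_iff: "finalizable I r h \<longleftrightarrow> r \<notin> exhausts I"
  using not_exhausts_finalizable exhausts_not_finalizable by blast

end

section \<open>Turing machines over arbitrary state and symbol types\<close>

definition head_or :: "'s \<Rightarrow> 's list \<Rightarrow> 's" where
  "head_or b xs = (case xs of [] \<Rightarrow> b | x # _ \<Rightarrow> x)"

definition astep :: "('q \<Rightarrow> 's \<Rightarrow> 'q \<times> 's \<times> move) \<Rightarrow> 's \<Rightarrow> 'q \<times> 's list \<times> 's \<times> 's list \<Rightarrow> 'q \<times> 's list \<times> 's \<times> 's list" where
  "astep \<delta> b cf = (case cf of (q, ls, a, rs) \<Rightarrow>
     (case \<delta> q a of (q', c, d) \<Rightarrow>
       (case d of
          MLeft \<Rightarrow> (q', tl ls, head_or b ls, c # rs)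
        | MRight \<Rightarrow> (q', c # ls, head_or b rs, tl rs)
        | MStay \<Rightarrow> (q', ls, c, rs))))"

text \<open>This lets a machine be built over datatypes and renumbered afterwards. The idling of
  \<open>qa\<close> and \<open>qr\<close> matches \<open>tm_step\<close>, which freezes the states 1
  and 2.\<close>

lemma machine_encoding:
  fixes \<delta> :: "'q \<Rightarrow> 's \<Rightarrow> 'q \<times> 's \<times> move" and e :: "'s \<Rightarrow> nat"
  assumes fin: "finite Q" "finite S"
    and closed: "\<And>q a q' c d. q \<in> Q \<Longrightarrow> a \<in> S \<Longrightarrow> \<delta> q a = (q', c, d) \<Longrightarrow> q' \<in> Q \<and> c \<in> S"
    and special: "q0 \<in> Q" "qa \<in> Q" "qr \<in> Q" "distinct [q0, qa, qr]"
    and halt: "\<And>a. \<delta> qa a = (qa, a, MStay)" "\<And>a. \<delta> qr a = (qr, a, MStay)"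
    and e: "inj_on e S" "b \<in> S" "e b = 0"
  obtains M g where "wf_tm M" "inj_on g Q" "g q0 = 0" "g qa = 1" "g qr = 2"
    "\<And>t q ls a rs q' ls' a' rs'. q \<in> Q \<Longrightarrow> set (a # ls @ rs) \<subseteq> S
       \<Longrightarrow> (astep \<delta> b ^^ t) (q, ls, a, rs) = (q', ls', a', rs')
       \<Longrightarrow> (tm_step M ^^ t) (g q, map e ls, e a, map e rs) = (g q', map e ls', e a', map e rs') \<and> q' \<in> Q"
proof -
  obtain f n where f: "bij_betw f (Q - {q0, qa, qr}) {0..<n::nat}"
    using ex_bij_betw_finite_nat[of "Q - {q0, qa, qr}"] fin(1) by auto
  define g where "g = (\<lambda>q. if q = q0 then 0 else if q = qa then 1 else if q = qr then 2 else 3 + f q)"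
  have inj: "inj_on g Q"
  proof (rule inj_onI)
    fix x y assume "x \<in> Q" "y \<in> Q" "g x = g y"
    then show "x = y"
      using inj_onD[OF bij_betw_imp_inj_on[OF f], of x y] by (simp add: g_def split: if_splits)
  qed
  have g_less: "g q < 3 + n" if "q \<in> Q" for q
    using that bij_betwE[OF f] by (auto simp: g_def)
  \<comment> \<open>The 3 secures the four symbols demanded by \<open>wf_tm\<close>, whatever
    \<open>S\<close> is.\<close>
  define Y where "Y = Suc (Max (insert 3 (e ` S)))"
  have Y: "4 \<le> Y" "\<And>a. a \<in> S \<Longrightarrow> e a < Y"
    unfolding Y_def using fin by (auto simp: less_Suc_eq_le Max_ge_iff)
  \<comment> \<open>Numbers outside the images of \<open>g\<close> and \<open>e\<close> decode to
    arbitrary values; the guard keeps the transition in bounds for them too.\<close>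
  define D where "D = (\<lambda>i j. case \<delta> (inv_into Q g i) (inv_into S e j) of (q, c, d) \<Rightarrow>
     if g q < 3 + n \<and> e c < Y then (g q, e c, d) else (0, 0, MStay))"
  define M where "M = \<lparr>tm_states = 3 + n, tm_symbols = Y, tm_delta = D\<rparr>"
  have "wf_tm M"
    using Y by (auto simp: wf_tm_def M_def D_def split: prod.splits)
  have D: "D (g q) (e a) = (g q', e c, d)" if "q \<in> Q" "a \<in> S" "\<delta> q a = (q', c, d)" for q a q' c d
    using closed[OF that] that by (auto simp: D_def inj e g_less Y)
  have hd_e: "hd0 (map e xs) = e (head_or b xs)" for xs
    using e by (cases xs) (auto simp: hd0_def head_or_def)
  have hd_S: "set xs \<subseteq> S \<Longrightarrow> head_or b xs \<in> S" for xs
    using e by (cases xs) (auto simp: head_or_def)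
  have tl_S: "set xs \<subseteq> S \<Longrightarrow> set (tl xs) \<subseteq> S" for xs :: "'s list"
    by (cases xs) auto
  have halt_iff: "g q = Suc 0 \<longleftrightarrow> q = qa" "g q = 2 \<longleftrightarrow> q = qr" for q
    using special by (auto simp: g_def)
  have step: "tm_step M (g q, map e ls, e a, map e rs) = (g q', map e ls', e a', map e rs')
      \<and> q' \<in> Q \<and> set (a' # ls' @ rs') \<subseteq> S"
    if q: "q \<in> Q" and s: "set (a # ls @ rs) \<subseteq> S" and st: "astep \<delta> b (q, ls, a, rs) = (q', ls', a', rs')"
    for q ls a rs q' ls' a' rs'
  proof -
    obtain p c d where d: "\<delta> q a = (p, c, d)"
      by (metis prod_cases3)
    have pc: "p \<in> Q" "c \<in> S"
      using closed[OF q _ d] s by auto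
    have D': "D (g q) (e a) = (g p, e c, d)"
      using D[OF q _ d] s by auto
    show ?thesis
    proof (cases "q = qa \<or> q = qr")
      case True
      then have "p = q" "c = a" "d = MStay"
        using d halt by auto
      then show ?thesis
        using st s q d True unfolding tm_step_def astep_def by (auto simp: halt_iff)
    next
      case False
      then show ?thesis
        using st s d D' pc hd_S tl_S unfolding tm_step_def astep_def
        by (cases d) (auto simp: halt_iff M_def hd_e map_tl)
    qed
  qed
  have run: "(tm_step M ^^ t) (g q, map e ls, e a, map e rs) = (g q', map e ls', e a', map e rs') \<and> q' \<in> Q"
    if "q \<in> Q" "set (a # ls @ rs) \<subseteq> S" "(astep \<delta> b ^^ t) (q, ls, a, rs) = (q', ls', a', rs')"
    for t q ls a rs q' ls' a' rs'
    using that
  proof (induction t arbitrary: q ls a rs)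
    case 0
    then show ?case by simp
  next
    case (Suc t)
    obtain p ls1 a1 rs1 where 1: "astep \<delta> b (q, ls, a, rs) = (p, ls1, a1, rs1)"
      by (metis prod_cases4)
    show ?case
      using step[OF Suc.prems(1,2) 1] Suc.IH[of p a1 ls1 rs1] Suc.prems(3) 1
      by (simp add: funpow_Suc_right del: funpow.simps)
  qed
  show ?thesis
    by (rule that[OF \<open>wf_tm M\<close> inj _ _ _ run]) (use special in \<open>auto simp: g_def\<close>)
qed

text \<open>A store assigns to each register a set of tape positions. In \<open>Op t u\<close> the function \<open>u\<close> is the
  transition of a two-state automaton that reads the symbol and the registers at each position from
  left to right and decides whether the position belongs to the new value of register \<open>t\<close>.
  \<open>Test\<close> and \<open>While\<close> branch on the register being nonempty.\<close>

section \<open>Sweep programs\<close>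

datatype cmd =
    Skip
  | Op nat "bool \<Rightarrow> nat \<Rightarrow> nat set \<Rightarrow> bool \<times> bool"
  | Seq cmd cmd
  | Test nat cmd cmd
  | While nat cmd

text \<open>A sweep that rewrites register \<open>v\<close> to itself while the flag records whether
  \<open>v\<close> is nonempty. Thus a test has the same form as an assignment.\<close>

definition probe :: "nat \<Rightarrow> bool \<Rightarrow> nat \<Rightarrow> nat set \<Rightarrow> bool \<times> bool" where
  "probe v b a B = (b \<or> v \<in> B, v \<in> B)"

text \<open>Every step of control costs exactly one sweep: commands that change nothing probe a
  register. The empty continuation probes register 1, which holds the verdict.\<close>

fun next_sweep :: "cmd list \<Rightarrow> nat \<times> (bool \<Rightarrow> nat \<Rightarrow> nat set \<Rightarrow> bool \<times> bool) \<times> (bool \<Rightarrow> cmd list)" where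
  "next_sweep [] = (1, probe 1, \<lambda>_. [])"
| "next_sweep (Skip # K) = (1, probe 1, \<lambda>_. K)"
| "next_sweep (Op t u # K) = (t, u, \<lambda>_. K)"
| "next_sweep (Seq c d # K) = (1, probe 1, \<lambda>_. c # d # K)"
| "next_sweep (Test v c d # K) = (v, probe v, \<lambda>b. (if b then c else d) # K)"
| "next_sweep (While v c # K) = (v, probe v, \<lambda>b. if b then c # While v c # K else K)"

text \<open>The continuations that a run of \<open>c\<close> in front of \<open>K\<close> passes
  through before \<open>K\<close> itself. A loop body continues with the loop it came from, so the
  set is finite; its members enter the machine states.\<close>

fun conts :: "cmd \<Rightarrow> cmd list \<Rightarrow> cmd list set" where
  "conts Skip K = {Skip # K}"
| "conts (Op t u) K = {Op t u # K}"
| "conts (Seq c d) K = {Seq c d # K} \<union> conts c (d # K) \<union> conts d K"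
| "conts (Test v c d) K = {Test v c d # K} \<union> conts c K \<union> conts d K"
| "conts (While v c) K = {While v c # K} \<union> conts c (While v c # K)"

fun regs :: "cmd \<Rightarrow> nat set" where
  "regs Skip = {}"
| "regs (Op t u) = {t}"
| "regs (Seq c d) = regs c \<union> regs d"
| "regs (Test v c d) = {v} \<union> regs c \<union> regs d"
| "regs (While v c) = {v} \<union> regs c"

lemma finite_conts: "finite (conts c K)"
  by (induction c arbitrary: K) auto

lemma finite_regs: "finite (regs c)"
  by (induction c) auto

lemma conts_start: "c # K \<in> conts c K"
  by (cases c) auto

lemma conts_closed:
  "L \<in> conts c K \<Longrightarrow> next_sweep L = (t, u, k) \<Longrightarrow> k b \<in> insert K (conts c K)"
proof (induction c arbitrary: K)
  case (Seq c d)
  from Seq.prems conts_start[of d K] conts_start[of c "d # K"] Seq.IH(1)[of "d # K"] Seq.IH(2)[of K]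
  show ?case by auto
next
  case (Test v c d)
  from Test.prems conts_start[of d K] conts_start[of c K] Test.IH(1)[of K] Test.IH(2)[of K]
  show ?case by (cases b) auto
next
  case (While v c)
  from While.prems conts_start[of c "While v c # K"] While.IH[of "While v c # K"]
  show ?case by (cases b) auto
qed auto

lemma conts_regs:
  "L \<in> conts c K \<Longrightarrow> next_sweep L = (t, u, k) \<Longrightarrow> t \<in> insert 1 (regs c)"
  by (induction c arbitrary: K) (fastforce+)

section \<open>Semantics of sweeps on stores\<close>

definition sym_at :: "nat list \<Rightarrow> nat \<Rightarrow> nat" where
  "sym_at w j = (if j < length w then w ! j else 0)"

definition bits :: "(nat \<Rightarrow> nat set) \<Rightarrow> nat \<Rightarrow> nat set" where
  "bits \<sigma> j = {v. j \<in> \<sigma> v}"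

text \<open>The flag on arrival at a position. A full sweep ends at \<open>Suc (length w)\<close>
  because the blank after the word is read as well.\<close>

fun scan :: "(bool \<Rightarrow> nat \<Rightarrow> nat set \<Rightarrow> bool \<times> bool) \<Rightarrow> nat list \<Rightarrow> (nat \<Rightarrow> nat set) \<Rightarrow> nat \<Rightarrow> bool" where
  "scan u w \<sigma> 0 = False"
| "scan u w \<sigma> (Suc j) = fst (u (scan u w \<sigma> j) (sym_at w j) (bits \<sigma> j))"

definition sweep :: "nat list \<Rightarrow> nat \<Rightarrow> (bool \<Rightarrow> nat \<Rightarrow> nat set \<Rightarrow> bool \<times> bool) \<Rightarrow> (nat \<Rightarrow> nat set) \<Rightarrow> nat \<Rightarrow> nat set" where
  "sweep w t u \<sigma> = \<sigma>(t := {j. j \<le> length w \<and> snd (u (scan u w \<sigma> j) (sym_at w j) (bits \<sigma> j))})"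

definition mstep :: "nat list \<Rightarrow> cmd list \<times> (nat \<Rightarrow> nat set) \<Rightarrow> cmd list \<times> (nat \<Rightarrow> nat set)" where
  "mstep w = (\<lambda>(K, \<sigma>). case next_sweep K of (t, u, k) \<Rightarrow> (k (scan u w \<sigma> (Suc (length w))), sweep w t u \<sigma>))"

text \<open>Register 0 is a constant: it marks the left end for the machine and supplies the
  position 0 to programs.\<close>

definition wf_store :: "nat list \<Rightarrow> (nat \<Rightarrow> nat set) \<Rightarrow> bool" where
  "wf_store w \<sigma> \<longleftrightarrow> \<sigma> 0 = {0} \<and> (\<forall>v. \<sigma> v \<subseteq> {..length w})"

lemma scan_probe: "scan (probe v) w \<sigma> n \<longleftrightarrow> (\<exists>j<n. j \<in> \<sigma> v)"
  by (induction n) (auto simp: probe_def bits_def less_Suc_eq)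

lemma scan_probe_wf: "wf_store w \<sigma> \<Longrightarrow> scan (probe v) w \<sigma> (Suc (length w)) \<longleftrightarrow> \<sigma> v \<noteq> {}"
  unfolding scan_probe wf_store_def by (force simp: less_Suc_eq_le)

lemma sweep_probe: "wf_store w \<sigma> \<Longrightarrow> sweep w v (probe v) \<sigma> = \<sigma>"
  by (auto simp: wf_store_def sweep_def probe_def bits_def fun_eq_iff)

lemma wf_store_sweep: "wf_store w \<sigma> \<Longrightarrow> t \<noteq> 0 \<Longrightarrow> wf_store w (sweep w t u \<sigma>)"
  by (auto simp: wf_store_def sweep_def)

text \<open>\<open>Cell a B\<close> at position \<open>j\<close>: \<open>a\<close> is the input symbol and \<open>B\<close> the set of registers containing \<open>j\<close>.
  Membership in register 0 marks the left end of the tape, the symbol 0 its right end.\<close>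
datatype cell = Raw nat | Cell nat "nat set"

section \<open>Simulation of sweep programs by a machine\<close>

datatype ctrl = QInit | QAcc | QRej | QLoad | QRight "cmd list" bool | QLeft "cmd list"

fun enc_cell :: "cell \<Rightarrow> nat" where
  "enc_cell (Raw n) = n"
| "enc_cell (Cell a B) = 4 + a + 4 * set_encode B"

text \<open>\<open>QInit\<close> and \<open>QLoad\<close> turn raw symbols into cells up to the
  first blank, which becomes the right end. \<open>QRight\<close> carries out a sweep in place and
  picks the continuation at the right end, \<open>QLeft\<close> rewinds. On the empty continuation
  the flag is the verdict.\<close>

fun ctrl_delta :: "cmd \<Rightarrow> ctrl \<Rightarrow> cell \<Rightarrow> ctrl \<times> cell \<times> move" where
  "ctrl_delta c QInit (Raw a) = (QLoad, Cell a {0}, MRight)"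
| "ctrl_delta c QLoad (Raw a) = (if a = 0 then (QLeft [c], Cell 0 {}, MLeft) else (QLoad, Cell a {}, MRight))"
| "ctrl_delta c (QRight K b) (Cell a B) = (case next_sweep K of (t, u, k) \<Rightarrow>
     let (b', x) = u b a B; B' = (if x then insert t B else B - {t})
     in if a \<noteq> 0 then (QRight K b', Cell a B', MRight)
        else if K = [] then (if b' then QAcc else QRej, Cell a B', MStay)
        else (QLeft (k b'), Cell a B', MStay))"
| "ctrl_delta c (QLeft K) (Cell a B) = (if 0 \<in> B then (QRight K False, Cell a B, MStay) else (QLeft K, Cell a B, MLeft))"
| "ctrl_delta c q s = (q, s, MStay)"

definition aconf :: "'q \<Rightarrow> (nat \<Rightarrow> 's) \<Rightarrow> nat \<Rightarrow> nat \<Rightarrow> 'q \<times> 's list \<times> 's \<times> 's list" where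
  "aconf q f N h = (q, map f (rev [0..<h]), f h, map f [Suc h..<Suc N])"

lemma aconf_cong: "(\<And>j. j \<le> N \<Longrightarrow> f j = g j) \<Longrightarrow> h \<le> N \<Longrightarrow> aconf q f N h = aconf q g N h"
  by (auto simp: aconf_def)

lemma astep_right:
  assumes "h < N" "\<delta> q (f h) = (q', c, MRight)"
  shows "astep \<delta> b (aconf q f N h) = aconf q' (f(h := c)) N (Suc h)"
proof -
  have "[Suc h..<Suc N] = Suc h # [Suc (Suc h)..<Suc N]"
    using assms by (simp add: upt_conv_Cons)
  then show ?thesis
    using assms by (auto simp: astep_def aconf_def head_or_def)
qed

lemma astep_left:
  assumes "0 < h" "h \<le> N" "\<delta> q (f h) = (q', c, MLeft)"
  shows "astep \<delta> b (aconf q f N h) = aconf q' (f(h := c)) N (h - 1)"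
proof -
  obtain i where i: "h = Suc i"
    using assms by (cases h) auto
  have "[Suc i..<Suc N] = Suc i # [Suc (Suc i)..<Suc N]"
    using assms i by (simp add: upt_conv_Cons)
  then show ?thesis
    using assms i by (auto simp: astep_def aconf_def head_or_def)
qed

lemma astep_stay:
  assumes "h \<le> N" "\<delta> q (f h) = (q', c, MStay)"
  shows "astep \<delta> b (aconf q f N h) = aconf q' (f(h := c)) N h"
  using assms by (auto simp: astep_def aconf_def)

lemma astep_right_end:
  assumes "\<delta> q (f h) = (q', c, MRight)"
  shows "astep \<delta> b (aconf q f h h) = aconf q' (f(h := c, Suc h := b)) (Suc h) (Suc h)"
  using assms by (auto simp: astep_def aconf_def head_or_def)

definition tape :: "nat list \<Rightarrow> (nat \<Rightarrow> nat set) \<Rightarrow> nat \<Rightarrow> cell" where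
  "tape w \<sigma> j = Cell (sym_at w j) (bits \<sigma> j)"

definition init_store :: "nat \<Rightarrow> nat set" where
  "init_store = (\<lambda>_. {})(0 := {0})"

context
  fixes w :: "nat list" and c :: cmd
  assumes w: "w \<noteq> []" "0 \<notin> set w"
begin

lemma sym_at_pos: "j < length w \<Longrightarrow> sym_at w j \<noteq> 0"
  using w by (metis nth_mem sym_at_def)

lemma run_load:
  "\<exists>t\<le>2 * length w + 1. (astep (ctrl_delta c) (Raw 0) ^^ t) (QInit, [], head_or (Raw 0) (map Raw w), tl (map Raw w))
     = aconf (QLeft [c]) (tape w init_store) (length w) (length w - 1)"
proof -
  let ?A = "astep (ctrl_delta c) (Raw 0)"
  define N where "N = length w - 1"
  have N: "length w = Suc N"
    using w by (cases w) (auto simp: N_def)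
  define F where "F = (\<lambda>i j. if j < i then tape w init_store j else Raw (sym_at w j))"
  have "map (F 0) [1..<Suc N] = tl (map Raw w)"
    by (rule nth_equalityI) (auto simp: N F_def nth_tl sym_at_def simp del: upt_Suc)
  moreover have "head_or (Raw 0) (map Raw w) = F 0 0"
    using w by (cases w) (auto simp: head_or_def F_def sym_at_def)
  ultimately have start: "(QInit, [], head_or (Raw 0) (map Raw w), tl (map Raw w)) = aconf QInit (F 0) N 0"
    by (simp add: aconf_def)
  have F_upd: "(F i)(i := tape w init_store i) = F (Suc i)" for i
    by (auto simp: F_def fun_eq_iff)
  have t0: "tape w init_store j = (if j = 0 then Cell (sym_at w 0) {0} else Cell (sym_at w j) {})" for j
    by (auto simp: tape_def init_store_def bits_def)
  have delta: "ctrl_delta c (if i = 0 then QInit else QLoad) (F i i) = (QLoad, tape w init_store i, MRight)"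
    if "i \<le> N" for i
    using sym_at_pos[of i] that N by (auto simp: F_def t0)
  have load: "(?A ^^ i) (aconf QInit (F 0) N 0) = aconf (if i = 0 then QInit else QLoad) (F i) N i" if "i \<le> N" for i
    using that
  proof (induction i)
    case (Suc i)
    then show ?case
      using astep_right[where \<delta> = "ctrl_delta c" and f = "F i" and h = i and N = N and b = "Raw 0", OF _ delta[of i]] by (simp add: F_upd)
  qed simp
  have "(?A ^^ Suc N) (aconf QInit (F 0) N 0) = aconf QLoad ((F (Suc N))(Suc N := Raw 0)) (Suc N) (Suc N)"
    using load[of N] astep_right_end[where \<delta> = "ctrl_delta c" and f = "F N" and h = N and b = "Raw 0", OF delta[of N]] by (simp add: F_upd)
  \<comment> \<open>The fresh blank agrees with the default value 0 of \<open>sym_at\<close> past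
    the word.\<close>
  also have "(F (Suc N))(Suc N := Raw 0) = F (Suc N)"
    by (auto simp: F_def fun_eq_iff sym_at_def N)
  finally have "(?A ^^ Suc (Suc N)) (aconf QInit (F 0) N 0) = ?A (aconf QLoad (F (Suc N)) (Suc N) (Suc N))"
    by simp
  also have "\<dots> = aconf (QLeft [c]) ((F (Suc N))(Suc N := Cell 0 {})) (Suc N) N"
    using astep_left[of "Suc N" "Suc N" "ctrl_delta c" QLoad "F (Suc N)" "QLeft [c]" "Cell 0 {}" "Raw 0"]
    by (simp add: F_def sym_at_def N)
  also have "\<dots> = aconf (QLeft [c]) (tape w init_store) (length w) (length w - 1)"
    unfolding N by (simp, rule aconf_cong) (auto simp: F_def t0 sym_at_def N)
  finally show ?thesis
    unfolding start by (intro exI[of _ "Suc (Suc N)"]) (simp add: N)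
qed

lemma run_left:
  assumes "wf_store w \<sigma>" "h \<le> length w"
  shows "(astep (ctrl_delta c) (Raw 0) ^^ Suc h) (aconf (QLeft K) (tape w \<sigma>) (length w) h)
    = aconf (QRight K False) (tape w \<sigma>) (length w) 0"
  using assms(2)
proof (induction h)
  case 0
  have "ctrl_delta c (QLeft K) (tape w \<sigma> 0) = (QRight K False, tape w \<sigma> 0, MStay)"
    using assms(1) by (simp add: tape_def wf_store_def bits_def)
  from astep_stay[where \<delta> = "ctrl_delta c" and f = "tape w \<sigma>" and h = 0 and N = "length w" and b = "Raw 0", OF _ this] show ?case
    by simp
next
  case (Suc h)
  have "astep (ctrl_delta c) (Raw 0) (aconf (QLeft K) (tape w \<sigma>) (length w) (Suc h)) = aconf (QLeft K) (tape w \<sigma>) (length w) h"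
  proof -
    have "ctrl_delta c (QLeft K) (tape w \<sigma> (Suc h)) = (QLeft K, tape w \<sigma> (Suc h), MLeft)"
      using assms(1) by (simp add: tape_def wf_store_def bits_def)
    from astep_left[where \<delta> = "ctrl_delta c" and f = "tape w \<sigma>" and h = "Suc h" and N = "length w" and b = "Raw 0", OF _ _ this]
    show ?thesis
      using Suc.prems by simp
  qed
  then show ?case
    using Suc by (simp add: funpow_Suc_right del: funpow.simps)
qed

lemma bits_sweep:
  "j \<le> length w \<Longrightarrow> bits (sweep w t u \<sigma>) j
     = (if snd (u (scan u w \<sigma> j) (sym_at w j) (bits \<sigma> j)) then insert t (bits \<sigma> j) else bits \<sigma> j - {t})"
  by (auto simp: bits_def sweep_def)

lemma run_right:
  assumes nx: "next_sweep K = (t, u, k)"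
  shows "(astep (ctrl_delta c) (Raw 0) ^^ Suc (length w)) (aconf (QRight K False) (tape w \<sigma>) (length w) 0)
    = aconf (if K = [] then if scan u w \<sigma> (Suc (length w)) then QAcc else QRej else QLeft (k (scan u w \<sigma> (Suc (length w)))))
        (tape w (sweep w t u \<sigma>)) (length w) (length w)"
proof -
  let ?A = "astep (ctrl_delta c) (Raw 0)"
  \<comment> \<open>Cells left of the head hold the new store, the others the old one. Updating in
    place is sound because the new membership of a position depends only on the flag and on the old
    bits there.\<close>
  define F where "F = (\<lambda>i j. if j < i then tape w (sweep w t u \<sigma>) j else tape w \<sigma> j)"
  have F_upd: "(F i)(i := tape w (sweep w t u \<sigma>) i) = F (Suc i)" for i
    by (auto simp: F_def fun_eq_iff)
  have F0: "F 0 = tape w \<sigma>"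
    by (simp add: F_def)
  have right: "(?A ^^ i) (aconf (QRight K False) (F 0) (length w) 0) = aconf (QRight K (scan u w \<sigma> i)) (F i) (length w) i"
    if "i \<le> length w" for i
    using that
  proof (induction i)
    case (Suc i)
    have "ctrl_delta c (QRight K (scan u w \<sigma> i)) (F i i)
        = (QRight K (scan u w \<sigma> (Suc i)), tape w (sweep w t u \<sigma>) i, MRight)"
      using Suc.prems sym_at_pos[of i]
      by (auto simp: F_def tape_def nx bits_sweep Let_def split: prod.splits)
    from astep_right[where \<delta> = "ctrl_delta c" and f = "F i" and h = i and N = "length w" and b = "Raw 0", OF _ this] Suc show ?case
      by (simp add: F_upd)
  qed simp
  have "ctrl_delta c (QRight K (scan u w \<sigma> (length w))) (F (length w) (length w))
      = (if K = [] then if scan u w \<sigma> (Suc (length w)) then QAcc else QRej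
           else QLeft (k (scan u w \<sigma> (Suc (length w)))), tape w (sweep w t u \<sigma>) (length w), MStay)"
    by (auto simp: F_def tape_def nx bits_sweep Let_def sym_at_def split: prod.splits)
  from astep_stay[where \<delta> = "ctrl_delta c" and f = "F (length w)" and h = "length w" and N = "length w" and b = "Raw 0", OF _ this] right[of "length w"]
  have "(?A ^^ Suc (length w)) (aconf (QRight K False) (F 0) (length w) 0) =
      aconf (if K = [] then if scan u w \<sigma> (Suc (length w)) then QAcc else QRej else QLeft (k (scan u w \<sigma> (Suc (length w)))))
        (F (Suc (length w))) (length w) (length w)"
    by (simp add: F_upd)
  then show ?thesis
    unfolding F0 by (simp only:, intro aconf_cong) (auto simp: F_def)
qed

text \<open>A sweep to the right and the way back take \<open>Suc (length w)\<close> steps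
  each.\<close>

lemma run_mstep:
  assumes "K \<noteq> []" "mstep w (K, \<sigma>) = (K', \<sigma>')" "wf_store w \<sigma>'"
  shows "(astep (ctrl_delta c) (Raw 0) ^^ (2 * length w + 2)) (aconf (QRight K False) (tape w \<sigma>) (length w) 0)
    = aconf (QRight K' False) (tape w \<sigma>') (length w) 0"
proof -
  obtain t u k where nx: "next_sweep K = (t, u, k)"
    by (metis prod_cases3)
  have eq: "2 * length w + 2 = Suc (length w) + Suc (length w)" by simp
  have "K' = k (scan u w \<sigma> (Suc (length w)))" "\<sigma>' = sweep w t u \<sigma>"
    using assms(2) nx by (auto simp: mstep_def)
  then show ?thesis
    using run_right[OF nx, of \<sigma>] run_left[OF assms(3), of "length w"] assms(1)
    unfolding eq funpow_add by (simp del: funpow.simps)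
qed

text \<open>The extra summand 1 in the bound pays for the last sweep, which runs on the empty
  continuation and reads off register 1.\<close>

lemma run_program:
  assumes "(mstep w ^^ n) (K, \<sigma>) = ([], \<sigma>')" "wf_store w \<sigma>" "K \<in> insert [] (conts c [])" "0 \<notin> regs c"
  shows "\<exists>t\<le>(n + 1) * (2 * length w + 2). fst ((astep (ctrl_delta c) (Raw 0) ^^ t) (aconf (QRight K False) (tape w \<sigma>) (length w) 0))
     = (if \<sigma>' 1 \<noteq> {} then QAcc else QRej)"
  using assms(1-3)
proof (induction n arbitrary: K \<sigma>)
  case 0
  then show ?case
    using run_right[of "[]" 1 "probe 1" _ \<sigma>] scan_probe_wf[of w \<sigma> 1]
    by (intro exI[of _ "Suc (length w)"]) (auto simp: aconf_def simp del: scan.simps funpow.simps)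
next
  case (Suc n)
  obtain t u k where nx: "next_sweep K = (t, u, k)"
    by (metis prod_cases3)
  define K1 \<sigma>1 where "K1 = k (scan u w \<sigma> (Suc (length w)))" and "\<sigma>1 = sweep w t u \<sigma>"
  have ms: "mstep w (K, \<sigma>) = (K1, \<sigma>1)"
    using nx by (simp add: mstep_def K1_def \<sigma>1_def)
  have K1: "K1 \<in> insert [] (conts c [])"
    using Suc.prems(3) conts_closed[OF _ nx, of c "[]"] nx unfolding K1_def by auto
  have "t = 1 \<or> t \<in> regs c"
    using Suc.prems(3) conts_regs[OF _ nx, of c "[]"] nx by auto
  then have "t \<noteq> 0"
    using assms(4) by (metis zero_neq_one)
  then have wf1: "wf_store w \<sigma>1"
    using Suc.prems(2) unfolding \<sigma>1_def by (intro wf_store_sweep)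
  have "(mstep w ^^ n) (K1, \<sigma>1) = ([], \<sigma>')"
    using Suc.prems(1) ms by (simp add: funpow_Suc_right del: funpow.simps)
  from Suc.IH[OF this wf1 K1] obtain s where s: "s \<le> (n + 1) * (2 * length w + 2)"
    "fst ((astep (ctrl_delta c) (Raw 0) ^^ s) (aconf (QRight K1 False) (tape w \<sigma>1) (length w) 0))
     = (if \<sigma>' 1 \<noteq> {} then QAcc else QRej)" by blast
  show ?case
  proof (cases "K = []")
    \<comment> \<open>The empty continuation steps to itself, so surplus steps change
      nothing.\<close>
    case True
    then have "K1 = K" "\<sigma>1 = \<sigma>"
      using nx Suc.prems(2) by (auto simp: K1_def \<sigma>1_def sweep_probe)
    then show ?thesis
      using s by (intro exI[of _ s]) auto
  next
    case False
    have "(astep (ctrl_delta c) (Raw 0) ^^ (s + (2 * length w + 2))) (aconf (QRight K False) (tape w \<sigma>) (length w) 0)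
        = (astep (ctrl_delta c) (Raw 0) ^^ s) (aconf (QRight K1 False) (tape w \<sigma>1) (length w) 0)"
      using run_mstep[OF False ms wf1] by (simp only: funpow_add[of s] o_apply)
    moreover have "s + (2 * length w + 2) \<le> (Suc n + 1) * (2 * length w + 2)"
      using s(1) by simp
    ultimately show ?thesis
      using s(2) by metis
  qed
qed

end

text \<open>Quantifying over \<open>K\<close> makes a run independent of what follows it, so runs of
  the parts of a command can be concatenated.\<close>

definition exec :: "nat list \<Rightarrow> cmd \<Rightarrow> nat \<Rightarrow> (nat \<Rightarrow> nat set) \<Rightarrow> (nat \<Rightarrow> nat set) \<Rightarrow> bool" where
  "exec w c n \<sigma> \<sigma>' \<longleftrightarrow> (\<forall>K. (mstep w ^^ n) (c # K, \<sigma>) = (K, \<sigma>'))"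

text \<open>Raw codes are below 4 and cell codes are not; in a cell code the remainder modulo 4
  gives the symbol and the quotient the set of registers.\<close>

lemma enc_cell_inj: "inj_on enc_cell (Raw ` {..<4} \<union> (\<lambda>(a, B). Cell a B) ` ({..<4} \<times> Pow {..<m}))"
proof (rule inj_onI)
  fix x y
  assume x: "x \<in> Raw ` {..<4} \<union> (\<lambda>(a, B). Cell a B) ` ({..<4} \<times> Pow {..<m})"
    and y: "y \<in> Raw ` {..<4} \<union> (\<lambda>(a, B). Cell a B) ` ({..<4} \<times> Pow {..<m})" and e: "enc_cell x = enc_cell y"
  have *: "a = a' \<and> B = B'" if "a < 4" "a' < 4" "B \<subseteq> {..<m}" "B' \<subseteq> {..<m}"
    "a + 4 * set_encode B = a' + 4 * set_encode B'" for a a' B B'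
  proof -
    have "set_encode B = (a + 4 * set_encode B) div 4" "set_encode B' = (a' + 4 * set_encode B') div 4"
      using that by auto
    then have "set_encode B = set_encode B'"
      using that(5) by simp
    then show ?thesis
      using that set_encode_eq[of B B'] finite_subset[OF _ finite_lessThan] by auto
  qed
  show "x = y"
    using x y e * by (cases x; cases y) auto
qed

text \<open>Besides \<open>n + 1\<close> sweeps there are the loading of the word and one rewind,
  which fit into the time of two more. Halting states idle, so every larger \<open>T\<close> gives
  the same verdict.\<close>

lemma cmd_decider:
  assumes "0 \<notin> regs c"
  obtains M where "wf_tm M"
    "\<And>w n \<sigma> T. w \<noteq> [] \<Longrightarrow> set w \<subseteq> {1, 2, 3} \<Longrightarrow> exec w c n init_store \<sigma> \<Longrightarrow> (n + 3) * (2 * length w + 2) \<le> T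
       \<Longrightarrow> fst (tm_run M T w) = (if \<sigma> 1 \<noteq> {} then 1 else 2)"
proof -
  let ?C = "insert [] (conts c [])"
  define Q where "Q = {QInit, QAcc, QRej, QLoad} \<union> (\<lambda>(K, b). QRight K b) ` (?C \<times> UNIV) \<union> QLeft ` ?C"
  \<comment> \<open>Register 1 is included because idle steps and the verdict probe it even if
    \<open>c\<close> does not mention it.\<close>
  define m where "m = Suc (Max (insert 1 (regs c)))"
  define S where "S = Raw ` {..<4} \<union> (\<lambda>(a, B). Cell a B) ` ({..<4} \<times> Pow {..<m})"
  have fin: "finite Q" "finite S"
    by (auto simp: Q_def S_def finite_conts)
  have m: "0 < m" "1 < m" "\<And>t. t \<in> regs c \<Longrightarrow> t < m"
    using finite_regs[of c] by (auto simp: m_def less_Suc_eq_le)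
  have start: "[c] \<in> ?C"
    using conts_start by blast
  have closed: "q' \<in> Q \<and> a' \<in> S" if q: "q \<in> Q" "a \<in> S" "ctrl_delta c q a = (q', a', d)" for q a q' a' d
  proof (cases "\<exists>K b s B. q = QRight K b \<and> a = Cell s B")
    case True
    then obtain K b s B where qa: "q = QRight K b" "a = Cell s B" by blast
    obtain t u k where nx: "next_sweep K = (t, u, k)"
      by (metis prod_cases3)
    have K: "K \<in> ?C"
      using q qa by (auto simp: Q_def)
    have "k x \<in> ?C" for x
      using K conts_closed[OF _ nx, of c "[]"] nx by auto
    moreover have "t < m"
      using K conts_regs[OF _ nx, of c "[]"] nx m by auto
    ultimately show ?thesis
      using q qa nx K by (auto simp: Q_def S_def Let_def split: prod.splits if_splits)
  next
    case False
    then show ?thesis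
      using q start m by (cases "(c, q, a)" rule: ctrl_delta.cases) (auto simp: Q_def S_def split: if_splits)
  qed
  have QS: "QInit \<in> Q" "QAcc \<in> Q" "QRej \<in> Q" "distinct [QInit, QAcc, QRej]"
    by (auto simp: Q_def)
  have halt: "ctrl_delta c QAcc a = (QAcc, a, MStay)" "ctrl_delta c QRej a = (QRej, a, MStay)" for a
    by simp_all
  have inj: "inj_on enc_cell S"
    unfolding S_def by (rule enc_cell_inj)
  have blank: "Raw 0 \<in> S" "enc_cell (Raw 0) = 0"
    by (auto simp: S_def)
  obtain M g where M: "wf_tm M" "inj_on g Q" "g QInit = 0" "g QAcc = 1" "g QRej = 2"
    and run: "\<And>t q ls a rs q' ls' a' rs'. q \<in> Q \<Longrightarrow> set (a # ls @ rs) \<subseteq> S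
       \<Longrightarrow> (astep (ctrl_delta c) (Raw 0) ^^ t) (q, ls, a, rs) = (q', ls', a', rs')
       \<Longrightarrow> (tm_step M ^^ t) (g q, map enc_cell ls, enc_cell a, map enc_cell rs)
         = (g q', map enc_cell ls', enc_cell a', map enc_cell rs') \<and> q' \<in> Q"
    by (rule machine_encoding[where ?q0.0 = QInit and qa = QAcc and qr = QRej and b = "Raw 0",
          OF fin closed QS halt inj blank]) (assumption | rule that)+
  have "fst (tm_run M T w) = (if \<sigma> 1 \<noteq> {} then 1 else 2)"
    if w: "w \<noteq> []" "set w \<subseteq> {1, 2, 3}" and ex: "exec w c n init_store \<sigma>" and T: "(n + 3) * (2 * length w + 2) \<le> T"
    for w n \<sigma> T
  proof -
    let ?A = "astep (ctrl_delta c) (Raw 0)"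
    have w0: "0 \<notin> set w"
      using w by auto
    have wf: "wf_store w init_store"
      by (auto simp: wf_store_def init_store_def)
    obtain t1 where t1: "t1 \<le> 2 * length w + 1"
      "(?A ^^ t1) (QInit, [], head_or (Raw 0) (map Raw w), tl (map Raw w))
        = aconf (QLeft [c]) (tape w init_store) (length w) (length w - 1)"
      using run_load[OF w(1) w0] by blast
    obtain t2 where t2: "t2 \<le> (n + 1) * (2 * length w + 2)"
      "fst ((?A ^^ t2) (aconf (QRight [c] False) (tape w init_store) (length w) 0)) = (if \<sigma> 1 \<noteq> {} then QAcc else QRej)"
      using run_program[OF w(1) w0, of n "[c]" init_store \<sigma>] ex wf start assms by (auto simp: exec_def)
    define t where "t = t2 + (Suc (length w - 1) + t1)"
    have t: "fst ((?A ^^ t) (QInit, [], head_or (Raw 0) (map Raw w), tl (map Raw w))) = (if \<sigma> 1 \<noteq> {} then QAcc else QRej)"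
      using t2(2) unfolding t_def funpow_add[of t2] funpow_add[of "Suc _"] o_apply t1(2) run_left[OF w(1) w0 wf diff_le_self] .
    have "t \<le> T"
      using T t1(1) t2(1) by (simp add: t_def algebra_simps)
    have halted: "fst ((?A ^^ k) x) = fst x" if "fst x = QAcc \<or> fst x = QRej" for k x
      using that by (induction k) (auto simp: astep_def split: prod.splits)
    have hT: "fst ((?A ^^ T) (QInit, [], head_or (Raw 0) (map Raw w), tl (map Raw w))) = (if \<sigma> 1 \<noteq> {} then QAcc else QRej)"
      using halted[of "(?A ^^ t) (QInit, [], head_or (Raw 0) (map Raw w), tl (map Raw w))" "T - t"] t \<open>t \<le> T\<close>
      by (simp flip: funpow_add[THEN fun_cong, unfolded o_apply] split: if_splits)
    obtain q' ls' a' rs' where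
      r: "(?A ^^ T) (QInit, [], head_or (Raw 0) (map Raw w), tl (map Raw w)) = (q', ls', a', rs')"
      by (metis prod_cases4)
    have ws: "set (head_or (Raw 0) (map Raw w) # [] @ tl (map Raw w)) \<subseteq> S"
      using w by (cases w) (auto simp: head_or_def S_def)
    have "q' = (if \<sigma> 1 \<noteq> {} then QAcc else QRej)"
      using hT unfolding r by simp
    then have "(tm_step M ^^ T) (0, [], enc_cell (head_or (Raw 0) (map Raw w)), map enc_cell (tl (map Raw w)))
        = (g (if \<sigma> 1 \<noteq> {} then QAcc else QRej), map enc_cell ls', enc_cell a', map enc_cell rs')"
      using run[OF QS(1) ws r] M(3) by simp
    moreover have "(0, [], enc_cell (head_or (Raw 0) (map Raw w)), map enc_cell (tl (map Raw w))) = tm_init w"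
      using w by (cases w) (auto simp: tm_init_def hd0_def head_or_def comp_def)
    ultimately show ?thesis
      using M by (auto simp: tm_run_def)
  qed
  then show ?thesis
    using that M(1) by blast
qed

section \<open>First-order definability with counting\<close>

text \<open>The same \<open>k\<close> is factor and exponent; this loses nothing, since either may
  be enlarged.\<close>

definition poly_bounded :: "(nat \<Rightarrow> nat) \<Rightarrow> bool" where
  "poly_bounded f \<longleftrightarrow> (\<exists>k. \<forall>n. f n \<le> k * (n + 1) ^ k)"

lemma poly_bounded_const: "poly_bounded (\<lambda>_. c)"
  unfolding poly_bounded_def
proof (intro exI allI)
  fix n :: nat
  show "c \<le> c * (n + 1) ^ c"
    by simp
qed

lemma poly_bounded_id: "poly_bounded (\<lambda>n. n)"
  unfolding poly_bounded_def by (intro exI[of _ 1]) simp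

lemma poly_bounded_add:
  assumes "poly_bounded f" "poly_bounded g"
  shows "poly_bounded (\<lambda>n. f n + g n)"
proof -
  obtain k l where k: "\<And>n. f n \<le> k * (n + 1) ^ k" and l: "\<And>n. g n \<le> l * (n + 1) ^ l"
    using assms unfolding poly_bounded_def by blast
  have "f n + g n \<le> (k + l) * (n + 1) ^ (k + l)" for n
  proof -
    have "k * (n + 1) ^ k \<le> k * (n + 1) ^ (k + l)" "l * (n + 1) ^ l \<le> l * (n + 1) ^ (k + l)"
      by (intro mult_left_mono power_increasing; simp)+
    then show ?thesis
      using k[of n] l[of n] unfolding add_mult_distrib by linarith
  qed
  then show ?thesis
    unfolding poly_bounded_def by blast
qed

lemma poly_bounded_mult:
  assumes "poly_bounded f" "poly_bounded g"
  shows "poly_bounded (\<lambda>n. f n * g n)"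
proof -
  obtain k l where k: "\<And>n. f n \<le> k * (n + 1) ^ k" and l: "\<And>n. g n \<le> l * (n + 1) ^ l"
    using assms unfolding poly_bounded_def by blast
  have "f n * g n \<le> (k * l + (k + l)) * (n + 1) ^ (k * l + (k + l))" for n
  proof -
    have "f n * g n \<le> (k * (n + 1) ^ k) * (l * (n + 1) ^ l)"
      using k l by (rule mult_le_mono)
    also have "\<dots> = (k * l) * (n + 1) ^ (k + l)"
      by (simp add: power_add)
    also have "\<dots> \<le> (k * l + (k + l)) * (n + 1) ^ (k * l + (k + l))"
      by (intro mult_le_mono power_increasing) auto
    finally show ?thesis .
  qed
  then show ?thesis
    unfolding poly_bounded_def by blast
qed

lemma poly_bounded_Suc: "poly_bounded f \<Longrightarrow> poly_bounded (\<lambda>n. Suc (f n))"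
  using poly_bounded_add[OF _ poly_bounded_const[of 1]] by simp

lemmas poly_bounded_intros =
  poly_bounded_const poly_bounded_id poly_bounded_Suc poly_bounded_add poly_bounded_mult

section \<open>Running times of program constructs\<close>

definition exec_le :: "nat list \<Rightarrow> cmd \<Rightarrow> nat \<Rightarrow> (nat \<Rightarrow> nat set) \<Rightarrow> (nat \<Rightarrow> nat set) \<Rightarrow> bool" where
  "exec_le w c N \<sigma> \<sigma>' \<longleftrightarrow> (\<exists>n\<le>N. exec w c n \<sigma> \<sigma>')"

lemma exec_le_mono: "exec_le w c N \<sigma> \<sigma>' \<Longrightarrow> N \<le> N' \<Longrightarrow> exec_le w c N' \<sigma> \<sigma>'"
  unfolding exec_le_def using le_trans by blast

lemma exec_Cons:
  assumes "\<And>K. mstep w (c # K, \<sigma>) = (L K, \<sigma>1)" "\<And>K. (mstep w ^^ n) (L K, \<sigma>1) = (K, \<sigma>')"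
  shows "exec w c (Suc n) \<sigma> \<sigma>'"
  using assms by (simp add: exec_def funpow_Suc_right del: funpow.simps)

lemma exec_le_Op: "exec_le w (Op t u) 1 \<sigma> (sweep w t u \<sigma>)"
  unfolding exec_le_def by (intro exI[of _ 1]) (simp add: exec_def mstep_def)

lemma exec_le_Skip: "wf_store w \<sigma> \<Longrightarrow> exec_le w Skip 1 \<sigma> \<sigma>"
  unfolding exec_le_def by (intro exI[of _ 1]) (simp add: exec_def mstep_def sweep_probe[unfolded One_nat_def])

lemma exec_le_Seq:
  assumes "wf_store w \<sigma>" "exec_le w c N \<sigma> \<sigma>1" "exec_le w d N' \<sigma>1 \<sigma>2"
  shows "exec_le w (Seq c d) (Suc (N + N')) \<sigma> \<sigma>2"
proof -
  obtain n n' where n: "n \<le> N" "n' \<le> N'" "exec w c n \<sigma> \<sigma>1" "exec w d n' \<sigma>1 \<sigma>2"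
    using assms unfolding exec_le_def by blast
  have "exec w (Seq c d) (Suc (n' + n)) \<sigma> \<sigma>2"
    by (rule exec_Cons[where L = "\<lambda>K. c # d # K" and ?\<sigma>1.0 = \<sigma>])
      (use n assms(1) in \<open>auto simp: mstep_def sweep_probe[unfolded One_nat_def] exec_def funpow_add\<close>)
  then show ?thesis
    unfolding exec_le_def using n by (intro exI[of _ "Suc (n' + n)"]) auto
qed

lemma exec_le_Test:
  assumes "wf_store w \<sigma>" "exec_le w (if \<sigma> v \<noteq> {} then c else d) N \<sigma> \<sigma>'"
  shows "exec_le w (Test v c d) (Suc N) \<sigma> \<sigma>'"
proof -
  obtain n where n: "n \<le> N" "exec w (if \<sigma> v \<noteq> {} then c else d) n \<sigma> \<sigma>'"
    using assms unfolding exec_le_def by blast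
  have "exec w (Test v c d) (Suc n) \<sigma> \<sigma>'"
    by (rule exec_Cons[where L = "\<lambda>K. (if \<sigma> v \<noteq> {} then c else d) # K" and ?\<sigma>1.0 = \<sigma>])
      (use n scan_probe_wf[OF assms(1)] assms(1) in \<open>auto simp: mstep_def sweep_probe exec_def simp del: scan.simps\<close>)
  then show ?thesis
    unfolding exec_le_def using n by blast
qed

lemma exec_le_While_done:
  assumes "wf_store w \<sigma>" "\<sigma> v = {}"
  shows "exec_le w (While v c) 1 \<sigma> \<sigma>"
  unfolding exec_le_def
  using scan_probe_wf[OF assms(1)] assms
  by (intro exI[of _ 1]) (auto simp: exec_def mstep_def sweep_probe simp del: scan.simps)

lemma exec_le_While_step:
  assumes "wf_store w \<sigma>" "\<sigma> v \<noteq> {}" "exec_le w c N \<sigma> \<sigma>1" "exec_le w (While v c) N' \<sigma>1 \<sigma>2"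
  shows "exec_le w (While v c) (Suc (N + N')) \<sigma> \<sigma>2"
proof -
  obtain n n' where n: "n \<le> N" "n' \<le> N'" "exec w c n \<sigma> \<sigma>1" "exec w (While v c) n' \<sigma>1 \<sigma>2"
    using assms unfolding exec_le_def by blast
  have "exec w (While v c) (Suc (n' + n)) \<sigma> \<sigma>2"
    by (rule exec_Cons[where L = "\<lambda>K. c # While v c # K" and ?\<sigma>1.0 = \<sigma>])
      (use n scan_probe_wf[OF assms(1)] assms(1,2) in
        \<open>auto simp: mstep_def sweep_probe exec_def funpow_add simp del: scan.simps\<close>)
  then show ?thesis
    unfolding exec_le_def using n by (intro exI[of _ "Suc (n' + n)"]) auto
qed

definition Assign :: "nat \<Rightarrow> (nat \<Rightarrow> nat set \<Rightarrow> bool) \<Rightarrow> cmd" where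
  "Assign t \<phi> = Op t (\<lambda>b a B. (b, \<phi> a B))"

text \<open>The flag carries the membership of the previous position, so the set moves one place to
  the right; a position pushed past the end disappears.\<close>

definition Shift :: "nat \<Rightarrow> cmd" where
  "Shift t = Op t (\<lambda>b a B. (t \<in> B, b))"

definition Fill :: "nat \<Rightarrow> nat \<Rightarrow> cmd" where
  "Fill t s = Op t (\<lambda>b a B. (b \<or> s \<in> B, b \<or> s \<in> B))"

lemma regs_ops [simp]: "regs (Assign t \<phi>) = {t}" "regs (Shift t) = {t}" "regs (Fill t s) = {t}"
  by (simp_all add: Assign_def Shift_def Fill_def)

lemma exec_Assign:
  "exec_le w (Assign t \<phi>) 1 \<sigma> (\<sigma>(t := {j. j \<le> length w \<and> \<phi> (sym_at w j) (bits \<sigma> j)}))"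
  using exec_le_Op[of w t "\<lambda>b a B. (b, \<phi> a B)" \<sigma>] by (simp add: Assign_def sweep_def)

lemma exec_Shift:
  "exec_le w (Shift t) 1 \<sigma> (\<sigma>(t := {j. j \<le> length w \<and> (\<exists>i\<in>\<sigma> t. j = Suc i)}))"
proof -
  have "scan (\<lambda>b a B. (t \<in> B, b)) w \<sigma> j \<longleftrightarrow> (\<exists>i\<in>\<sigma> t. j = Suc i)" for j
    by (cases j) (auto simp: bits_def)
  then show ?thesis
    using exec_le_Op[of w t "\<lambda>b a B. (t \<in> B, b)" \<sigma>] by (simp add: Shift_def sweep_def)
qed

lemma exec_Fill:
  "exec_le w (Fill t s) 1 \<sigma> (\<sigma>(t := {j. j \<le> length w \<and> (\<exists>i\<in>\<sigma> s. i \<le> j)}))"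
proof -
  let ?u = "\<lambda>b a B. (b \<or> s \<in> B, b \<or> s \<in> B)"
  have "scan ?u w \<sigma> j \<longleftrightarrow> (\<exists>i\<in>\<sigma> s. i < j)" for j
    by (induction j) (auto simp: bits_def less_Suc_eq)
  then have "snd (?u (scan ?u w \<sigma> j) (sym_at w j) (bits \<sigma> j)) \<longleftrightarrow> (\<exists>i\<in>\<sigma> s. i \<le> j)" for j
    by (auto simp: bits_def le_less)
  then show ?thesis
    using exec_le_Op[of w t ?u \<sigma>] by (simp add: Fill_def sweep_def)
qed

lemma wf_store_upd: "wf_store w \<sigma> \<Longrightarrow> t \<noteq> 0 \<Longrightarrow> A \<subseteq> {..length w} \<Longrightarrow> wf_store w (\<sigma>(t := A))"
  by (auto simp: wf_store_def)

text \<open>The counter is a singleton that starts at position 0, taken from register 0, and is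
  shifted until it falls off the tape.\<close>

definition For :: "nat \<Rightarrow> cmd \<Rightarrow> cmd" where
  "For v c = Seq (Assign v (\<lambda>_ B. 0 \<in> B)) (While v (Seq c (Shift v)))"

lemma regs_For [simp]: "regs (For v c) = insert v (regs c)"
  by (auto simp: For_def)

text \<open>\<open>frame\<close> is there because the loop itself overwrites \<open>v\<close>. A
  round costs \<open>b + 3\<close>: the body, the shift, and one control step each for
  \<open>While\<close> and \<open>Seq\<close>.\<close>

lemma exec_For:
  assumes step: "\<And>x \<sigma>. x \<le> length w \<Longrightarrow> wf_store w \<sigma> \<Longrightarrow> \<sigma> v = {x} \<Longrightarrow> Inv x \<sigma>
      \<Longrightarrow> \<exists>\<sigma>'. exec_le w c b \<sigma> \<sigma>' \<and> wf_store w \<sigma>' \<and> \<sigma>' v = {x} \<and> Inv (Suc x) \<sigma>'"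
    and frame: "\<And>x \<sigma> A. Inv x \<sigma> \<Longrightarrow> Inv x (\<sigma>(v := A))"
    and v: "v \<noteq> 0" and start: "wf_store w \<sigma>" "Inv 0 \<sigma>"
  shows "\<exists>\<sigma>'. exec_le w (For v c) (3 + (length w + 1) * (b + 3)) \<sigma> \<sigma>' \<and> wf_store w \<sigma>' \<and> Inv (Suc (length w)) \<sigma>'"
proof -
  let ?N = "length w" and ?W = "While v (Seq c (Shift v))"
  \<comment> \<open>\<open>k\<close> is the number of remaining rounds. For \<open>k = 0\<close> the
    counter would stand at \<open>Suc (length w)\<close>, so the intersection is empty and the loop
    ends.\<close>
  have loop: "\<exists>\<sigma>'. exec_le w ?W (1 + k * (b + 3)) \<sigma> \<sigma>' \<and> wf_store w \<sigma>' \<and> Inv (Suc ?N) \<sigma>'"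
    if "wf_store w \<sigma>" "k \<le> Suc ?N" "\<sigma> v = {Suc ?N - k} \<inter> {..?N}" "Inv (Suc ?N - k) \<sigma>" for k \<sigma>
    using that
  proof (induction k arbitrary: \<sigma>)
    case 0
    then show ?case
      using exec_le_While_done[of w \<sigma> v] by auto
  next
    case (Suc k)
    define x where "x = Suc ?N - Suc k"
    have x: "x \<le> ?N" "Suc ?N - k = Suc x"
      using Suc.prems(2) by (auto simp: x_def)
    have "\<sigma> v = {x}"
      using Suc.prems(3) x by (auto simp: x_def)
    then obtain \<sigma>1 where 1: "exec_le w c b \<sigma> \<sigma>1" "wf_store w \<sigma>1" "\<sigma>1 v = {x}" "Inv (Suc x) \<sigma>1"
      using step[OF x(1) Suc.prems(1)] Suc.prems(4) unfolding x_def by blast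
    define \<sigma>2 where "\<sigma>2 = \<sigma>1(v := {j. j \<le> ?N \<and> (\<exists>i\<in>\<sigma>1 v. j = Suc i)})"
    have "wf_store w \<sigma>2"
      unfolding \<sigma>2_def using 1 v by (intro wf_store_upd) auto
    moreover have "\<sigma>2 v = {Suc ?N - k} \<inter> {..?N}"
      using 1 x by (auto simp: \<sigma>2_def)
    moreover have "Inv (Suc ?N - k) \<sigma>2"
      unfolding \<sigma>2_def x(2) using 1 by (intro frame)
    ultimately obtain \<sigma>3 where 3: "exec_le w ?W (1 + k * (b + 3)) \<sigma>2 \<sigma>3" "wf_store w \<sigma>3" "Inv (Suc ?N) \<sigma>3"
      using Suc.IH[of \<sigma>2] Suc.prems(2) by auto
    have "exec_le w (Seq c (Shift v)) (Suc (b + 1)) \<sigma> \<sigma>2"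
      unfolding \<sigma>2_def using exec_le_Seq[OF Suc.prems(1) 1(1) exec_Shift] .
    then have "exec_le w ?W (Suc (Suc (b + 1) + (1 + k * (b + 3)))) \<sigma> \<sigma>3"
      using exec_le_While_step[OF Suc.prems(1) _ _ 3(1)] \<open>\<sigma> v = {x}\<close> by blast
    then show ?case
      using 3 by (intro exI[of _ \<sigma>3]) (auto elim!: exec_le_mono)
  qed
  define \<sigma>1 where "\<sigma>1 = \<sigma>(v := {j. j \<le> ?N \<and> 0 \<in> bits \<sigma> j})"
  have 1: "wf_store w \<sigma>1" "\<sigma>1 v = {0}" "Inv 0 \<sigma>1"
    using start v by (auto simp: \<sigma>1_def wf_store_def bits_def intro: frame)
  obtain \<sigma>2 where 2: "exec_le w ?W (1 + Suc ?N * (b + 3)) \<sigma>1 \<sigma>2" "wf_store w \<sigma>2" "Inv (Suc ?N) \<sigma>2"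
    using loop[of \<sigma>1 "Suc ?N"] 1 by auto
  have "exec_le w (For v c) (Suc (1 + (1 + Suc ?N * (b + 3)))) \<sigma> \<sigma>2"
    unfolding For_def using 2(1) exec_Assign[of w v "\<lambda>_ B. 0 \<in> B" \<sigma>]
    by (intro exec_le_Seq[OF start(1), where ?\<sigma>1.0 = \<sigma>1]) (auto simp: \<sigma>1_def)
  then show ?thesis
    using 2 by (intro exI[of _ \<sigma>2]) (auto elim!: exec_le_mono)
qed

text \<open>Register 1 holds \<open>X\<close>, register \<open>\<rho> i\<close> holds the singleton of the variable \<open>e i\<close>, and the truth
  value is returned as nonemptiness of register \<open>t\<close>, below which nothing is changed.\<close>
definition computes ::
    "cmd \<Rightarrow> (nat \<Rightarrow> nat) \<Rightarrow> (nat \<Rightarrow> nat) \<Rightarrow> nat \<Rightarrow> (nat list \<Rightarrow> nat set \<Rightarrow> (nat \<Rightarrow> nat) \<Rightarrow> bool) \<Rightarrow> bool" where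
  "computes c f \<rho> t P \<longleftrightarrow> poly_bounded f \<and> regs c \<subseteq> {t..} \<and>
     (\<forall>w \<sigma> e. wf_store w \<sigma> \<longrightarrow> (\<forall>i. \<sigma> (\<rho> i) = {e i}) \<longrightarrow>
        (\<exists>\<sigma>'. exec_le w c (f (length w)) \<sigma> \<sigma>' \<and> wf_store w \<sigma>' \<and> (\<forall>v<t. \<sigma>' v = \<sigma> v)
           \<and> (\<sigma>' t \<noteq> {} \<longleftrightarrow> P w (\<sigma> 1) e)))"

text \<open>Allowing every placement \<open>\<rho>\<close> of the variables and every first free
  register \<open>t\<close> lets subformulas be compiled with fresh registers. Environments are
  total; irrelevant variables can be placed in register 0, where they have the value 0.\<close>

definition definable :: "(nat list \<Rightarrow> nat set \<Rightarrow> (nat \<Rightarrow> nat) \<Rightarrow> bool) \<Rightarrow> bool" where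
  "definable P \<longleftrightarrow> (\<forall>\<rho> t. 2 \<le> t \<longrightarrow> (\<forall>i. \<rho> i < t) \<longrightarrow> (\<exists>c f. computes c f \<rho> t P))"

section \<open>Closure properties of definability\<close>

lemma computesI:
  assumes "poly_bounded f" "regs c \<subseteq> {t..}"
    "\<And>w \<sigma> e. wf_store w \<sigma> \<Longrightarrow> (\<And>i. \<sigma> (\<rho> i) = {e i}) \<Longrightarrow>
        (\<exists>\<sigma>'. exec_le w c (f (length w)) \<sigma> \<sigma>' \<and> wf_store w \<sigma>' \<and> (\<forall>v<t. \<sigma>' v = \<sigma> v)
           \<and> (\<sigma>' t \<noteq> {} \<longleftrightarrow> P w (\<sigma> 1) e))"
  shows "computes c f \<rho> t P"
  using assms unfolding computes_def by blast

lemma computesE: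
  assumes "computes c f \<rho> t P" "wf_store w \<sigma>" "\<And>i. \<sigma> (\<rho> i) = {e i}"
  obtains \<sigma>' where "exec_le w c (f (length w)) \<sigma> \<sigma>'" "wf_store w \<sigma>'" "\<And>v. v < t \<Longrightarrow> \<sigma>' v = \<sigma> v"
    "\<sigma>' t \<noteq> {} \<longleftrightarrow> P w (\<sigma> 1) e"
  using assms unfolding computes_def by blast

lemma computesD:
  assumes "computes c f \<rho> t P"
  shows "poly_bounded f" "regs c \<subseteq> {t..}"
  using assms unfolding computes_def by blast+

lemma definableE:
  assumes "definable P" "2 \<le> t" "\<forall>i. \<rho> i < t"
  obtains c f where "computes c f \<rho> t P"
  using assms unfolding definable_def by blast

text \<open>For atoms: one sweep keeps the positions that pass a local test, and the atom holds iff
  one is left.\<close>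

lemma definable_Assign:
  assumes "\<And>w \<sigma> e (\<rho> :: nat \<Rightarrow> nat). wf_store w \<sigma> \<Longrightarrow> (\<And>i. \<sigma> (\<rho> i) = {e i})
    \<Longrightarrow> (\<exists>j\<le>length w. \<phi> \<rho> (sym_at w j) (bits \<sigma> j)) \<longleftrightarrow> P w (\<sigma> 1) e"
  shows "definable P"
  unfolding definable_def
proof (intro allI impI exI)
  fix \<rho> :: "nat \<Rightarrow> nat" and t :: nat assume t: "2 \<le> t" "\<forall>i. \<rho> i < t"
  show "computes (Assign t (\<phi> \<rho>)) (\<lambda>_. 1) \<rho> t P"
  proof (rule computesI)
    fix w \<sigma> e assume \<sigma>: "wf_store w \<sigma>" "\<And>i. \<sigma> (\<rho> i) = {e i}"
    show "\<exists>\<sigma>'. exec_le w (Assign t (\<phi> \<rho>)) 1 \<sigma> \<sigma>' \<and> wf_store w \<sigma>' \<and> (\<forall>v<t. \<sigma>' v = \<sigma> v)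
           \<and> (\<sigma>' t \<noteq> {} \<longleftrightarrow> P w (\<sigma> 1) e)"
    proof (intro exI conjI)
      show "exec_le w (Assign t (\<phi> \<rho>)) 1 \<sigma> (\<sigma>(t := {j. j \<le> length w \<and> \<phi> \<rho> (sym_at w j) (bits \<sigma> j)}))"
        by (rule exec_Assign)
    qed (use \<sigma>(1) t assms[of w \<sigma> \<rho> e, OF \<sigma>] in \<open>auto intro!: wf_store_upd\<close>)
  qed (auto intro: poly_bounded_intros)
qed

lemma definable_sym: "definable (\<lambda>w X e. sym_at w (e i) = a)"
proof (rule definable_Assign)
  fix w \<sigma> e and \<rho> :: "nat \<Rightarrow> nat" assume \<sigma>: "wf_store w \<sigma>" "\<And>i. \<sigma> (\<rho> i) = {e i :: nat}"
  then have "e i \<le> length w"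
    unfolding wf_store_def by (metis atMost_iff insert_subset)
  then show "(\<exists>j\<le>length w. (\<lambda>\<rho> s B. s = a \<and> \<rho> i \<in> B) \<rho> (sym_at w j) (bits \<sigma> j)) \<longleftrightarrow> sym_at w (e i) = a"
    using \<sigma>(2)[of i] by (auto simp: bits_def)
qed

lemma definable_mem: "definable (\<lambda>w X e. e i \<in> X)"
proof (rule definable_Assign)
  fix w \<sigma> e and \<rho> :: "nat \<Rightarrow> nat" assume \<sigma>: "wf_store w \<sigma>" "\<And>i. \<sigma> (\<rho> i) = {e i :: nat}"
  then have "e i \<le> length w"
    unfolding wf_store_def by (metis atMost_iff insert_subset)
  then show "(\<exists>j\<le>length w. (\<lambda>\<rho> s B. 1 \<in> B \<and> \<rho> i \<in> B) \<rho> (sym_at w j) (bits \<sigma> j)) \<longleftrightarrow> e i \<in> \<sigma> 1"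
    using \<sigma>(2)[of i] by (auto simp: bits_def)
qed

lemma definable_le: "definable (\<lambda>w X e. e i \<le> e j)"
  unfolding definable_def
proof (intro allI impI exI)
  fix \<rho> :: "nat \<Rightarrow> nat" and t :: nat assume t: "2 \<le> t" "\<forall>i. \<rho> i < t"
  \<comment> \<open>\<open>Fill\<close> marks everything from \<open>e i\<close> on; the
    intersection with the register of \<open>e j\<close> is then nonempty iff the inequality
    holds.\<close>
  let ?c = "Seq (Fill t (\<rho> i)) (Assign t (\<lambda>_ B. t \<in> B \<and> \<rho> j \<in> B))"
  show "computes ?c (\<lambda>_. 3) \<rho> t (\<lambda>w X e. e i \<le> e j)"
  proof (rule computesI)
    fix w \<sigma> e assume \<sigma>: "wf_store w \<sigma>" "\<And>i. \<sigma> (\<rho> i) = {e i}"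
    have e: "e i \<le> length w" "e j \<le> length w"
      using \<sigma> unfolding wf_store_def by (metis atMost_iff insert_subset)+
    define \<sigma>1 where "\<sigma>1 = \<sigma>(t := {j. j \<le> length w \<and> (\<exists>i\<in>\<sigma> (\<rho> i). i \<le> j)})"
    have "exec_le w ?c (Suc (1 + 1)) \<sigma> (\<sigma>1(t := {k. k \<le> length w \<and> (t \<in> bits \<sigma>1 k \<and> \<rho> j \<in> bits \<sigma>1 k)}))"
      unfolding \<sigma>1_def by (rule exec_le_Seq[OF \<sigma>(1) exec_Fill exec_Assign])
    moreover have "\<sigma>1 (\<rho> j) = {e j}"
      using t(2) \<sigma>(2) by (simp add: \<sigma>1_def less_imp_neq)
    ultimately show "\<exists>\<sigma>'. exec_le w ?c 3 \<sigma> \<sigma>' \<and> wf_store w \<sigma>' \<and> (\<forall>v<t. \<sigma>' v = \<sigma> v)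
           \<and> (\<sigma>' t \<noteq> {} \<longleftrightarrow> e i \<le> e j)"
      using \<sigma> t e by (intro exI conjI, simp add: numeral_3_eq_3) (auto intro!: wf_store_upd simp: \<sigma>1_def bits_def)
  qed (auto intro: poly_bounded_intros)
qed

lemma definable_not:
  assumes "definable P"
  shows "definable (\<lambda>w X e. \<not> P w X e)"
  unfolding definable_def
proof (intro allI impI)
  fix \<rho> :: "nat \<Rightarrow> nat" and t :: nat assume t: "2 \<le> t" "\<forall>i. \<rho> i < t"
  obtain c f where c: "computes c f \<rho> t P"
    using assms t unfolding definable_def by blast
  let ?c = "Seq c (Test t (Assign t (\<lambda>_ _. False)) (Assign t (\<lambda>_ B. 0 \<in> B)))"
  have "computes ?c (\<lambda>n. Suc (f n + 2)) \<rho> t (\<lambda>w X e. \<not> P w X e)"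
  proof (rule computesI)
    fix w \<sigma> e assume \<sigma>: "wf_store w \<sigma>" "\<And>i. \<sigma> (\<rho> i) = {e i}"
    obtain \<sigma>1 where 1: "exec_le w c (f (length w)) \<sigma> \<sigma>1" "wf_store w \<sigma>1" "\<And>v. v < t \<Longrightarrow> \<sigma>1 v = \<sigma> v"
      "\<sigma>1 t \<noteq> {} \<longleftrightarrow> P w (\<sigma> 1) e"
      using computesE[OF c \<sigma>] by metis
    define A where "A = (if \<sigma>1 t \<noteq> {} then {} else {0::nat})"
    have "{j. j \<le> length w \<and> 0 \<in> bits \<sigma>1 j} = {0}"
      using 1(2) by (auto simp: wf_store_def bits_def)
    then have "exec_le w (if \<sigma>1 t \<noteq> {} then Assign t (\<lambda>_ _. False) else Assign t (\<lambda>_ B. 0 \<in> B)) 1 \<sigma>1 (\<sigma>1(t := A))"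
      using exec_Assign[of w t "\<lambda>_ _. False" \<sigma>1] exec_Assign[of w t "\<lambda>_ B. 0 \<in> B" \<sigma>1] by (auto simp: A_def)
    then have "exec_le w ?c (Suc (f (length w) + 2)) \<sigma> (\<sigma>1(t := A))"
      using exec_le_Seq[OF \<sigma>(1) 1(1) exec_le_Test[OF 1(2)]] by fastforce
    moreover have "wf_store w (\<sigma>1(t := A))"
      using 1(2) t by (intro wf_store_upd) (auto simp: A_def)
    ultimately show "\<exists>\<sigma>'. exec_le w ?c (Suc (f (length w) + 2)) \<sigma> \<sigma>' \<and> wf_store w \<sigma>' \<and> (\<forall>v<t. \<sigma>' v = \<sigma> v)
           \<and> (\<sigma>' t \<noteq> {} \<longleftrightarrow> \<not> P w (\<sigma> 1) e)"
      using 1 by (intro exI[of _ "\<sigma>1(t := A)"]) (auto simp: A_def)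
  qed (intro poly_bounded_intros computesD[OF c], use computesD(2)[OF c] in auto)
  then show "\<exists>c f. computes c f \<rho> t (\<lambda>w X e. \<not> P w X e)"
    by blast
qed

lemma definable_conj:
  assumes "definable P" "definable Q"
  shows "definable (\<lambda>w X e. P w X e \<and> Q w X e)"
  unfolding definable_def
proof (intro allI impI)
  fix \<rho> :: "nat \<Rightarrow> nat" and t :: nat assume t: "2 \<le> t" "\<forall>i. \<rho> i < t"
  obtain c f where c: "computes c f \<rho> t P"
    using assms(1) t unfolding definable_def by blast
  have "2 \<le> Suc t" "\<forall>i. \<rho> i < Suc t"
    using t by (auto simp: less_SucI)
  then obtain d g where d: "computes d g \<rho> (Suc t) Q"
    using assms(2) unfolding definable_def by blast
  let ?c = "Seq c (Seq d (Test (Suc t) Skip (Assign t (\<lambda>_ _. False))))"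
  have "computes ?c (\<lambda>n. Suc (f n + Suc (g n + 2))) \<rho> t (\<lambda>w X e. P w X e \<and> Q w X e)"
  proof (rule computesI)
    fix w \<sigma> e assume \<sigma>: "wf_store w \<sigma>" "\<And>i. \<sigma> (\<rho> i) = {e i}"
    obtain \<sigma>1 where 1: "exec_le w c (f (length w)) \<sigma> \<sigma>1" "wf_store w \<sigma>1" "\<And>v. v < t \<Longrightarrow> \<sigma>1 v = \<sigma> v"
      "\<sigma>1 t \<noteq> {} \<longleftrightarrow> P w (\<sigma> 1) e"
      using computesE[OF c \<sigma>] by metis
    have "\<sigma>1 (\<rho> i) = {e i}" for i
      using 1(3) t(2) \<sigma>(2) by simp
    then obtain \<sigma>2 where 2: "exec_le w d (g (length w)) \<sigma>1 \<sigma>2" "wf_store w \<sigma>2" "\<And>v. v < Suc t \<Longrightarrow> \<sigma>2 v = \<sigma>1 v"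
      "\<sigma>2 (Suc t) \<noteq> {} \<longleftrightarrow> Q w (\<sigma>1 1) e"
      using computesE[OF d 1(2)] by metis
    define \<sigma>3 where "\<sigma>3 = (if \<sigma>2 (Suc t) \<noteq> {} then \<sigma>2 else \<sigma>2(t := {}))"
    have "exec_le w (if \<sigma>2 (Suc t) \<noteq> {} then Skip else Assign t (\<lambda>_ _. False)) 1 \<sigma>2 \<sigma>3"
      using exec_Assign[of w t "\<lambda>_ _. False" \<sigma>2] exec_le_Skip[OF 2(2)] by (auto simp: \<sigma>3_def)
    then have "exec_le w ?c (Suc (f (length w) + Suc (g (length w) + 2))) \<sigma> \<sigma>3"
      using exec_le_Seq[OF \<sigma>(1) 1(1) exec_le_Seq[OF 1(2) 2(1) exec_le_Test[OF 2(2)]]] by fastforce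
    moreover have "wf_store w \<sigma>3"
      using 2(2) t by (auto simp: \<sigma>3_def intro!: wf_store_upd)
    ultimately show "\<exists>\<sigma>'. exec_le w ?c (Suc (f (length w) + Suc (g (length w) + 2))) \<sigma> \<sigma>' \<and> wf_store w \<sigma>'
        \<and> (\<forall>v<t. \<sigma>' v = \<sigma> v) \<and> (\<sigma>' t \<noteq> {} \<longleftrightarrow> P w (\<sigma> 1) e \<and> Q w (\<sigma> 1) e)"
      using 1 2 t by (intro exI[of _ \<sigma>3]) (auto simp: \<sigma>3_def)
  qed (intro poly_bounded_intros computesD[OF c] computesD[OF d],
      use computesD(2)[OF c] computesD(2)[OF d] in auto)
  then show "\<exists>c f. computes c f \<rho> t (\<lambda>w X e. P w X e \<and> Q w X e)"
    by blast
qed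

text \<open>The bound variable has index 0 and lives in register \<open>Suc t\<close>, and the body
  reports in \<open>Suc (Suc t)\<close>. Register \<open>t\<close> stays available to accumulate a
  result over all values.\<close>

lemma computes_bound:
  assumes "definable (\<lambda>w X e. P w X (e 0) (\<lambda>i. e (Suc i)))" "2 \<le> t" "\<forall>i. \<rho> i < t"
  obtains c f where "poly_bounded f" "regs c \<subseteq> {t..}"
    "\<forall>w \<sigma> e x. wf_store w \<sigma> \<longrightarrow> (\<forall>i. \<sigma> (\<rho> i) = {e i}) \<longrightarrow> \<sigma> (Suc t) = {x} \<longrightarrow>
      (\<exists>\<sigma>'. exec_le w c (f (length w)) \<sigma> \<sigma>' \<and> wf_store w \<sigma>' \<and> (\<forall>v<Suc (Suc t). \<sigma>' v = \<sigma> v)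
         \<and> (\<sigma>' (Suc (Suc t)) \<noteq> {} \<longleftrightarrow> P w (\<sigma> 1) x e))"
proof -
  let ?\<rho> = "case_nat (Suc t) \<rho>"
  have "2 \<le> Suc (Suc t)" "\<forall>i. ?\<rho> i < Suc (Suc t)"
    using assms(3) by (auto simp: less_SucI split: nat.split)
  then obtain c f where c: "computes c f ?\<rho> (Suc (Suc t)) (\<lambda>w X e. P w X (e 0) (\<lambda>i. e (Suc i)))"
    by (rule definableE[OF assms(1)])
  show ?thesis
  proof (rule that[of f c], goal_cases)
    case 3
    show ?case
    proof (intro allI impI)
      fix w \<sigma> e x assume \<sigma>: "wf_store w \<sigma>" "\<forall>i. \<sigma> (\<rho> i) = {e i}" "\<sigma> (Suc t) = {x}"
      have "\<sigma> (?\<rho> i) = {case_nat x e i}" for i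
        using \<sigma> by (auto split: nat.split)
      then obtain \<sigma>' where "exec_le w c (f (length w)) \<sigma> \<sigma>'" "wf_store w \<sigma>'" "\<And>v. v < Suc (Suc t) \<Longrightarrow> \<sigma>' v = \<sigma> v"
        "\<sigma>' (Suc (Suc t)) \<noteq> {} \<longleftrightarrow> P w (\<sigma> 1) (case_nat x e 0) (\<lambda>i. case_nat x e (Suc i))"
        by (rule computesE[OF c \<sigma>(1)]) (assumption | rule that)+
      then show "\<exists>\<sigma>'. exec_le w c (f (length w)) \<sigma> \<sigma>' \<and> wf_store w \<sigma>' \<and> (\<forall>v<Suc (Suc t). \<sigma>' v = \<sigma> v)
           \<and> (\<sigma>' (Suc (Suc t)) \<noteq> {} \<longleftrightarrow> P w (\<sigma> 1) x e)"
        unfolding old.nat.simps by blast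
    qed
  qed (use computesD[OF c] in auto)
qed

lemma definable_ex:
  assumes "definable (\<lambda>w X e. P w X (e 0) (\<lambda>i. e (Suc i)))"
  shows "definable (\<lambda>w X e. \<exists>x\<le>length w. P w X x e)"
  unfolding definable_def
proof (intro allI impI)
  fix \<rho> :: "nat \<Rightarrow> nat" and t :: nat assume t: "2 \<le> t" "\<forall>i. \<rho> i < t"
  obtain c f where f: "poly_bounded f" "regs c \<subseteq> {t..}" and
    c: "\<forall>w \<sigma> e x. wf_store w \<sigma> \<longrightarrow> (\<forall>i. \<sigma> (\<rho> i) = {e i}) \<longrightarrow> \<sigma> (Suc t) = {x} \<longrightarrow>
      (\<exists>\<sigma>'. exec_le w c (f (length w)) \<sigma> \<sigma>' \<and> wf_store w \<sigma>' \<and> (\<forall>v<Suc (Suc t). \<sigma>' v = \<sigma> v)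
         \<and> (\<sigma>' (Suc (Suc t)) \<noteq> {} \<longleftrightarrow> P w (\<sigma> 1) x e))"
    by (rule computes_bound[OF assms t]) (rule that)
  let ?b = "Seq c (Test (Suc (Suc t)) (Assign t (\<lambda>_ B. 0 \<in> B)) Skip)"
  let ?c = "Seq (Assign t (\<lambda>_ _. False)) (For (Suc t) ?b)"
  let ?f = "\<lambda>n. Suc (1 + (3 + (n + 1) * (Suc (f n + 2) + 3)))"
  have "computes ?c ?f \<rho> t (\<lambda>w X e. \<exists>x\<le>length w. P w X x e)"
  proof (rule computesI)
    fix w \<sigma> e assume \<sigma>: "wf_store w \<sigma>" "\<And>i. \<sigma> (\<rho> i) = {e i}"
    define Inv where "Inv = (\<lambda>x \<tau>. (\<forall>v<t. \<tau> v = \<sigma> v) \<and> (\<tau> t \<noteq> {} \<longleftrightarrow> (\<exists>y<x. P w (\<sigma> 1) y e)))"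
    define \<sigma>1 where "\<sigma>1 = \<sigma>(t := {})"
    have frame: "Inv x (\<tau>(Suc t := A))" if "Inv x \<tau>" for x \<tau> A
      using that by (auto simp: Inv_def)
    have start: "Inv 0 \<sigma>1"
      by (auto simp: Inv_def \<sigma>1_def)
    have "exec_le w (Assign t (\<lambda>_ _. False)) 1 \<sigma> \<sigma>1"
      using exec_Assign[of w t "\<lambda>_ _. False" \<sigma>] by (simp add: \<sigma>1_def)
    moreover have "wf_store w \<sigma>1"
      using \<sigma> t by (auto simp: \<sigma>1_def intro!: wf_store_upd)
    moreover have "\<exists>\<sigma>'. exec_le w (For (Suc t) ?b) (3 + (length w + 1) * (Suc (f (length w) + 2) + 3)) \<sigma>1 \<sigma>'
        \<and> wf_store w \<sigma>' \<and> Inv (Suc (length w)) \<sigma>'"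
    proof (rule exec_For)
      fix x \<tau> assume \<tau>: "x \<le> length w" "wf_store w \<tau>" "\<tau> (Suc t) = {x}" "Inv x \<tau>"
      have "\<tau> (\<rho> i) = {e i}" for i
        using \<tau>(4) t \<sigma>(2) by (auto simp: Inv_def)
      from c[rule_format, OF \<tau>(2) this \<tau>(3)] obtain \<tau>1 where 1: "exec_le w c (f (length w)) \<tau> \<tau>1" "wf_store w \<tau>1"
        "\<And>v. v < Suc (Suc t) \<Longrightarrow> \<tau>1 v = \<tau> v" "\<tau>1 (Suc (Suc t)) \<noteq> {} \<longleftrightarrow> P w (\<tau> 1) x e"
        by blast
      define \<tau>2 where "\<tau>2 = (if \<tau>1 (Suc (Suc t)) \<noteq> {} then \<tau>1(t := {0}) else \<tau>1)"
      have z: "{j. j \<le> length w \<and> 0 \<in> bits \<tau>1 j} = {0}"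
        using 1(2) by (auto simp: wf_store_def bits_def)
      have "exec_le w (if \<tau>1 (Suc (Suc t)) \<noteq> {} then Assign t (\<lambda>_ B. 0 \<in> B) else Skip) 1 \<tau>1 \<tau>2"
        using exec_Assign[of w t "\<lambda>_ B. 0 \<in> B" \<tau>1] exec_le_Skip[OF 1(2)] by (auto simp: \<tau>2_def z)
      then have "exec_le w ?b (Suc (f (length w) + 2)) \<tau> \<tau>2"
        using exec_le_Seq[OF \<tau>(2) 1(1) exec_le_Test[OF 1(2)]] by fastforce
      moreover have "wf_store w \<tau>2"
        using 1(2) t by (auto simp: \<tau>2_def intro!: wf_store_upd)
      moreover have "\<tau>2 (Suc t) = {x}"
        using 1(3) \<tau>(3) by (auto simp: \<tau>2_def)
      moreover have "Inv (Suc x) \<tau>2"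
        using \<tau>(4) 1(3,4) t by (auto simp: Inv_def \<tau>2_def less_Suc_eq)
      ultimately show "\<exists>\<sigma>'. exec_le w ?b (Suc (f (length w) + 2)) \<tau> \<sigma>' \<and> wf_store w \<sigma>' \<and> \<sigma>' (Suc t) = {x} \<and> Inv (Suc x) \<sigma>'"
        by blast
    qed (rule frame \<open>wf_store w \<sigma>1\<close> start | assumption | simp)+
    ultimately obtain \<sigma>2 where "exec_le w ?c (?f (length w)) \<sigma> \<sigma>2" "wf_store w \<sigma>2" "Inv (Suc (length w)) \<sigma>2"
      using exec_le_Seq[OF \<sigma>(1)] by blast
    then show "\<exists>\<sigma>'. exec_le w ?c (?f (length w)) \<sigma> \<sigma>' \<and> wf_store w \<sigma>'
        \<and> (\<forall>v<t. \<sigma>' v = \<sigma> v) \<and> (\<sigma>' t \<noteq> {} \<longleftrightarrow> (\<exists>x\<le>length w. P w (\<sigma> 1) x e))"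
      by (intro exI[of _ \<sigma>2]) (auto simp: Inv_def less_Suc_eq_le)
  qed (intro poly_bounded_intros f(1), use f(2) in auto)
  then show "\<exists>c f. computes c f \<rho> t (\<lambda>w X e. \<exists>x\<le>length w. P w X x e)"
    by blast
qed

lemma definable_count:
  assumes "definable (\<lambda>w X e. P w X (e 0) (\<lambda>i. e (Suc i)))"
  shows "definable (\<lambda>w X e. card {x. x \<le> length w \<and> P w X x e} = e j)"
  unfolding definable_def
proof (intro allI impI)
  fix \<rho> :: "nat \<Rightarrow> nat" and t :: nat assume t: "2 \<le> t" "\<forall>i. \<rho> i < t"
  obtain c f where f: "poly_bounded f" "regs c \<subseteq> {t..}" and
    c: "\<forall>w \<sigma> e x. wf_store w \<sigma> \<longrightarrow> (\<forall>i. \<sigma> (\<rho> i) = {e i}) \<longrightarrow> \<sigma> (Suc t) = {x} \<longrightarrow>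
      (\<exists>\<sigma>'. exec_le w c (f (length w)) \<sigma> \<sigma>' \<and> wf_store w \<sigma>' \<and> (\<forall>v<Suc (Suc t). \<sigma>' v = \<sigma> v)
         \<and> (\<sigma>' (Suc (Suc t)) \<noteq> {} \<longleftrightarrow> P w (\<sigma> 1) x e))"
    by (rule computes_bound[OF assms t]) (rule that)
  let ?b = "Seq c (Test (Suc (Suc t)) (Shift t) Skip)"
  let ?c = "Seq (Assign t (\<lambda>_ B. 0 \<in> B)) (Seq (For (Suc t) ?b) (Assign t (\<lambda>_ B. t \<in> B \<and> \<rho> j \<in> B)))"
  let ?f = "\<lambda>n. Suc (1 + Suc ((3 + (n + 1) * (Suc (f n + 2) + 3)) + 1))"
  have "computes ?c ?f \<rho> t (\<lambda>w X e. card {x. x \<le> length w \<and> P w X x e} = e j)"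
  proof (rule computesI)
    fix w \<sigma> e assume \<sigma>: "wf_store w \<sigma>" "\<And>i. \<sigma> (\<rho> i) = {e i}"
    define n where "n = (\<lambda>x. card {y. y < x \<and> P w (\<sigma> 1) y e})"
    have n_Suc: "n (Suc x) = (if P w (\<sigma> 1) x e then Suc (n x) else n x)" for x
    proof -
      have "{y. y < Suc x \<and> P w (\<sigma> 1) y e} =
          (if P w (\<sigma> 1) x e then insert x {y. y < x \<and> P w (\<sigma> 1) y e} else {y. y < x \<and> P w (\<sigma> 1) y e})"
        by (auto simp: less_Suc_eq)
      then show ?thesis
        by (simp add: n_def)
    qed
    \<comment> \<open>The running count is one position in register \<open>t\<close>, shifted at
      every hit. If all \<open>length w + 1\<close> positions are hits, it leaves the tape; an empty
      register is then right, because \<open>e j \<le> length w\<close>.\<close>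
    define Inv where "Inv = (\<lambda>x \<tau>. (\<forall>v<t. \<tau> v = \<sigma> v) \<and> \<tau> t = {n x} \<inter> {..length w})"
    define \<sigma>1 where "\<sigma>1 = \<sigma>(t := {0})"
    have frame: "Inv x (\<tau>(Suc t := A))" if "Inv x \<tau>" for x \<tau> A
      using that by (auto simp: Inv_def)
    have start: "Inv 0 \<sigma>1"
      by (auto simp: Inv_def \<sigma>1_def n_def)
    have "{j. j \<le> length w \<and> 0 \<in> bits \<sigma> j} = {0}"
      using \<sigma>(1) by (auto simp: wf_store_def bits_def)
    then have 1: "exec_le w (Assign t (\<lambda>_ B. 0 \<in> B)) 1 \<sigma> \<sigma>1"
      using exec_Assign[of w t "\<lambda>_ B. 0 \<in> B" \<sigma>] by (simp add: \<sigma>1_def)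
    have wf1: "wf_store w \<sigma>1"
      using \<sigma> t by (auto simp: \<sigma>1_def intro!: wf_store_upd)
    have "\<exists>\<sigma>'. exec_le w (For (Suc t) ?b) (3 + (length w + 1) * (Suc (f (length w) + 2) + 3)) \<sigma>1 \<sigma>'
        \<and> wf_store w \<sigma>' \<and> Inv (Suc (length w)) \<sigma>'"
    proof (rule exec_For)
      fix x \<tau> assume \<tau>: "x \<le> length w" "wf_store w \<tau>" "\<tau> (Suc t) = {x}" "Inv x \<tau>"
      have "\<tau> (\<rho> i) = {e i}" for i
        using \<tau>(4) t \<sigma>(2) by (auto simp: Inv_def)
      from c[rule_format, OF \<tau>(2) this \<tau>(3)] obtain \<tau>1 where 1: "exec_le w c (f (length w)) \<tau> \<tau>1" "wf_store w \<tau>1"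
        "\<And>v. v < Suc (Suc t) \<Longrightarrow> \<tau>1 v = \<tau> v" "\<tau>1 (Suc (Suc t)) \<noteq> {} \<longleftrightarrow> P w (\<tau> 1) x e"
        by blast
      define \<tau>2 where "\<tau>2 = (if \<tau>1 (Suc (Suc t)) \<noteq> {}
        then \<tau>1(t := {j. j \<le> length w \<and> (\<exists>i\<in>\<tau>1 t. j = Suc i)}) else \<tau>1)"
      have "exec_le w (if \<tau>1 (Suc (Suc t)) \<noteq> {} then Shift t else Skip) 1 \<tau>1 \<tau>2"
        using exec_Shift[of w t \<tau>1] exec_le_Skip[OF 1(2)] by (auto simp: \<tau>2_def)
      then have "exec_le w ?b (Suc (f (length w) + 2)) \<tau> \<tau>2"
        using exec_le_Seq[OF \<tau>(2) 1(1) exec_le_Test[OF 1(2)]] by fastforce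
      moreover have "wf_store w \<tau>2"
        using 1(2) t by (auto simp: \<tau>2_def intro!: wf_store_upd)
      moreover have "\<tau>2 (Suc t) = {x}"
        using 1(3) \<tau>(3) by (auto simp: \<tau>2_def)
      moreover have "\<tau>1 t = \<tau> t" "\<tau> 1 = \<sigma> 1"
        using 1(3) \<tau>(4) t by (auto simp: Inv_def)
      then have "Inv (Suc x) \<tau>2"
        using \<tau>(4) 1(3,4) by (auto simp: Inv_def \<tau>2_def n_Suc)
      ultimately show "\<exists>\<sigma>'. exec_le w ?b (Suc (f (length w) + 2)) \<tau> \<sigma>' \<and> wf_store w \<sigma>' \<and> \<sigma>' (Suc t) = {x} \<and> Inv (Suc x) \<sigma>'"
        by blast
    qed (rule frame wf1 start | assumption | simp)+
    then obtain \<sigma>2 where 2: "exec_le w (For (Suc t) ?b) (3 + (length w + 1) * (Suc (f (length w) + 2) + 3)) \<sigma>1 \<sigma>2"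
      "wf_store w \<sigma>2" "Inv (Suc (length w)) \<sigma>2" by blast
    define \<sigma>3 where "\<sigma>3 = \<sigma>2(t := {k. k \<le> length w \<and> (t \<in> bits \<sigma>2 k \<and> \<rho> j \<in> bits \<sigma>2 k)})"
    have "exec_le w ?c (?f (length w)) \<sigma> \<sigma>3"
      unfolding \<sigma>3_def by (intro exec_le_Seq[OF \<sigma>(1) 1] exec_le_Seq[OF wf1 2(1)] exec_Assign)
    moreover have "wf_store w \<sigma>3"
      using 2(2) t by (auto simp: \<sigma>3_def intro!: wf_store_upd)
    moreover have "e j \<le> length w"
      using \<sigma> unfolding wf_store_def by (metis atMost_iff insert_subset)
    then have "\<sigma>3 t \<noteq> {} \<longleftrightarrow> card {x. x \<le> length w \<and> P w (\<sigma> 1) x e} = e j"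
      using 2(3) t(2) \<sigma>(2) by (auto simp: \<sigma>3_def Inv_def bits_def n_def less_Suc_eq_le)
    moreover have "\<forall>v<t. \<sigma>3 v = \<sigma> v"
      using 2(3) by (auto simp: \<sigma>3_def Inv_def)
    ultimately show "\<exists>\<sigma>'. exec_le w ?c (?f (length w)) \<sigma> \<sigma>' \<and> wf_store w \<sigma>'
        \<and> (\<forall>v<t. \<sigma>' v = \<sigma> v) \<and> (\<sigma>' t \<noteq> {} \<longleftrightarrow> card {x. x \<le> length w \<and> P w (\<sigma> 1) x e} = e j)"
      by blast
  qed (intro poly_bounded_intros f(1), use f(2) in auto)
  then show "\<exists>c f. computes c f \<rho> t (\<lambda>w X e. card {x. x \<le> length w \<and> P w X x e} = e j)"
    by blast
qed

lemma definable_disj: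
  assumes "definable P" "definable Q"
  shows "definable (\<lambda>w X e. P w X e \<or> Q w X e)"
  using definable_not[OF definable_conj[OF definable_not[OF assms(1)] definable_not[OF assms(2)]]] by simp

lemma definable_imp:
  assumes "definable P" "definable Q"
  shows "definable (\<lambda>w X e. P w X e \<longrightarrow> Q w X e)"
  using definable_not[OF definable_conj[OF assms(1) definable_not[OF assms(2)]]] by simp

lemma definable_all:
  assumes "definable (\<lambda>w X e. P w X (e 0) (\<lambda>i. e (Suc i)))"
  shows "definable (\<lambda>w X e. \<forall>x\<le>length w. P w X x e)"
  using definable_not[OF definable_ex[OF definable_not[OF assms]]] by simp

lemma definable_less: "definable (\<lambda>w X e. e i < e j)"
  using definable_not[OF definable_le[of j i]] by (simp add: not_le)

lemma definable_eq: "definable (\<lambda>w X e. e i = e j)"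
  using definable_conj[OF definable_le[of i j] definable_le[of j i]] by (simp add: order.eq_iff)

lemmas definable_intros = definable_count definable_ex definable_all definable_conj definable_disj
  definable_imp definable_not definable_sym definable_mem definable_less definable_le definable_eq

text \<open>Register 1 grows in place, so a round may already use what it added. By
  \<open>mono\<close> it still stays inside the least fixed point and covers one application of the
  operator. A round that starts from a set not yet closed adds a position, so
  \<open>length w + 1\<close> rounds suffice.\<close>

theorem least_fixed_point_decidable:
  assumes F: "definable (\<lambda>w X e. F w X (e 0))" and G: "definable (\<lambda>w X e. G w X)"
    and mono: "\<And>w X Y z. X \<subseteq> Y \<Longrightarrow> F w X z \<Longrightarrow> F w Y z"
  shows "\<exists>M k. wf_tm M \<and> (\<forall>w. w \<noteq> [] \<longrightarrow> set w \<subseteq> {1, 2, 3} \<longrightarrow>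
    fst (tm_run M (k * (length w + 1) ^ k) w) = (if G w (lfp (\<lambda>X. {z. z \<le> length w \<and> F w X z})) then 1 else 2))"
proof -
  \<comment> \<open>Variable 0 is the inner counter, register 3; all others rest in register 0.
    Register 2 counts the rounds, so the formula works from register 4 on.\<close>
  let ?\<rho> = "case_nat 3 (\<lambda>_. 0::nat)"
  have "\<forall>i. ?\<rho> i < 4"
    by (auto split: nat.split)
  then obtain c f where c: "computes c f ?\<rho> 4 (\<lambda>w X e. F w X (e 0))"
    by (rule definableE[OF F, rotated]) auto
  obtain d g where d: "computes d g (\<lambda>_. 0) 2 (\<lambda>w X e. G w X)"
    by (rule definableE[OF G, where t = 2 and \<rho> = "\<lambda>_. 0"]) auto
  let ?body = "Seq c (Test 4 (Assign 1 (\<lambda>_ B. 1 \<in> B \<or> 3 \<in> B)) Skip)"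
  let ?P = "Seq (For 2 (For 3 ?body)) (Seq d (Assign 1 (\<lambda>_ B. 2 \<in> B)))"
  define b where "b = (\<lambda>n. 3 + (n + 1) * (Suc (f n + 2) + 3))"
  define p where "p = (\<lambda>n. Suc (3 + (n + 1) * (b n + 3) + Suc (g n + 1)))"
  have "poly_bounded (\<lambda>n. (p n + 3) * (2 * n + 2))"
    unfolding p_def b_def by (intro poly_bounded_intros computesD[OF c] computesD[OF d])
  then obtain k where k: "\<And>n. (p n + 3) * (2 * n + 2) \<le> k * (n + 1) ^ k"
    unfolding poly_bounded_def by blast
  have "0 \<notin> regs ?P"
    using c d by (auto simp: computes_def)
  then obtain M where M: "wf_tm M" "\<And>w n \<sigma> T. w \<noteq> [] \<Longrightarrow> set w \<subseteq> {1, 2, 3} \<Longrightarrow> exec w ?P n init_store \<sigma>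
      \<Longrightarrow> (n + 3) * (2 * length w + 2) \<le> T \<Longrightarrow> fst (tm_run M T w) = (if \<sigma> 1 \<noteq> {} then 1 else 2)"
    by (rule cmd_decider) blast
  have "fst (tm_run M (k * (length w + 1) ^ k) w) = (if G w (lfp (\<lambda>X. {z. z \<le> length w \<and> F w X z})) then 1 else 2)"
    if w: "w \<noteq> []" "set w \<subseteq> {1, 2, 3}" for w
  proof -
    let ?N = "length w"
    define \<Phi> where "\<Phi> = (\<lambda>X. {z. z \<le> ?N \<and> F w X z})"
    define L where "L = lfp \<Phi>"
    have mono\<Phi>: "mono \<Phi>"
      using mono by (auto simp: \<Phi>_def mono_def)
    have L_closed: "\<Phi> L \<subseteq> L"
      using lfp_unfold[OF mono\<Phi>] by (simp add: L_def)
    have L_least: "L \<subseteq> X" if "\<Phi> X \<subseteq> X" for X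
      using that unfolding L_def by (rule lfp_lowerbound)
    have inner: "\<exists>\<sigma>'. exec_le w (For 3 ?body) (b ?N) \<sigma> \<sigma>' \<and> wf_store w \<sigma>'
        \<and> (\<sigma>' 2 = \<sigma> 2 \<and> \<sigma> 1 \<subseteq> \<sigma>' 1 \<and> \<sigma>' 1 \<subseteq> L \<and> (\<forall>y<Suc ?N. F w (\<sigma> 1) y \<longrightarrow> y \<in> \<sigma>' 1))"
      if \<sigma>: "wf_store w \<sigma>" "\<sigma> 1 \<subseteq> L" for \<sigma>
      unfolding b_def
    proof (rule exec_For)
      fix x \<tau> assume \<tau>: "x \<le> ?N" "wf_store w \<tau>" "\<tau> 3 = {x}"
        "\<tau> 2 = \<sigma> 2 \<and> \<sigma> 1 \<subseteq> \<tau> 1 \<and> \<tau> 1 \<subseteq> L \<and> (\<forall>y<x. F w (\<sigma> 1) y \<longrightarrow> y \<in> \<tau> 1)"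
      have "\<tau> (?\<rho> i) = {case_nat x (\<lambda>_. 0) i}" for i
        using \<tau>(2,3) by (auto simp: wf_store_def split: nat.split)
      from computesE[OF c \<tau>(2), OF this] obtain \<tau>1 where 1: "exec_le w c (f ?N) \<tau> \<tau>1" "wf_store w \<tau>1"
        "\<And>v. v < 4 \<Longrightarrow> \<tau>1 v = \<tau> v" "\<tau>1 4 \<noteq> {} \<longleftrightarrow> F w (\<tau> 1) x"
        by (metis old.nat.simps(4))
      define \<tau>2 where "\<tau>2 = (if \<tau>1 4 \<noteq> {} then \<tau>1(1 := insert x (\<tau> 1)) else \<tau>1)"
      have ins: "{j. j \<le> ?N \<and> (1 \<in> bits \<tau>1 j \<or> 3 \<in> bits \<tau>1 j)} = insert x (\<tau> 1)"
        using 1(3)[of 1] 1(3)[of 3] \<tau>(1-3) by (auto simp: bits_def wf_store_def)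
      have "exec_le w (if \<tau>1 4 \<noteq> {} then Assign 1 (\<lambda>_ B. 1 \<in> B \<or> 3 \<in> B) else Skip) 1 \<tau>1 \<tau>2"
        using exec_Assign[of w 1 "\<lambda>_ B. 1 \<in> B \<or> 3 \<in> B" \<tau>1] exec_le_Skip[OF 1(2)] unfolding ins by (simp add: \<tau>2_def)
      then have "exec_le w ?body (Suc (f ?N + 2)) \<tau> \<tau>2"
        using exec_le_Seq[OF \<tau>(2) 1(1) exec_le_Test[OF 1(2)]] by fastforce
      moreover have "wf_store w \<tau>2"
        using 1(2) \<tau>(1,2) by (auto simp: \<tau>2_def wf_store_def)
      moreover have "\<tau>2 3 = {x}" "\<tau>2 2 = \<sigma> 2"
        using 1(3) \<tau>(3,4) by (auto simp: \<tau>2_def)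
      moreover have "F w (\<tau> 1) x \<Longrightarrow> x \<in> L"
        using mono[of "\<tau> 1" L w x] \<tau>(1,4) L_closed by (auto simp: \<Phi>_def)
      then have "\<sigma> 1 \<subseteq> \<tau>2 1" "\<tau>2 1 \<subseteq> L"
        using 1(3)[of 1] 1(4) \<tau>(4) by (auto simp: \<tau>2_def)
      moreover have "\<forall>y<Suc x. F w (\<sigma> 1) y \<longrightarrow> y \<in> \<tau>2 1"
        using 1(3)[of 1] 1(4) \<tau>(4) mono[of "\<sigma> 1" "\<tau> 1" w x] by (auto simp: \<tau>2_def less_Suc_eq)
      ultimately show "\<exists>\<sigma>'. exec_le w ?body (Suc (f ?N + 2)) \<tau> \<sigma>' \<and> wf_store w \<sigma>' \<and> \<sigma>' 3 = {x} \<and>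
          (\<sigma>' 2 = \<sigma> 2 \<and> \<sigma> 1 \<subseteq> \<sigma>' 1 \<and> \<sigma>' 1 \<subseteq> L \<and> (\<forall>y<Suc x. F w (\<sigma> 1) y \<longrightarrow> y \<in> \<sigma>' 1))"
        by blast
    qed (use \<sigma> in auto)
    have init1: "init_store 1 = {}"
      by (simp add: init_store_def)
    have wf0: "wf_store w init_store"
      by (auto simp: wf_store_def init_store_def)
    have "\<exists>\<sigma>'. exec_le w (For 2 (For 3 ?body)) (3 + (?N + 1) * (b ?N + 3)) init_store \<sigma>' \<and> wf_store w \<sigma>'
        \<and> (\<sigma>' 1 \<subseteq> L \<and> (\<Phi> (\<sigma>' 1) \<subseteq> \<sigma>' 1 \<or> Suc ?N \<le> card (\<sigma>' 1)))"
    proof (rule exec_For)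
      fix x \<tau> assume \<tau>: "x \<le> ?N" "wf_store w \<tau>" "\<tau> 2 = {x}" "\<tau> 1 \<subseteq> L \<and> (\<Phi> (\<tau> 1) \<subseteq> \<tau> 1 \<or> x \<le> card (\<tau> 1))"
      obtain \<tau>' where 1: "exec_le w (For 3 ?body) (b ?N) \<tau> \<tau>'" "wf_store w \<tau>'" "\<tau>' 2 = \<tau> 2" "\<tau> 1 \<subseteq> \<tau>' 1" "\<tau>' 1 \<subseteq> L"
        "\<forall>y<Suc ?N. F w (\<tau> 1) y \<longrightarrow> y \<in> \<tau>' 1"
        using inner[OF \<tau>(2)] \<tau>(4) by blast
      have "\<Phi> (\<tau>' 1) \<subseteq> \<tau>' 1 \<or> Suc x \<le> card (\<tau>' 1)"
      proof (cases "\<Phi> (\<tau> 1) \<subseteq> \<tau> 1")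
        case True
        then have "\<tau>' 1 = L"
          using L_least[OF True] 1(4,5) by blast
        then show ?thesis
          using L_closed by simp
      next
        case False
        then have "\<tau> 1 \<subset> \<tau>' 1"
          using 1(4,6) by (auto simp: \<Phi>_def less_Suc_eq_le)
        moreover have "finite (\<tau>' 1)"
          using 1(2) unfolding wf_store_def by (meson finite_atMost finite_subset)
        ultimately have "card (\<tau> 1) < card (\<tau>' 1)"
          by (simp add: psubset_card_mono)
        then show ?thesis
          using False \<tau>(4) by auto
      qed
      then show "\<exists>\<sigma>'. exec_le w (For 3 ?body) (b ?N) \<tau> \<sigma>' \<and> wf_store w \<sigma>' \<and> \<sigma>' 2 = {x} \<and>
          (\<sigma>' 1 \<subseteq> L \<and> (\<Phi> (\<sigma>' 1) \<subseteq> \<sigma>' 1 \<or> Suc x \<le> card (\<sigma>' 1)))"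
        using 1 \<tau>(3) by auto
    qed (use wf0 init1 in auto)
    then obtain \<sigma>1 where 1: "exec_le w (For 2 (For 3 ?body)) (3 + (?N + 1) * (b ?N + 3)) init_store \<sigma>1" "wf_store w \<sigma>1"
      "\<sigma>1 1 \<subseteq> L" "\<Phi> (\<sigma>1 1) \<subseteq> \<sigma>1 1 \<or> Suc ?N \<le> card (\<sigma>1 1)" by blast
    have "\<Phi> (\<sigma>1 1) \<subseteq> \<sigma>1 1"
    proof (rule disjE[OF 1(4)])
      \<comment> \<open>All positions are present, and the operator yields only positions.\<close>
      assume "Suc ?N \<le> card (\<sigma>1 1)"
      then have "\<sigma>1 1 = {..?N}"
        using 1(2) by (intro card_seteq) (auto simp: wf_store_def)
      then show ?thesis
        by (auto simp: \<Phi>_def)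
    qed
    then have L: "\<sigma>1 1 = L"
      using 1(3) L_least by blast
    have "\<sigma>1 0 = {0}"
      using 1(2) by (simp add: wf_store_def)
    from computesE[OF d 1(2), of "\<lambda>_. 0", OF this] obtain \<sigma>2 where 2: "exec_le w d (g ?N) \<sigma>1 \<sigma>2" "wf_store w \<sigma>2"
      "\<sigma>2 2 \<noteq> {} \<longleftrightarrow> G w L"
      using L by metis
    define \<sigma>3 where "\<sigma>3 = \<sigma>2(1 := {j. j \<le> ?N \<and> 2 \<in> bits \<sigma>2 j})"
    have "exec_le w ?P (p ?N) init_store \<sigma>3"
      unfolding \<sigma>3_def p_def by (intro exec_le_Seq[OF wf0 1(1)] exec_le_Seq[OF 1(2) 2(1)] exec_Assign)
    then obtain n where n: "n \<le> p ?N" "exec w ?P n init_store \<sigma>3"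
      unfolding exec_le_def by blast
    have "(n + 3) * (2 * ?N + 2) \<le> (p ?N + 3) * (2 * ?N + 2)"
      using n(1) by (intro mult_right_mono) auto
    also have "\<dots> \<le> k * (?N + 1) ^ k"
      by (rule k)
    finally have "fst (tm_run M (k * (?N + 1) ^ k) w) = (if \<sigma>3 1 \<noteq> {} then 1 else 2)"
      using M(2)[OF w n(2)] by blast
    moreover have "\<sigma>3 1 = \<sigma>2 2"
      using 2(2) by (auto simp: \<sigma>3_def bits_def wf_store_def)
    ultimately show ?thesis
      using 2(3) by (simp add: L_def \<Phi>_def)
  qed
  then show ?thesis
    using M(1) by blast
qed

section \<open>Defining exhaustible residents on the encoded word\<close>

text \<open>The number of list terminators before \<open>p\<close>, hence the index of the block
  around \<open>p\<close>. The bracketing fits the counted set in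
  \<open>definable_count\<close>.\<close>

definition count3 :: "nat list \<Rightarrow> nat \<Rightarrow> nat" where
  "count3 w p = card {j. j \<le> length w \<and> (j < p \<and> sym_at w j = 3)}"

text \<open>Position \<open>p\<close> is the terminator of the unary code of \<open>v\<close>.\<close>
definition is_item :: "nat list \<Rightarrow> nat \<Rightarrow> nat \<Rightarrow> bool" where
  "is_item w v p \<longleftrightarrow> sym_at w p = 2 \<and>
     card {j. j \<le> length w \<and> (j < p \<and> (\<forall>i\<le>length w. j \<le> i \<and> i < p \<longrightarrow> sym_at w i = 1))} = v"

text \<open>The encoding starts with as many ones as there are residents.\<close>
definition is_res :: "nat list \<Rightarrow> nat \<Rightarrow> bool" where
  "is_res w b \<longleftrightarrow> (\<forall>i\<le>length w. i \<le> b \<longrightarrow> sym_at w i = 1)"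

text \<open>The two earlier items exclude the header of the encoding, which precedes the first list.\<close>
definition res_item :: "nat list \<Rightarrow> nat \<Rightarrow> nat \<Rightarrow> nat \<Rightarrow> bool" where
  "res_item w b v p \<longleftrightarrow> is_res w b \<and> is_item w v p \<and> count3 w p = b \<and>
     (\<exists>i\<le>length w. \<exists>j\<le>length w. i < j \<and> j < p \<and> sym_at w i = 2 \<and> sym_at w j = 2)"

definition in_res_part :: "nat list \<Rightarrow> nat \<Rightarrow> bool" where
  "in_res_part w p \<longleftrightarrow> (\<exists>b\<le>length w. is_res w b \<and> count3 w p = b)"

text \<open>The earlier item in the same block excludes the quota.\<close>
definition hos_item :: "nat list \<Rightarrow> nat \<Rightarrow> nat \<Rightarrow> nat \<Rightarrow> bool" where
  "hos_item w g v p \<longleftrightarrow> is_item w v p \<and> \<not> in_res_part w p \<and>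
     card {j. j \<le> length w \<and> (j < p \<and> sym_at w j = 3 \<and> \<not> in_res_part w j)} = g \<and>
     (\<exists>i\<le>length w. i < p \<and> sym_at w i = 2 \<and> \<not> (\<exists>j\<le>length w. i < j \<and> j < p \<and> sym_at w j = 3))"

definition last_item :: "nat list \<Rightarrow> nat \<Rightarrow> nat \<Rightarrow> bool" where
  "last_item w z g \<longleftrightarrow> (\<exists>p\<le>length w. res_item w z g p \<and>
     \<not> (\<exists>q\<le>length w. \<exists>v\<le>length w. p < q \<and> res_item w z v q))"

text \<open>The counterpart of \<open>can_beat\<close> on the word, with ranks for residents and
  positions for the order of the list.\<close>

definition beats :: "nat list \<Rightarrow> nat \<Rightarrow> nat \<Rightarrow> nat \<Rightarrow> bool" where
  "beats w g y z \<longleftrightarrow> \<not> y = z \<and> (\<not> (\<exists>q\<le>length w. hos_item w g z q) \<or>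
     (\<exists>q\<le>length w. hos_item w g y q \<and> \<not> (\<exists>p\<le>length w. p \<le> q \<and> hos_item w g z p)))"

text \<open>One application of the rules of \<open>exhausts\<close>, with ranks for
  residents.\<close>

definition exhaust_step :: "nat list \<Rightarrow> nat set \<Rightarrow> nat \<Rightarrow> bool" where
  "exhaust_step w X z \<longleftrightarrow> is_res w z \<and>
     (\<not> (\<exists>p\<le>length w. \<exists>v\<le>length w. res_item w z v p) \<or>
      (\<exists>g\<le>length w. \<exists>y\<le>length w. last_item w z g \<and> is_res w y \<and> beats w g y z \<and>
         ((\<exists>p\<le>length w. res_item w y g p) \<or> y \<in> X)))"

text \<open>The queried resident is the second to last number; only the query follows the last list.\<close>
definition query_safe :: "nat list \<Rightarrow> nat set \<Rightarrow> bool" where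
  "query_safe w X \<longleftrightarrow> \<not> (\<exists>v\<le>length w. v \<in> X \<and> (\<exists>p\<le>length w. is_item w v p \<and>
     \<not> (\<exists>j\<le>length w. p < j \<and> sym_at w j = 3) \<and> (\<exists>j\<le>length w. p < j \<and> sym_at w j = 2)))"

lemma definable_exhaust_step: "definable (\<lambda>w X e. exhaust_step w X (e 0))"
  unfolding exhaust_step_def beats_def last_item_def hos_item_def in_res_part_def res_item_def is_res_def is_item_def count3_def
  by (intro definable_intros)

lemma definable_query_safe: "definable (\<lambda>w X e. query_safe w X)"
  unfolding query_safe_def is_item_def by (intro definable_intros)

lemma exhaust_step_mono: "X \<subseteq> Y \<Longrightarrow> exhaust_step w X z \<Longrightarrow> exhaust_step w Y z"
  unfolding exhaust_step_def by blast

section \<open>Words made of blocks of unary numbers\<close>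

definition nums :: "nat list \<Rightarrow> nat list" where
  "nums xs = concat (map enc_num xs)"

definition blocks :: "nat list list \<Rightarrow> nat list" where
  "blocks Bs = concat (map (\<lambda>xs. nums xs @ [3]) Bs)"

lemma nums_simps [simp]: "nums [] = []" "nums (x # xs) = replicate x 1 @ [2] @ nums xs" "nums (xs @ ys) = nums xs @ nums ys"
  by (auto simp: nums_def enc_num_def)

lemma blocks_simps [simp]: "blocks [] = []" "blocks (xs # Bs) = nums xs @ [3] @ blocks Bs" "blocks (As @ Bs) = blocks As @ blocks Bs"
  by (auto simp: blocks_def)

lemma set_nums: "set (nums xs) \<subseteq> {1, 2}"
  by (induction xs) auto

lemma set_blocks: "set (blocks Bs) \<subseteq> {1, 2, 3}"
proof (induction Bs)
  case (Cons xs Bs)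
  then show ?case using set_nums[of xs] by auto
qed simp

lemma filter3_nums [simp]: "filter (\<lambda>x. x = 3) (nums xs) = []"
  using set_nums[of xs] by (auto simp: filter_empty_conv)

lemma filter3_blocks [simp]: "length (filter (\<lambda>x. x = 3) (blocks Bs)) = length Bs"
  by (induction Bs) auto

lemma nums_two:
  "p < length (nums xs) \<Longrightarrow> nums xs ! p = 2 \<Longrightarrow> \<exists>i<length xs. p = length (nums (take i xs)) + xs ! i"
proof (induction xs arbitrary: p)
  case (Cons x xs)
  consider "p < x" | "p = x" | "x < p" by linarith
  then show ?case
  proof cases
    case 1
    then show ?thesis using Cons.prems by (simp add: nth_append)
  next
    case 2
    then show ?thesis by (intro exI[of _ 0]) simp
  next
    case 3
    then have "p - Suc x < length (nums xs)"
      using Cons.prems(1) by auto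
    then obtain i where "i < length xs" "p - Suc x = length (nums (take i xs)) + xs ! i"
      using 3 Cons.IH[of "p - Suc x"] Cons.prems by (auto simp: nth_append nth_Cons' split: if_splits)
    then show ?thesis
      using 3 by (intro exI[of _ "Suc i"]) simp
  qed
qed simp

lemma last_nums: "xs \<noteq> [] \<Longrightarrow> last (nums xs) = 2"
  by (cases xs rule: rev_cases) auto

lemma last_blocks: "Bs \<noteq> [] \<Longrightarrow> last (blocks Bs) = 3"
  by (cases Bs rule: rev_cases) auto

text \<open>The numbers \<open>ys\<close> after the last terminator count as one more block, with
  index \<open>length Bs\<close>, so the query is addressed like a list.\<close>

definition block_of :: "nat list list \<Rightarrow> nat list \<Rightarrow> nat \<Rightarrow> nat list" where
  "block_of Bs ys b = (Bs @ [ys]) ! b"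

text \<open>The position of the 2 that ends the code of item \<open>i\<close> in block
  \<open>b\<close>.\<close>

definition pos_of :: "nat list list \<Rightarrow> nat list \<Rightarrow> nat \<Rightarrow> nat \<Rightarrow> nat" where
  "pos_of Bs ys b i = length (blocks (take b Bs)) + length (nums (take i (block_of Bs ys b))) + block_of Bs ys b ! i"

context
  fixes Bs :: "nat list list" and ys :: "nat list" and w :: "nat list"
  assumes w: "w = blocks Bs @ nums ys"
begin

abbreviation block :: "nat \<Rightarrow> nat list" where "block \<equiv> block_of Bs ys"
abbreviation pos :: "nat \<Rightarrow> nat \<Rightarrow> nat" where "pos \<equiv> pos_of Bs ys"

lemma word_split:
  assumes "b \<le> length Bs" "i < length (block b)"
  shows "\<exists>rest. w = (blocks (take b Bs) @ nums (take i (block b)) @ replicate (block b ! i) 1) @ 2 # rest"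
proof -
  have xs: "block b = take i (block b) @ block b ! i # drop (Suc i) (block b)"
    using assms(2) by (rule id_take_nth_drop)
  have "nums (block b) = nums (take i (block b)) @ replicate (block b ! i) 1 @ 2 # nums (drop (Suc i) (block b))"
    by (subst xs) simp
  moreover have "\<exists>rest. w = blocks (take b Bs) @ nums (block b) @ rest"
  proof (cases "b = length Bs")
    case True
    then show ?thesis by (simp add: w block_of_def)
  next
    case False
    then have "Bs = take b Bs @ block b # drop (Suc b) Bs"
      using assms(1) id_take_nth_drop[of b Bs] by (simp add: block_of_def nth_append)
    then have "blocks Bs = blocks (take b Bs) @ nums (block b) @ [3] @ blocks (drop (Suc b) Bs)"
      by (metis blocks_simps(2,3))
    then show ?thesis by (simp add: w)
  qed
  ultimately show ?thesis by auto
qed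

lemma pos_facts:
  assumes "b \<le> length Bs" "i < length (block b)"
  shows "pos b i < length w" "sym_at w (pos b i) = 2"
    "take (pos b i) w = blocks (take b Bs) @ nums (take i (block b)) @ replicate (block b ! i) 1"
proof -
  let ?u = "blocks (take b Bs) @ nums (take i (block b)) @ replicate (block b ! i) 1"
  obtain rest where r: "w = ?u @ 2 # rest"
    using word_split[OF assms] by blast
  have p: "pos b i = length ?u"
    by (simp add: pos_of_def)
  show 1: "pos b i < length w"
    unfolding p by (subst r) simp
  have "w ! pos b i = 2"
    unfolding p by (subst r) (rule nth_append_length)
  then show "sym_at w (pos b i) = 2"
    using 1 by (simp add: sym_at_def)
  show "take (pos b i) w = ?u"
    unfolding p by (subst r) simp
qed

lemma word_two:
  assumes "sym_at w p = 2"
  shows "\<exists>b\<le>length Bs. \<exists>i<length (block b). p = pos b i"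
proof -
  have p: "p < length w" "w ! p = 2"
    using assms by (auto simp: sym_at_def split: if_splits)
  have "\<exists>b\<le>length Cs. \<exists>i<length ((Cs @ [ys]) ! b).
      p = length (blocks (take b Cs)) + length (nums (take i ((Cs @ [ys]) ! b))) + (Cs @ [ys]) ! b ! i"
    if "p < length (blocks Cs @ nums ys)" "(blocks Cs @ nums ys) ! p = 2" for Cs p
    using that
  proof (induction Cs arbitrary: p)
    case Nil
    then show ?case using nums_two[of p ys] by auto
  next
    case (Cons xs Cs)
    show ?case
    proof (cases "p < length (nums xs)")
      case True
      then obtain i where "i < length xs" "p = length (nums (take i xs)) + xs ! i"
        using nums_two[of p xs] Cons.prems by (auto simp: nth_append)
      then show ?thesis
        by (intro exI[of _ 0]) auto
    next
      case False
      define q where "q = p - Suc (length (nums xs))"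
      have "p \<noteq> length (nums xs)"
        using Cons.prems(2) by (auto simp: nth_append)
      then have pq: "p = Suc (length (nums xs)) + q"
        using False by (auto simp: q_def)
      have "q < length (blocks Cs @ nums ys)" "(blocks Cs @ nums ys) ! q = 2"
        using Cons.prems by (auto simp: pq nth_append)
      from Cons.IH[OF this] obtain b i where "b \<le> length Cs" "i < length ((Cs @ [ys]) ! b)"
        "q = length (blocks (take b Cs)) + length (nums (take i ((Cs @ [ys]) ! b))) + (Cs @ [ys]) ! b ! i"
        by blast
      then show ?thesis
        by (intro exI[of _ "Suc b"] exI[of _ i] conjI) (auto simp: pq)
    qed
  qed
  from this[of p Bs] show ?thesis
    using p by (simp add: w pos_of_def block_of_def)
qed

lemma count3_take:
  assumes "p \<le> length w"
  shows "count3 w p = length (filter (\<lambda>x. x = 3) (take p w))"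
proof -
  have "{j. j \<le> length w \<and> (j < p \<and> sym_at w j = 3)} = {j. j < length (take p w) \<and> take p w ! j = 3}"
    using assms by (auto simp: sym_at_def)
  then show ?thesis
    by (simp add: count3_def length_filter_conv_card)
qed

lemma count3_mono: "p \<le> q \<Longrightarrow> count3 w p \<le> count3 w q"
  unfolding count3_def by (rule card_mono) auto

lemma count3_strict: "p < q \<Longrightarrow> sym_at w p = 3 \<Longrightarrow> count3 w p < count3 w q"
proof -
  assume a: "p < q" "sym_at w p = 3"
  then have "p \<le> length w"
    by (auto simp: sym_at_def split: if_splits)
  then have "insert p {j. j \<le> length w \<and> (j < p \<and> sym_at w j = 3)} \<subseteq> {j. j \<le> length w \<and> (j < q \<and> sym_at w j = 3)}"
    using a by auto
  from card_mono[OF _ this] show "count3 w p < count3 w q"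
    by (simp add: count3_def)
qed

lemma count3_pos: "b \<le> length Bs \<Longrightarrow> i < length (block b) \<Longrightarrow> count3 w (pos b i) = b"
  using pos_facts[of b i] by (simp add: count3_take)

lemma count3_between:
  assumes "p \<le> q" "\<not> (\<exists>j\<le>length w. p \<le> j \<and> j < q \<and> sym_at w j = 3)"
  shows "count3 w p = count3 w q"
proof -
  have "{j. j \<le> length w \<and> (j < p \<and> sym_at w j = 3)} = {j. j \<le> length w \<and> (j < q \<and> sym_at w j = 3)}"
    using assms by (auto simp: not_le[symmetric])
  then show ?thesis
    by (simp add: count3_def)
qed

lemma pos_less_block:
  assumes "b \<le> length Bs" "i < length (block b)" "c \<le> length Bs" "j < length (block c)" "b < c"
  shows "pos b i < pos c j"
  using count3_mono[of "pos c j" "pos b i"] assms by (force simp: count3_pos not_less)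

lemma pos_less_item:
  assumes "i < j" "j < length (block b)"
  shows "pos b i < pos b j"
proof -
  have "take j (block b) = take i (block b) @ block b ! i # drop (Suc i) (take j (block b))"
    using assms id_take_nth_drop[of i "take j (block b)"] by simp
  then have "nums (take j (block b)) = nums (take i (block b)) @ replicate (block b ! i) 1 @ 2 # nums (drop (Suc i) (take j (block b)))"
    by (metis append_Cons append_Nil nums_simps(2,3))
  then show ?thesis
    by (simp add: pos_of_def)
qed

lemma pos_less_iff:
  assumes "i < length (block b)" "j < length (block b)"
  shows "pos b i < pos b j \<longleftrightarrow> i < j"
  using pos_less_item[of i j b] pos_less_item[of j i b] assms by (metis less_asym less_irrefl nat_neq_iff)

text \<open>As \<open>u\<close> does not end in a one, the counted set is the maximal run of ones
  that ends just before \<open>p\<close>.\<close>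

lemma run_length:
  assumes p: "p < length w" and u: "take p w = u @ replicate v 1" and last: "u = [] \<or> last u \<noteq> 1"
  shows "card {j. j \<le> length w \<and> (j < p \<and> (\<forall>i\<le>length w. j \<le> i \<and> i < p \<longrightarrow> sym_at w i = 1))} = v"
proof -
  have len: "p = length u + v"
    using arg_cong[OF u, of length] p by simp
  have nth: "sym_at w i = (u @ replicate v 1) ! i" if "i < p" for i
    using u that p by (metis less_trans nth_take sym_at_def)
  have "{j. j \<le> length w \<and> (j < p \<and> (\<forall>i\<le>length w. j \<le> i \<and> i < p \<longrightarrow> sym_at w i = 1))} = {length u..<p}"
  proof (intro set_eqI iffI)
    fix j assume j: "j \<in> {j. j \<le> length w \<and> (j < p \<and> (\<forall>i\<le>length w. j \<le> i \<and> i < p \<longrightarrow> sym_at w i = 1))}"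
    show "j \<in> {length u..<p}"
    proof (rule ccontr)
      assume "j \<notin> {length u..<p}"
      then have jl: "j < length u"
        using j by auto
      then have "length u - 1 \<le> length w \<and> j \<le> length u - 1 \<and> length u - 1 < p"
        using p len by auto
      then have "sym_at w (length u - 1) = 1"
        using j by blast
      moreover have "sym_at w (length u - 1) = last u"
        using jl len nth[of "length u - 1"] last_conv_nth[of u] by (cases "u = []") (auto simp: nth_append)
      ultimately show False
        using last jl by auto
    qed
  next
    fix j assume "j \<in> {length u..<p}"
    then show "j \<in> {j. j \<le> length w \<and> (j < p \<and> (\<forall>i\<le>length w. j \<le> i \<and> i < p \<longrightarrow> sym_at w i = 1))}"
      using p nth len by (auto simp: nth_append)
  qed
  then show ?thesis
    using len by simp
qed

lemma is_item_pos:
  assumes "b \<le> length Bs" "i < length (block b)"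
  shows "is_item w v (pos b i) \<longleftrightarrow> v = block b ! i"
proof -
  let ?u = "blocks (take b Bs) @ nums (take i (block b))"
  have "?u = [] \<or> last ?u \<noteq> 1"
    using last_blocks[of "take b Bs"] last_nums[of "take i (block b)"]
    by (cases "take i (block b) = []"; cases "take b Bs = []") (auto simp: last_append)
  from run_length[OF pos_facts(1)[OF assms] _ this] show ?thesis
    using pos_facts[OF assms] unfolding is_item_def by auto
qed

lemma is_item_iff:
  "is_item w v p \<longleftrightarrow> (\<exists>b\<le>length Bs. \<exists>i<length (block b). p = pos b i \<and> v = block b ! i)"
proof
  assume i: "is_item w v p"
  then obtain b i where bi: "b \<le> length Bs" "i < length (block b)" "p = pos b i"
    using word_two unfolding is_item_def by blast
  then show "\<exists>b\<le>length Bs. \<exists>i<length (block b). p = pos b i \<and> v = block b ! i"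
    using i is_item_pos by blast
qed (use is_item_pos in blast)

lemma item_le:
  assumes "b \<le> length Bs" "i < length (block b)"
  shows "pos b i \<le> length w" "block b ! i \<le> length w"
  using pos_facts(1)[OF assms] by (auto simp: pos_of_def)


text \<open>Block 0 has at least two items, so every later block has them in front; within block 0
  exactly the first two items fail. These will be the header numbers.\<close>

lemma earlier_two_iff:
  assumes "2 \<le> length (block 0)" "b \<le> length Bs" "i < length (block b)"
  shows "(\<exists>k\<le>length w. \<exists>j\<le>length w. k < j \<and> j < pos b i \<and> sym_at w k = 2 \<and> sym_at w j = 2) \<longleftrightarrow> b = 0 \<longrightarrow> 2 \<le> i"
proof
  assume "\<exists>k\<le>length w. \<exists>j\<le>length w. k < j \<and> j < pos b i \<and> sym_at w k = 2 \<and> sym_at w j = 2"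
  then obtain k j where kj: "k < j" "j < pos b i" "sym_at w k = 2" "sym_at w j = 2"
    by blast
  obtain c l where c: "c \<le> length Bs" "l < length (block c)" "k = pos c l"
    using word_two[OF kj(3)] by blast
  obtain d m where d: "d \<le> length Bs" "m < length (block d)" "j = pos d m"
    using word_two[OF kj(4)] by blast
  show "b = 0 \<longrightarrow> 2 \<le> i"
  proof
    assume b: "b = 0"
    have "d = 0"
      using count3_mono[of j "pos b i"] kj(2) b assms d by (simp add: count3_pos)
    moreover have "c = 0"
      using count3_mono[of k "pos b i"] kj(1,2) b assms c by (simp add: count3_pos)
    ultimately have "l < m" "m < i"
      using kj(1,2) c d b assms pos_less_iff[of l 0 m] pos_less_iff[of m 0 i] by auto
    then show "2 \<le> i" by simp
  qed
next
  assume bi: "b = 0 \<longrightarrow> 2 \<le> i"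
  have 01: "pos 0 0 < pos 0 1"
    using assms by (intro pos_less_item) auto
  have 1: "pos 0 1 < pos b i"
  proof (cases "b = 0")
    case True
    then show ?thesis
      using bi assms pos_less_item[of 1 i 0] by auto
  next
    case False
    then show ?thesis
      using assms by (intro pos_less_block) auto
  qed
  have "sym_at w (pos 0 0) = 2" "sym_at w (pos 0 1) = 2"
    using assms by (auto intro!: pos_facts(2))
  moreover have "pos b i \<le> length w"
    using item_le assms by blast
  ultimately show "\<exists>k\<le>length w. \<exists>j\<le>length w. k < j \<and> j < pos b i \<and> sym_at w k = 2 \<and> sym_at w j = 2"
    using 01 1 by (intro exI[of _ "pos 0 0"] exI[of _ "pos 0 1"] conjI) auto
qed

text \<open>Two item ends with no terminator in between have equal \<open>count3\<close> and so
  share a block.\<close>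

lemma earlier_same_block_iff:
  assumes "b \<le> length Bs" "i < length (block b)"
  shows "(\<exists>k\<le>length w. k < pos b i \<and> sym_at w k = 2 \<and> \<not> (\<exists>j\<le>length w. k < j \<and> j < pos b i \<and> sym_at w j = 3)) \<longleftrightarrow> 0 < i"
proof
  assume "\<exists>k\<le>length w. k < pos b i \<and> sym_at w k = 2 \<and> \<not> (\<exists>j\<le>length w. k < j \<and> j < pos b i \<and> sym_at w j = 3)"
  then obtain k where k: "k < pos b i" "sym_at w k = 2" "\<not> (\<exists>j\<le>length w. k < j \<and> j < pos b i \<and> sym_at w j = 3)"
    by blast
  then have "count3 w k = count3 w (pos b i)"
    by (intro count3_between) (auto simp: le_less)
  moreover obtain c l where c: "c \<le> length Bs" "l < length (block c)" "k = pos c l"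
    using word_two[OF k(2)] by blast
  ultimately have "c = b"
    using assms by (simp add: count3_pos)
  then show "0 < i"
    using k(1) c assms pos_less_iff[of l b i] by auto
next
  assume i: "0 < i"
  then have 0: "0 < length (block b)"
    using assms by auto
  have "\<not> (\<exists>j\<le>length w. pos b 0 < j \<and> j < pos b i \<and> sym_at w j = 3)"
  proof
    assume "\<exists>j\<le>length w. pos b 0 < j \<and> j < pos b i \<and> sym_at w j = 3"
    then obtain j where "pos b 0 < j" "j < pos b i" "sym_at w j = 3" by blast
    then have "count3 w (pos b 0) < count3 w (pos b i)"
      using count3_strict[of j "pos b i"] count3_mono[of "pos b 0" j] by simp
    then show False
      using assms 0 by (simp add: count3_pos)
  qed
  moreover have "pos b 0 < pos b i"
    using i assms by (intro pos_less_item)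
  moreover have "sym_at w (pos b 0) = 2" "pos b 0 \<le> length w"
    using assms(1) 0 pos_facts(2) item_le by auto
  ultimately show "\<exists>k\<le>length w. k < pos b i \<and> sym_at w k = 2 \<and> \<not> (\<exists>j\<le>length w. k < j \<and> j < pos b i \<and> sym_at w j = 3)"
    by blast
qed

text \<open>\<open>count3\<close> numbers the terminators before \<open>p\<close> bijectively by an
  initial segment, so discarding those numbered below \<open>m\<close> subtracts \<open>m\<close>.
  This is how a formula obtains the index of a hospital.\<close>

lemma count3_from:
  "card {j. j \<le> length w \<and> (j < p \<and> sym_at w j = 3 \<and> \<not> count3 w j < m)} = count3 w p - m"
proof -
  define A where "A = {j. j \<le> length w \<and> (j < p \<and> sym_at w j = 3)}"
  have inj: "inj_on (count3 w) A"
    by (rule linorder_inj_onI) (auto simp: A_def dest: count3_strict)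
  have "count3 w ` A \<subseteq> {..<count3 w p}"
    using count3_strict by (auto simp: A_def)
  moreover have "card (count3 w ` A) = count3 w p"
    using card_image[OF inj] by (simp add: A_def count3_def)
  ultimately have img: "count3 w ` A = {..<count3 w p}"
    by (intro card_subset_eq) auto
  have "count3 w ` {j\<in>A. \<not> count3 w j < m} = {m..<count3 w p}"
  proof -
    have "count3 w ` {j\<in>A. \<not> count3 w j < m} = {n\<in>count3 w ` A. \<not> n < m}"
      by auto
    then show ?thesis
      unfolding img by auto
  qed
  moreover have "inj_on (count3 w) {j\<in>A. \<not> count3 w j < m}"
    using inj by (rule inj_on_subset) auto
  ultimately have "card {j\<in>A. \<not> count3 w j < m} = count3 w p - m"
    using card_image by fastforce
  moreover have "{j\<in>A. \<not> count3 w j < m} = {j. j \<le> length w \<and> (j < p \<and> sym_at w j = 3 \<and> \<not> count3 w j < m)}"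
    by (auto simp: A_def)
  ultimately show ?thesis by simp
qed

lemma count3_end: "count3 w (length w) = length Bs"
  by (simp add: count3_take) (simp add: w)

text \<open>An item followed by no terminator lies in the last block, and of its two items only the
  first has a later 2.\<close>

lemma query_safe_iff:
  assumes "length ys = 2"
  shows "query_safe w X \<longleftrightarrow> ys ! 0 \<notin> X"
proof -
  let ?n = "length Bs"
  have blk: "block ?n = ys"
    by (simp add: block_of_def)
  have item: "(is_item w v p \<and> \<not> (\<exists>j\<le>length w. p < j \<and> sym_at w j = 3) \<and> (\<exists>j\<le>length w. p < j \<and> sym_at w j = 2))
      \<longleftrightarrow> p = pos ?n 0 \<and> v = ys ! 0" for v p
  proof
    assume a: "is_item w v p \<and> \<not> (\<exists>j\<le>length w. p < j \<and> sym_at w j = 3) \<and> (\<exists>j\<le>length w. p < j \<and> sym_at w j = 2)"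
    then obtain b i where b: "b \<le> ?n" "i < length (block b)" "p = pos b i" "v = block b ! i"
      by (auto simp: is_item_iff)
    obtain q where q: "p < q" "sym_at w q = 2"
      using a by blast
    obtain c j where c: "c \<le> ?n" "j < length (block c)" "q = pos c j"
      using word_two[OF q(2)] by blast
    have "sym_at w p = 2"
      using a by (simp add: is_item_def)
    then have "\<not> (\<exists>j\<le>length w. p \<le> j \<and> j < length w \<and> sym_at w j = 3)"
      using a by (auto simp: le_less)
    then have "count3 w p = count3 w (length w)"
      using b item_le by (intro count3_between) auto
    then have bn: "b = ?n"
      using b by (simp add: count3_pos count3_end)
    have "count3 w p \<le> count3 w q"
      using q(1) by (intro count3_mono) simp
    then have "c = ?n"
      using b c bn by (simp add: count3_pos)
    then have "i < j"
      using q b c bn pos_less_iff[of i ?n j] by simp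
    then have "i = 0"
      using c \<open>c = ?n\<close> assms by (simp add: blk)
    then show "p = pos ?n 0 \<and> v = ys ! 0"
      using b bn by (simp add: blk)
  next
    assume pv: "p = pos ?n 0 \<and> v = ys ! 0"
    have "is_item w v p"
      using pv assms by (auto simp: is_item_pos blk)
    moreover have "\<not> (\<exists>j\<le>length w. p < j \<and> sym_at w j = 3)"
    proof
      assume "\<exists>j\<le>length w. p < j \<and> sym_at w j = 3"
      then obtain j where j: "j \<le> length w" "p < j" "sym_at w j = 3" by blast
      then have "j < length w"
        by (auto simp: sym_at_def split: if_splits)
      then have "count3 w j < ?n"
        using count3_strict[OF _ j(3)] count3_end by metis
      moreover have "count3 w p \<le> count3 w j"
        using j by (intro count3_mono) simp
      ultimately show False
        using pv assms by (simp add: count3_pos blk)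
    qed
    moreover have "p < pos ?n 1" "sym_at w (pos ?n 1) = 2" "pos ?n 1 \<le> length w"
      using pv assms by (auto simp: blk intro!: pos_less_item pos_facts(2) item_le)
    ultimately show "is_item w v p \<and> \<not> (\<exists>j\<le>length w. p < j \<and> sym_at w j = 3) \<and> (\<exists>j\<le>length w. p < j \<and> sym_at w j = 2)"
      by blast
  qed
  have "pos ?n 0 \<le> length w" "ys ! 0 \<le> length w"
    using item_le[of ?n 0] assms by (auto simp: blk)
  then show ?thesis
    unfolding query_safe_def item by auto
qed

end

section \<open>Positions in lists and ranks in finite sets\<close>

lemma in_takeWhile_iff:
  "y \<in> set (takeWhile (\<lambda>x. x \<noteq> z) L) \<longleftrightarrow> (\<exists>i<length L. L ! i = y \<and> (\<forall>j\<le>i. L ! j \<noteq> z))"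
proof
  assume "y \<in> set (takeWhile (\<lambda>x. x \<noteq> z) L)"
  then obtain i where i: "i < length (takeWhile (\<lambda>x. x \<noteq> z) L)" "takeWhile (\<lambda>x. x \<noteq> z) L ! i = y"
    by (auto simp: in_set_conv_nth)
  have "L ! j \<noteq> z" if "j \<le> i" for j
    using i(1) that nth_mem[of j "takeWhile (\<lambda>x. x \<noteq> z) L"] takeWhile_nth[of j "\<lambda>x. x \<noteq> z" L]
    by (auto dest: set_takeWhileD)
  then show "\<exists>i<length L. L ! i = y \<and> (\<forall>j\<le>i. L ! j \<noteq> z)"
    using i length_takeWhile_le[of "\<lambda>x. x \<noteq> z" L] takeWhile_nth[OF i(1)] by (intro exI[of _ i]) auto
next
  assume "\<exists>i<length L. L ! i = y \<and> (\<forall>j\<le>i. L ! j \<noteq> z)"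
  then obtain i where i: "i < length L" "L ! i = y" "\<forall>j\<le>i. L ! j \<noteq> z" by blast
  have "i < length (takeWhile (\<lambda>x. x \<noteq> z) L)"
    using i nth_length_takeWhile[of "\<lambda>x. x \<noteq> z" L] by (meson le_less_trans not_le)
  then show "y \<in> set (takeWhile (\<lambda>x. x \<noteq> z) L)"
    using i(2) takeWhile_nth nth_mem by metis
qed

lemma rank_nth:
  assumes "finite A" "i < card A"
  shows "rank A (sorted_list_of_set A ! i) = i"
proof -
  let ?xs = "sorted_list_of_set A"
  have s: "sorted_wrt (<) ?xs" "length ?xs = card A"
    by auto
  have lt: "?xs ! j < ?xs ! i \<longleftrightarrow> j < i" if "j < card A" for j
    using sorted_wrt_nth_less[OF s(1), of j i] sorted_wrt_nth_less[OF s(1), of i j] that assms(2) s(2)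
    by (metis less_asym less_irrefl nat_neq_iff)
  have "{y\<in>A. y < ?xs ! i} = (\<lambda>j. ?xs ! j) ` {..<i}"
  proof (intro set_eqI iffI)
    fix y assume y: "y \<in> {y\<in>A. y < ?xs ! i}"
    then have "y \<in> set ?xs"
      using assms(1) by simp
    then obtain j where "j < card A" "y = ?xs ! j"
      by (metis in_set_conv_nth s(2))
    then show "y \<in> (\<lambda>j. ?xs ! j) ` {..<i}"
      using y lt by auto
  next
    fix y assume "y \<in> (\<lambda>j. ?xs ! j) ` {..<i}"
    then obtain j where j: "j < i" "y = ?xs ! j" by auto
    then have "y \<in> set ?xs"
      using assms(2) s(2) by auto
    then show "y \<in> {y\<in>A. y < ?xs ! i}"
      using j lt assms by auto
  qed
  moreover have "inj_on (\<lambda>j. ?xs ! j) {..<i}"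
    using assms(2) s(2) by (intro inj_on_nth) auto
  ultimately show ?thesis
    by (simp add: rank_def card_image)
qed

lemma rank_in:
  assumes "finite A" "x \<in> A"
  shows "rank A x < card A" "sorted_list_of_set A ! rank A x = x"
proof -
  have "x \<in> set (sorted_list_of_set A)"
    using assms by simp
  then obtain i where i: "i < card A" "x = sorted_list_of_set A ! i"
    by (metis in_set_conv_nth sorted_list_of_set.length_sorted_key_list_of_set)
  then show "rank A x < card A" "sorted_list_of_set A ! rank A x = x"
    using rank_nth[OF assms(1)] by auto
qed

section \<open>The encoded instance\<close>

context
  fixes I :: "(nat, nat) inst" and r h :: nat
  assumes input: "ftm_rm_input I r h"
begin

abbreviation nR :: nat where "nR \<equiv> card (Res I)"
abbreviation nH :: nat where "nH \<equiv> card (Hos I)"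
abbreviation res_at :: "nat \<Rightarrow> nat" where "res_at z \<equiv> sorted_list_of_set (Res I) ! z"
abbreviation hos_at :: "nat \<Rightarrow> nat" where "hos_at g \<equiv> sorted_list_of_set (Hos I) ! g"

definition rl :: "nat \<Rightarrow> nat list" where
  "rl z = map (rank (Hos I)) (rlist I (res_at z))"

definition hl :: "nat \<Rightarrow> nat list" where
  "hl g = map (rank (Res I)) (hlist I (hos_at g))"

text \<open>No terminator follows the two header numbers, so they become the first two items of the
  first resident's block. Each quota is the first item of its hospital's block.\<close>

definition input_blocks :: "nat list list" where
  "input_blocks = map (\<lambda>z. (if z = 0 then [nR, nH] else []) @ rl z) [0..<nR]
     @ map (\<lambda>g. quota I (hos_at g) # hl g) [0..<nH]"

definition query :: "nat list" where
  "query = [rank (Res I) r, rank (Hos I) h]"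

lemma fin: "finite (Res I)" "finite (Hos I)"
  using input_valid[OF input] by (auto simp: valid_inst_def)

lemma nR_pos: "0 < nR"
  using input_tent(1)[OF input] fin by (auto simp: card_gt_0_iff)

lemma res_at_in: "z < nR \<Longrightarrow> res_at z \<in> Res I"
  using fin by (metis nth_mem set_sorted_list_of_set sorted_list_of_set.length_sorted_key_list_of_set)

lemma hos_at_in: "g < nH \<Longrightarrow> hos_at g \<in> Hos I"
  using fin by (metis nth_mem set_sorted_list_of_set sorted_list_of_set.length_sorted_key_list_of_set)

lemma rlist_sub: "x \<in> Res I \<Longrightarrow> set (rlist I x) \<subseteq> Hos I"
  using input_valid[OF input] by (auto simp: valid_inst_def)

lemma hlist_sub: "x \<in> Hos I \<Longrightarrow> set (hlist I x) \<subseteq> Res I"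
  using input_valid[OF input] by (auto simp: valid_inst_def)

lemma encode_blocks: "encode I r h = blocks input_blocks @ nums query"
proof -
  have el: "enc_list A xs = nums (map (rank A) xs) @ [3]" for A xs
    by (simp add: enc_list_def nums_def comp_def)
  have conc: "concat (map f xs) = concat (map (\<lambda>i. f (xs ! i)) [0..<length xs])" for f :: "nat \<Rightarrow> nat list" and xs
    by (rule arg_cong[where f = concat], rule nth_equalityI) auto
  have res: "concat (map (\<lambda>x. enc_list (Hos I) (rlist I x)) (sorted_list_of_set (Res I)))
      = concat (map (\<lambda>z. nums (rl z) @ [3]) [0..<nR])"
    by (subst conc) (simp add: el rl_def)
  have hos: "concat (map (\<lambda>y. enc_num (quota I y) @ enc_list (Res I) (hlist I y)) (sorted_list_of_set (Hos I)))
      = blocks (map (\<lambda>g. quota I (hos_at g) # hl g) [0..<nH])"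
    by (subst conc) (simp add: el hl_def blocks_def comp_def enc_num_def)
  \<comment> \<open>The block that absorbs the header exists because \<open>r\<close> is a
    resident.\<close>
  have up: "[0..<nR] = 0 # [1..<nR]"
    using nR_pos by (simp add: upt_conv_Cons)
  have "blocks (map (\<lambda>z. (if z = 0 then [nR, nH] else []) @ rl z) [0..<nR])
      = enc_num nR @ enc_num nH @ concat (map (\<lambda>z. nums (rl z) @ [3]) [0..<nR])"
  proof -
    have "map (\<lambda>z. (if z = 0 then [nR, nH] else []) @ rl z) [1..<nR] = map rl [1..<nR]"
      by (rule map_cong) auto
    then have "map (\<lambda>z. (if z = 0 then [nR, nH] else []) @ rl z) [0..<nR] = ([nR, nH] @ rl 0) # map rl [1..<nR]"
      unfolding up by simp
    then show ?thesis
      unfolding up by (simp only:) (simp add: blocks_def enc_num_def comp_def)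
  qed
  then show ?thesis
    unfolding encode_def res hos by (simp add: input_blocks_def query_def enc_num_def)
qed

abbreviation (input) word :: "nat list" where "word \<equiv> encode I r h"
abbreviation blk :: "nat \<Rightarrow> nat list" where "blk \<equiv> block_of input_blocks query"
abbreviation ps :: "nat \<Rightarrow> nat \<Rightarrow> nat" where "ps \<equiv> pos_of input_blocks query"

lemma length_input_blocks: "length input_blocks = nR + nH"
  by (simp add: input_blocks_def)

lemma blk_res: "z < nR \<Longrightarrow> blk z = (if z = 0 then [nR, nH] else []) @ rl z"
  by (simp add: block_of_def input_blocks_def nth_append)

lemma blk_hos: "g < nH \<Longrightarrow> blk (nR + g) = quota I (hos_at g) # hl g"
  by (simp add: block_of_def input_blocks_def nth_append)

lemmas item_iff = is_item_iff[OF encode_blocks, unfolded length_input_blocks]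
lemmas ps_le = item_le[OF encode_blocks, unfolded length_input_blocks]
lemmas ps_count3 = count3_pos[OF encode_blocks, unfolded length_input_blocks]

text \<open>The first number of the word is \<open>nR\<close>, so the word begins with
  \<open>nR\<close> ones and a 2.\<close>

lemma is_res_iff: "is_res word b \<longleftrightarrow> b < nR"
proof -
  have b0: "0 < length (blk 0)" "blk 0 ! 0 = nR"
    using nR_pos by (auto simp: blk_res)
  have p0: "ps 0 0 = nR"
    using b0 by (simp add: pos_of_def)
  have two: "sym_at word nR = 2" "nR < length word" "take nR word = replicate nR 1"
    using pos_facts[OF encode_blocks, of 0 0] b0 by (auto simp: p0)
  have one: "sym_at word i = 1" if "i < nR" for i
    using that two(2,3) by (metis less_trans nth_replicate nth_take sym_at_def)
  show ?thesis
    using one two(1,2) unfolding is_res_def by (metis le_less_trans less_imp_le not_less numeral_eq_one_iff semiring_norm(85))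
qed

lemma nR_le: "nR \<le> length word"
  using ps_le(2)[of 0 0] nR_pos by (auto simp: blk_res)

lemma in_res_part_iff: "in_res_part word p \<longleftrightarrow> count3 word p < nR"
  unfolding in_res_part_def is_res_iff using nR_le by auto

lemma res_item_iff:
  "res_item word b v p \<longleftrightarrow> b < nR \<and> (\<exists>i<length (rl b). v = rl b ! i \<and> p = ps b ((if b = 0 then 2 else 0) + i))"
proof -
  \<comment> \<open>The offset skips the header in block 0.\<close>
  let ?o = "if b = 0 then 2 else 0 :: nat"
  have b0: "2 \<le> length (blk 0)"
    using nR_pos by (simp add: blk_res)
  show ?thesis
  proof
    assume a: "res_item word b v p"
    then have b: "b < nR"
      by (simp add: res_item_def is_res_iff)
    obtain c i where c: "c \<le> nR + nH" "i < length (blk c)" "p = ps c i" "v = blk c ! i"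
      using a by (auto simp: res_item_def item_iff)
    have "c = b"
      using a c by (simp add: res_item_def ps_count3)
    moreover have "c = 0 \<longrightarrow> 2 \<le> i"
      using a c earlier_two_iff[OF encode_blocks b0, of c i] by (simp add: res_item_def length_input_blocks)
    ultimately show "b < nR \<and> (\<exists>i<length (rl b). v = rl b ! i \<and> p = ps b (?o + i))"
    proof -
      assume *: "c = b" "c = 0 \<longrightarrow> 2 \<le> i"
      obtain k where k: "i = ?o + k"
      proof -
        have "?o \<le> i"
          using * by simp
        then show ?thesis
          using that le_Suc_ex by blast
      qed
      show ?thesis
        using b c(2-) unfolding *(1) k by (auto simp: blk_res nth_append intro!: exI[of _ k] split: if_splits)
    qed
  next
    assume "b < nR \<and> (\<exists>i<length (rl b). v = rl b ! i \<and> p = ps b (?o + i))"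
    then obtain i where b: "b < nR" and i: "i < length (rl b)" "v = rl b ! i" "p = ps b (?o + i)"
      by blast
    have bi: "b \<le> nR + nH" "?o + i < length (blk b)" "blk b ! (?o + i) = v"
      using b i by (auto simp: blk_res nth_append)
    have "is_item word v p"
      unfolding item_iff using bi i by blast
    moreover have "count3 word p = b"
      using bi i by (simp add: ps_count3)
    moreover have "\<exists>k\<le>length word. \<exists>j\<le>length word. k < j \<and> j < p \<and> sym_at word k = 2 \<and> sym_at word j = 2"
      unfolding i(3) using bi by (subst earlier_two_iff[OF encode_blocks b0]) (simp_all add: length_input_blocks)
    ultimately show "res_item word b v p"
      using b unfolding res_item_def is_res_iff by blast
  qed
qed

text \<open>Hospital blocks start at index \<open>nR\<close>, and \<open>Suc i\<close> skips the
  quota.\<close>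

lemma hos_item_iff:
  assumes g: "g < nH"
  shows "hos_item word g v p \<longleftrightarrow> (\<exists>i<length (hl g). v = hl g ! i \<and> p = ps (nR + g) (Suc i))"
proof -
  have card: "card {j. j \<le> length word \<and> (j < p \<and> sym_at word j = 3 \<and> \<not> in_res_part word j)} = count3 word p - nR"
    unfolding in_res_part_iff by (rule count3_from[OF encode_blocks])
  show ?thesis
  proof
    assume a: "hos_item word g v p"
    then obtain c i where c: "c \<le> nR + nH" "i < length (blk c)" "p = ps c i" "v = blk c ! i"
      by (auto simp: hos_item_def item_iff)
    have "c - nR = g" "\<not> c < nR"
      using a c unfolding hos_item_def card unfolding in_res_part_iff by (simp_all add: ps_count3)
    then have "c = nR + g"
      by simp
    moreover have "0 < i"
      using a c earlier_same_block_iff[OF encode_blocks, of c i] by (simp add: hos_item_def length_input_blocks)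
    ultimately show "\<exists>i<length (hl g). v = hl g ! i \<and> p = ps (nR + g) (Suc i)"
      using c g by (intro exI[of _ "i - 1"]) (auto simp: blk_hos)
  next
    assume "\<exists>i<length (hl g). v = hl g ! i \<and> p = ps (nR + g) (Suc i)"
    then obtain i where i: "i < length (hl g)" "v = hl g ! i" "p = ps (nR + g) (Suc i)" by blast
    have bi: "nR + g \<le> nR + nH" "Suc i < length (blk (nR + g))" "blk (nR + g) ! Suc i = v"
      using i g by (auto simp: blk_hos)
    have "is_item word v p"
      unfolding item_iff using bi i by blast
    moreover have "count3 word p = nR + g"
      using bi i by (simp add: ps_count3)
    ultimately show "hos_item word g v p"
      using i bi earlier_same_block_iff[OF encode_blocks, of "nR + g" "Suc i"]
      unfolding hos_item_def card unfolding in_res_part_iff by (simp add: length_input_blocks)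
  qed
qed

lemma rl_bounds:
  assumes "z < nR" "i < length (rl z)"
  shows "ps z ((if z = 0 then 2 else 0) + i) \<le> length word" "rl z ! i \<le> length word"
  using assms ps_le[of z "(if z = 0 then 2 else 0) + i"] by (cases "z = 0"; auto simp: blk_res nth_append)+

lemma hl_bounds:
  assumes "g < nH" "i < length (hl g)"
  shows "ps (nR + g) (Suc i) \<le> length word"
  using assms ps_le(1)[of "nR + g" "Suc i"] by (auto simp: blk_hos)

lemma ex_res_item_iff: "(\<exists>p\<le>length word. res_item word y g p) \<longleftrightarrow> y < nR \<and> g \<in> set (rl y)"
  unfolding res_item_iff in_set_conv_nth using rl_bounds(1) by metis

lemma any_res_item_iff: "(\<exists>p\<le>length word. \<exists>v\<le>length word. res_item word z v p) \<longleftrightarrow> z < nR \<and> rl z \<noteq> []"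
proof -
  have "(\<exists>p\<le>length word. \<exists>v\<le>length word. res_item word z v p) \<longleftrightarrow> (\<exists>v\<le>length word. z < nR \<and> v \<in> set (rl z))"
    using ex_res_item_iff by blast
  also have "\<dots> \<longleftrightarrow> z < nR \<and> rl z \<noteq> []"
    using rl_bounds(2)[of z 0] by (metis length_greater_0_conv list.set_intros(1) neq_Nil_conv nth_mem empty_iff list.set(1))
  finally show ?thesis .
qed

lemma last_item_iff: "last_item word z g \<longleftrightarrow> z < nR \<and> rl z \<noteq> [] \<and> g = last (rl z)"
proof -
  let ?o = "if z = 0 then 2 else 0 :: nat"
  have less: "ps z (?o + i) < ps z (?o + j) \<longleftrightarrow> i < j" if "z < nR" "i < length (rl z)" "j < length (rl z)" for i j
    using pos_less_iff[OF encode_blocks, of "?o + i" z "?o + j"] that by (auto simp: blk_res)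
  have "last_item word z g \<longleftrightarrow> z < nR \<and> (\<exists>i<length (rl z). g = rl z ! i \<and> \<not> (\<exists>j<length (rl z). i < j))"
  proof
    assume "last_item word z g"
    then obtain p where p: "res_item word z g p"
      and no: "\<And>q v. q \<le> length word \<Longrightarrow> v \<le> length word \<Longrightarrow> res_item word z v q \<Longrightarrow> \<not> p < q"
      unfolding last_item_def by blast
    obtain i where i: "z < nR" "i < length (rl z)" "g = rl z ! i" "p = ps z (?o + i)"
      using p unfolding res_item_iff by blast
    have "\<not> i < j" if j: "j < length (rl z)" for j
    proof -
      have "res_item word z (rl z ! j) (ps z (?o + j))"
        unfolding res_item_iff using i j by blast
      then have "\<not> p < ps z (?o + j)"
        by (rule no[OF rl_bounds[OF i(1) j]])
      then show ?thesis
        unfolding i(4) using less[OF i(1,2) j] by blast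
    qed
    then show "z < nR \<and> (\<exists>i<length (rl z). g = rl z ! i \<and> \<not> (\<exists>j<length (rl z). i < j))"
      using i by blast
  next
    assume "z < nR \<and> (\<exists>i<length (rl z). g = rl z ! i \<and> \<not> (\<exists>j<length (rl z). i < j))"
    then obtain i where i: "z < nR" "i < length (rl z)" "g = rl z ! i" "\<And>j. j < length (rl z) \<Longrightarrow> \<not> i < j"
      by blast
    have "res_item word z g (ps z (?o + i))"
      unfolding res_item_iff using i by blast
    moreover have "\<not> ps z (?o + i) < q" if "res_item word z v q" for q v
      using that i(4) less[OF i(1,2)] unfolding res_item_iff by blast
    ultimately show "last_item word z g"
      unfolding last_item_def using rl_bounds(1)[OF i(1,2)] by blast
  qed
  also have "\<dots> \<longleftrightarrow> z < nR \<and> rl z \<noteq> [] \<and> g = last (rl z)"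
  proof -
    have "(\<exists>i<length L. g = L ! i \<and> \<not> (\<exists>j<length L. i < j)) \<longleftrightarrow> L \<noteq> [] \<and> g = last L" for L :: "nat list"
    proof (cases L rule: rev_cases)
      case (snoc xs x)
      have max: "i < length L \<and> \<not> (\<exists>j<length L. i < j) \<longleftrightarrow> i = length xs" for i
        unfolding snoc by (metis length_append_singleton lessI less_antisym not_less_eq)
      have "(\<exists>i<length L. g = L ! i \<and> \<not> (\<exists>j<length L. i < j)) \<longleftrightarrow> (\<exists>i. i = length xs \<and> g = L ! i)"
        unfolding max[symmetric] by blast
      then show ?thesis
        by (simp add: snoc)
    qed simp
    then show ?thesis by blast
  qed
  finally show ?thesis .
qed

lemma beats_iff:
  assumes g: "g < nH"
  shows "beats word g y z \<longleftrightarrow> y \<noteq> z \<and> (z \<notin> set (hl g) \<or> y \<in> set (takeWhile (\<lambda>x. x \<noteq> z) (hl g)))"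
proof -
  let ?p = "\<lambda>i. ps (nR + g) (Suc i)"
  have le: "?p i \<le> ?p j \<longleftrightarrow> i \<le> j" if "i < length (hl g)" "j < length (hl g)" for i j
  proof -
    have "?p j < ?p i \<longleftrightarrow> j < i"
      using pos_less_iff[OF encode_blocks, of "Suc j" "nR + g" "Suc i"] that g by (simp add: blk_hos)
    then show ?thesis
      unfolding not_less[symmetric] by simp
  qed
  have ex: "(\<exists>q\<le>length word. hos_item word g v q \<and> P q) \<longleftrightarrow> (\<exists>i<length (hl g). v = hl g ! i \<and> P (?p i))" for v P
    unfolding hos_item_iff[OF g] using hl_bounds[OF g] by blast
  have "(\<exists>p\<le>length word. p \<le> ?p i \<and> hos_item word g z p) \<longleftrightarrow> (\<exists>j\<le>i. hl g ! j = z)" if "i < length (hl g)" for i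
  proof -
    have "(\<exists>p\<le>length word. p \<le> ?p i \<and> hos_item word g z p) \<longleftrightarrow> (\<exists>j<length (hl g). z = hl g ! j \<and> ?p j \<le> ?p i)"
      using ex[of z "\<lambda>q. q \<le> ?p i"] by (simp only: conj_commute)
    also have "\<dots> \<longleftrightarrow> (\<exists>j<length (hl g). z = hl g ! j \<and> j \<le> i)"
      using le[OF _ that] by blast
    also have "\<dots> \<longleftrightarrow> (\<exists>j\<le>i. hl g ! j = z)"
    proof
      assume "\<exists>j\<le>i. hl g ! j = z"
      then obtain j where "j \<le> i" "hl g ! j = z" by blast
      then show "\<exists>j<length (hl g). z = hl g ! j \<and> j \<le> i"
        using that by (intro exI[of _ j]) auto
    qed blast
    finally show ?thesis .
  qed
  then have "(\<exists>q\<le>length word. hos_item word g y q \<and> \<not> (\<exists>p\<le>length word. p \<le> q \<and> hos_item word g z p))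
      \<longleftrightarrow> y \<in> set (takeWhile (\<lambda>x. x \<noteq> z) (hl g))"
    unfolding ex in_takeWhile_iff by metis
  moreover have "(\<exists>q\<le>length word. hos_item word g z q) \<longleftrightarrow> z \<in> set (hl g)"
    using ex[of z "\<lambda>_. True"] by (auto simp: in_set_conv_nth)
  ultimately show ?thesis
    unfolding beats_def by blast
qed

text \<open>Ranks and indices into the sorted list are mutually inverse between \<open>Res I\<close>
  and the numbers below \<open>nR\<close>, so comparisons carry over.\<close>

lemma can_beat_iff:
  assumes g: "g < nH" and y: "y < nR" and z: "z < nR"
  shows "beats word g y z \<longleftrightarrow> can_beat I (hos_at g) (res_at y) (res_at z)"
proof -
  have eq: "rank (Res I) x = z \<longleftrightarrow> x = res_at z" if "x \<in> Res I" "z < nR" for x z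
    using rank_nth[OF fin(1)] rank_in[OF fin(1)] that by metis
  have sub: "set (hlist I (hos_at g)) \<subseteq> Res I"
    using hlist_sub hos_at_in g by blast
  have mem: "v \<in> set (map (rank (Res I)) xs) \<longleftrightarrow> res_at v \<in> set xs" if "set xs \<subseteq> Res I" "v < nR" for v xs
    using eq that by (force simp: rank_nth[OF fin(1)])
  have "takeWhile (\<lambda>x. x \<noteq> z) (hl g) = map (rank (Res I)) (takeWhile (\<lambda>x. rank (Res I) x \<noteq> z) (hlist I (hos_at g)))"
    by (simp add: hl_def takeWhile_map comp_def)
  also have "takeWhile (\<lambda>x. rank (Res I) x \<noteq> z) (hlist I (hos_at g)) = takeWhile (\<lambda>x. x \<noteq> res_at z) (hlist I (hos_at g))"
    using sub eq[OF _ z] by (intro takeWhile_cong) auto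
  finally have "y \<in> set (takeWhile (\<lambda>x. x \<noteq> z) (hl g)) \<longleftrightarrow> res_at y \<in> set (takeWhile (\<lambda>x. x \<noteq> res_at z) (hlist I (hos_at g)))"
    using mem[OF _ y] sub by (metis (no_types, lifting) set_takeWhileD subset_iff)
  moreover have "z \<in> set (hl g) \<longleftrightarrow> res_at z \<in> set (hlist I (hos_at g))"
    unfolding hl_def by (rule mem[OF sub z])
  moreover have "y = z \<longleftrightarrow> res_at y = res_at z"
    using rank_nth[OF fin(1)] y z by metis
  ultimately show ?thesis
    unfolding beats_iff[OF g] can_beat_def by blast
qed

lemma rl_last:
  assumes "z < nR" "rlist I (res_at z) \<noteq> []"
  shows "last (rl z) < nH" "hos_at (last (rl z)) = last (rlist I (res_at z))"
proof -
  have "last (rlist I (res_at z)) \<in> Hos I"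
    using assms rlist_sub res_at_in last_in_set by blast
  then show "last (rl z) < nH" "hos_at (last (rl z)) = last (rlist I (res_at z))"
    using assms(2) rank_in[OF fin(2)] by (auto simp: rl_def last_map)
qed

lemma rl_mem:
  assumes "y < nR" "g < nH"
  shows "g \<in> set (rl y) \<longleftrightarrow> hos_at g \<in> set (rlist I (res_at y))"
proof
  assume "g \<in> set (rl y)"
  then obtain x where x: "x \<in> set (rlist I (res_at y))" "g = rank (Hos I) x"
    by (auto simp: rl_def)
  then have "x \<in> Hos I"
    using rlist_sub[OF res_at_in[OF assms(1)]] by blast
  then show "hos_at g \<in> set (rlist I (res_at y))"
    using x rank_in(2)[OF fin(2)] by simp
next
  assume "hos_at g \<in> set (rlist I (res_at y))"
  then show "g \<in> set (rl y)"
    unfolding rl_def using rank_nth[OF fin(2) assms(2)] by (metis imageI list.set_map)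
qed

lemma exhaust_step_iff:
  "exhaust_step word X z \<longleftrightarrow> z < nR \<and> (rlist I (res_at z) = [] \<or>
     (\<exists>y<nR. can_beat I (last (rlist I (res_at z))) (res_at y) (res_at z) \<and>
        (last (rlist I (res_at z)) \<in> set (rlist I (res_at y)) \<or> y \<in> X)))"
proof (cases "z < nR \<and> rlist I (res_at z) \<noteq> []")
  case True
  let ?g = "last (rl z)"
  have z: "z < nR" "rl z \<noteq> []"
    using True by (auto simp: rl_def)
  have g: "?g < nH" "hos_at ?g = last (rlist I (res_at z))"
    using rl_last True by auto
  have gle: "?g \<le> length word"
    using rl_bounds(2)[OF z(1), of "length (rl z) - 1"] z(2) by (simp add: last_conv_nth)
  have y_le: "y \<le> length word" if "y < nR" for y
    using that nR_le by simp
  have "exhaust_step word X z \<longleftrightarrow> (\<exists>y<nR. beats word ?g y z \<and> (?g \<in> set (rl y) \<or> y \<in> X))"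
    unfolding exhaust_step_def is_res_iff any_res_item_iff ex_res_item_iff last_item_iff
    using z gle y_le by blast
  then show ?thesis
    using True can_beat_iff[OF g(1) _ z(1)] rl_mem[OF _ g(1)] unfolding g(2) by blast
next
  case False
  then show ?thesis
    unfolding exhaust_step_def is_res_iff any_res_item_iff by (auto simp: rl_def)
qed

text \<open>Ranks of residents are below \<open>nR \<le> length word\<close>, so restricting the
  operator to positions cuts nothing off. One inclusion is closure of the right side, the other is
  induction on \<open>exhausts\<close>.\<close>

lemma lfp_exhaust_step:
  "lfp (\<lambda>X. {z. z \<le> length word \<and> exhaust_step word X z}) = {z. z < nR \<and> res_at z \<in> exhausts I}" (is "lfp ?\<Phi> = ?L")
proof
  have mono: "mono ?\<Phi>"
    using exhaust_step_mono unfolding mono_def by blast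
  show "lfp ?\<Phi> \<subseteq> ?L"
  proof (rule lfp_lowerbound, rule subsetI)
    fix z assume "z \<in> ?\<Phi> ?L"
    then have z: "z < nR" and *: "rlist I (res_at z) = [] \<or>
     (\<exists>y<nR. can_beat I (last (rlist I (res_at z))) (res_at y) (res_at z) \<and>
        (last (rlist I (res_at z)) \<in> set (rlist I (res_at y)) \<or> res_at y \<in> exhausts I))"
      by (auto simp: exhaust_step_iff)
    have "res_at z \<in> exhausts I"
      using * exhausts_Nil[OF res_at_in[OF z]] exhausts_step[OF res_at_in[OF z] _ res_at_in] by metis
    then show "z \<in> ?L"
      using z by simp
  qed
  have L: "z \<in> lfp ?\<Phi>" if "exhaust_step word (lfp ?\<Phi>) z" for z
  proof -
    have "z \<le> length word"
      using that nR_le by (auto simp: exhaust_step_iff)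
    then show ?thesis
      by (subst lfp_unfold[OF mono]) (simp add: that)
  qed
  have "rank (Res I) x \<in> lfp ?\<Phi>" if "x \<in> exhausts I" for x
    using that
  proof (induction rule: exhausts.induct)
    case (exhausts_Nil z)
    then show ?case
      using rank_in[OF fin(1) exhausts_Nil(1)] by (intro L) (simp add: exhaust_step_iff)
  next
    case (exhausts_step z y)
    then show ?case
      using rank_in[OF fin(1) exhausts_step(1)] rank_in[OF fin(1) exhausts_step(3)]
      by (intro L) (auto simp: exhaust_step_iff intro!: exI[of _ "rank (Res I) y"])
  qed
  then show "?L \<subseteq> lfp ?\<Phi>"
    using rank_nth[OF fin(1)] by (metis (no_types, lifting) mem_Collect_eq subsetI)
qed

lemma query_safe_finalizable:
  "query_safe word (lfp (\<lambda>X. {z. z \<le> length word \<and> exhaust_step word X z})) \<longleftrightarrow> finalizable I r h"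
proof -
  have "query_safe word X \<longleftrightarrow> rank (Res I) r \<notin> X" for X
    using query_safe_iff[OF encode_blocks, of X] by (simp add: query_def)
  then show ?thesis
    unfolding lfp_exhaust_step finalizable_iff[OF input]
    using rank_in[OF fin(1) input_tent(1)[OF input]] by simp
qed

lemma word_alphabet: "word \<noteq> []" "set word \<subseteq> {1, 2, 3}"
  using set_blocks[of input_blocks] set_nums[of query] by (auto simp: encode_blocks query_def)

end

theorem theorem4:
  shows "\<exists>M k c. wf_tm M \<and>
    (\<forall>(I :: (nat, nat) inst) r h. ftm_rm_input I r h \<longrightarrow>
       (let w = encode I r h;
            q = fst (tm_run M (c * (length w + 1) ^ k) w)
        in (q = 1 \<or> q = 2) \<and> (q = 1 \<longleftrightarrow> finalizable I r h)))"
proof -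
  have "\<exists>M k. wf_tm M \<and> (\<forall>w. w \<noteq> [] \<longrightarrow> set w \<subseteq> {1, 2, 3} \<longrightarrow>
      fst (tm_run M (k * (length w + 1) ^ k) w)
        = (if query_safe w (lfp (\<lambda>X. {z. z \<le> length w \<and> exhaust_step w X z})) then 1 else 2))"
    by (rule least_fixed_point_decidable[OF definable_exhaust_step definable_query_safe])
      (rule exhaust_step_mono)
  then obtain M k where "wf_tm M" and dec: "\<And>w. w \<noteq> [] \<Longrightarrow> set w \<subseteq> {1, 2, 3} \<Longrightarrow>
      fst (tm_run M (k * (length w + 1) ^ k) w)
        = (if query_safe w (lfp (\<lambda>X. {z. z \<le> length w \<and> exhaust_step w X z})) then 1 else 2)"
    by blast
  have "let w = encode I r h; q = fst (tm_run M (k * (length w + 1) ^ k) w)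
      in (q = 1 \<or> q = 2) \<and> (q = 1 \<longleftrightarrow> finalizable I r h)" if "ftm_rm_input I r h" for I r h
    using dec[OF word_alphabet[OF that]] query_safe_finalizable[OF that] by (simp add: Let_def)
  \<comment> \<open>\<open>k\<close> serves both as the exponent and as the factor
    \<open>c\<close>.\<close>
  then show ?thesis
    using \<open>wf_tm M\<close> by blast
qed

end
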